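(* Let $u\in\mathcal{D}$. Then $W^u$ is $\nu$-a.s. invertible if and only if $$H(W^u\nu|\nu)=\frac12\mathbb{E}_\nu\left[|u|_H^2\right].$$
   Context: Notation. Let $n\ge 1$, $\mathbb{W}=C([0,1],\mathbb{R}^n)$, $H=\{\int_0^\cdot\dot h(s)ds:\dot h\in L^2([0,1],\mathbb{R}^n)\}$ with $|h|_H^2=\int_0^1|\dot h(s)|^2ds$. $W=(W(t))_{t\in[0,1]}$ is the coordinate process on $\mathbb{W}$ (so, as a map, $W=I_{\mathbb{W}}$, the identity). $\nu$ is a probability measure on $\mathbb{W}$; all filtrations are completed with respect to $\nu$, and $(\mathcal{F}_t)$ is the filtration of $W$. For $p\ge 0$, $L^p_a(\nu,H)$ is the set of $u\in L^p(\nu,H)$ whose density $\dot u$ is $(\mathcal{F}_t)$-adapted ($L^0$: all measurable maps). $\mathcal{D}=\{u\in L^0_a(\nu,H):\dot u \text{ is } d\nu\times dt\text{-a.s. bounded}\}$. For a $\nu$-Brownian motion $\beta$, $\delta_\beta u=\int_0^1\dot u(s)d\beta(s)$ and $\rho(-\delta_\beta u)=\exp\left(-\int_0^1\dot u(s)d\beta(s)-\frac12\int_0^1|\dot u(s)|^2ds\right)$. $U\nu$ denotes the image measure of $\nu$ under $U$. For $\theta\ll\nu$, $H(\theta|\nu)=\mathbb{E}_\nu\left[\frac{d\theta}{d\nu}\log\frac{d\theta}{d\nu}\right]$. Standing assumption. There are an $\mathbb{R}^n$-valued $\nu$-Brownian motion $\beta$ defined on $\mathbb{W}$ and a family $(W^u)_{u\in\mathcal{D}}$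 of continuous processes on $\mathbb{W}$ (i.e. measurable maps $W^u:\mathbb{W}\to\mathbb{W}$) such that: (i) the canonical (completed) filtration of $\beta$ equals that of $W$; (ii) $W^0=W$; (iii) for every $u\in\mathcal{D}$, the law of $W^u$ under $\tilde\nu^u$, where $\frac{d\tilde\nu^u}{d\nu}=\rho(-\delta_\beta u)$, equals the law of $W$ under $\nu$; (iv) for every $u\in\mathcal{D}$, $\beta\circ W^u=\beta+u$ $\nu$-a.s.; (v) for all $u,v\in\mathcal{D}$, $W^u\circ W^v=W^{v+u\circ W^v}$ $\nu$-a.s. (These imply $W^u\nu\sim\nu$ for $u\in\mathcal{D}$.) A measurable map $U:\mathbb{W}\to\mathbb{W}$ with $U\nu\sim\nu$ is called $\nu$-a.s. invertible if there is a measurable $V:\mathbb{W}\to\mathbb{W}$ with $V\nu\ll\nu$ and $V\circ U=I_{\mathbb{W}}$ $\nu$-a.s. (then also $U\circ V=I_{\mathbb{W}}$ $\nu$-a.s.). *)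

theory Defs
  imports "HOL-Probability.Probability"
begin

(* C([0,1], R^n) with the sigma-algebra generated by the coordinate maps, which is the Borel
   sigma-algebra of the uniform norm. Paths are extensional: they are undefined off [0,1]. *)
definition path_space :: "(real \<Rightarrow> real ^ 'n::finite) measure" where
  "path_space = restrict_space (PiM {0..1} (\<lambda>_. borel)) {w. continuous_on {0..1} w}"

definition zero_path :: "real \<Rightarrow> real ^ 'n::finite" where
  "zero_path = (\<lambda>t\<in>{0..1}. 0)"

definition path_add ::
  "(real \<Rightarrow> real ^ 'n::finite) \<Rightarrow> (real \<Rightarrow> real ^ 'n) \<Rightarrow> (real \<Rightarrow> real ^ 'n)"
  where "path_add h k = (\<lambda>t\<in>{0..1}. h t + k t)"


definition has_density :: "(real \<Rightarrow> real ^ 'n::finite) \<Rightarrow> (real \<Rightarrow> real ^ 'n) \<Rightarrow> bool" where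
  "has_density h g \<longleftrightarrow>
     set_borel_measurable lborel {0..1} g \<and>
     set_integrable lborel {0..1} (\<lambda>s. (norm (g s))\<^sup>2) \<and>
     h = (\<lambda>t\<in>{0..1}. LINT s:{0..t}|lborel. g s)"

definition cameron_martin :: "(real \<Rightarrow> real ^ 'n::finite) set" where
  "cameron_martin = {h. \<exists>g. has_density h g}"

(* A density is unique up to Lebesgue-null sets, so the choice does not affect the value. *)
definition cm_norm_sq :: "(real \<Rightarrow> real ^ 'n::finite) \<Rightarrow> real" where
  "cm_norm_sq h = (LINT s:{0..1}|lborel. (norm ((SOME g. has_density h g) s))\<^sup>2)"


(* Processes are maps X from paths to paths, X w t being the value at time t.
   A measure \<nu> lives on path_space, and "measurable" means measurable from completion \<nu>. *)
definition past_events ::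
  "(real \<Rightarrow> real ^ 'n::finite) measure \<Rightarrow> ((real \<Rightarrow> real ^ 'n) \<Rightarrow> (real \<Rightarrow> real ^ 'n)) \<Rightarrow> real
    \<Rightarrow> (real \<Rightarrow> real ^ 'n) set set"
  where "past_events \<nu> X t =
    (\<Union>s\<in>{0..t}. {(\<lambda>w. X w s) -` A \<inter> space \<nu> |A. A \<in> sets borel})"

definition completed_filtration ::
  "(real \<Rightarrow> real ^ 'n::finite) measure \<Rightarrow> ((real \<Rightarrow> real ^ 'n) \<Rightarrow> (real \<Rightarrow> real ^ 'n)) \<Rightarrow> real
    \<Rightarrow> (real \<Rightarrow> real ^ 'n) measure"
  where "completed_filtration \<nu> X t =
    sigma (space \<nu>) (past_events \<nu> X t \<union> null_sets (completion \<nu>))"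

abbreviation canonical_filtration ::
  "(real \<Rightarrow> real ^ 'n::finite) measure \<Rightarrow> real \<Rightarrow> (real \<Rightarrow> real ^ 'n) measure"
  where "canonical_filtration \<nu> \<equiv> completed_filtration \<nu> (\<lambda>w. w)"

definition brownian_motion ::
  "(real \<Rightarrow> real ^ 'n::finite) measure \<Rightarrow> ((real \<Rightarrow> real ^ 'n) \<Rightarrow> (real \<Rightarrow> real ^ 'n)) \<Rightarrow> bool"
  where "brownian_motion \<nu> \<beta> \<longleftrightarrow>
    \<beta> \<in> measurable (completion \<nu>) path_space \<and>
    (AE w in \<nu>. \<beta> w 0 = 0) \<and>
    (\<forall>s t. 0 \<le> s \<and> s < t \<and> t \<le> 1 \<longrightarrow>
       distributed (completion \<nu>) lborel (\<lambda>w. \<beta> w t - \<beta> w s)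
         (\<lambda>x. ennreal (\<Prod>i\<in>UNIV. normal_density 0 (sqrt (t - s)) (x $ i))) \<and>
       prob_space.indep_set (completion \<nu>)
         (sigma_sets (space \<nu>) (past_events \<nu> \<beta> s))
         {(\<lambda>w. \<beta> w t - \<beta> w s) -` A \<inter> space \<nu> |A. A \<in> sets borel})"


definition adapted_density ::
  "(real \<Rightarrow> real ^ 'n::finite) measure \<Rightarrow> ((real \<Rightarrow> real ^ 'n) \<Rightarrow> (real \<Rightarrow> real ^ 'n))
    \<Rightarrow> ((real \<Rightarrow> real ^ 'n) \<Rightarrow> real \<Rightarrow> real ^ 'n) \<Rightarrow> bool"
  where "adapted_density \<nu> u du \<longleftrightarrow>
    case_prod du \<in> borel_measurable (completion \<nu> \<Otimes>\<^sub>M restrict_space lborel {0..1}) \<and>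
    (\<forall>t\<in>{0..1}. (\<lambda>w. du w t) \<in> borel_measurable (canonical_filtration \<nu> t)) \<and>
    (AE w in \<nu>. has_density (u w) (du w))"

(* Measurability into the Cameron-Martin space H is measurability as a path-valued map: the Borel
   sigma-algebra of the separable Hilbert space H is the trace on H of that of path_space. *)
definition adapted_L0 ::
  "(real \<Rightarrow> real ^ 'n::finite) measure \<Rightarrow> ((real \<Rightarrow> real ^ 'n) \<Rightarrow> (real \<Rightarrow> real ^ 'n)) set"
  where "adapted_L0 \<nu> =
    {u \<in> measurable (completion \<nu>) path_space.
       (\<forall>w\<in>space \<nu>. u w \<in> cameron_martin) \<and> (\<exists>du. adapted_density \<nu> u du)}"

definition bounded_drifts ::
  "(real \<Rightarrow> real ^ 'n::finite) measure \<Rightarrow> ((real \<Rightarrow> real ^ 'n) \<Rightarrow> (real \<Rightarrow> real ^ 'n)) set"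
  where "bounded_drifts \<nu> =
    {u \<in> adapted_L0 \<nu>. \<exists>du C. adapted_density \<nu> u du \<and>
       (AE p in completion \<nu> \<Otimes>\<^sub>M restrict_space lborel {0..1}. norm (case_prod du p) \<le> C)}"


(* Ito integral over [0,1] of an R^n-valued integrand: the L^2 limit of the elementary integrals
   of simple processes sum_i xi_i 1_(t_i, t_(i+1)], with bounded xi_i known at time t_i. *)
definition simple_integrand ::
  "(real \<Rightarrow> real ^ 'n::finite) measure \<Rightarrow> nat \<Rightarrow> (nat \<Rightarrow> real)
    \<Rightarrow> (nat \<Rightarrow> (real \<Rightarrow> real ^ 'n) \<Rightarrow> real ^ 'n) \<Rightarrow> bool"
  where "simple_integrand \<nu> k t \<xi> \<longleftrightarrow>
    t 0 = 0 \<and> t k = 1 \<and> (\<forall>i<k. t i < t (Suc i)) \<and>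
    (\<forall>i<k. \<xi> i \<in> borel_measurable (canonical_filtration \<nu> (t i)) \<and>
           (\<exists>C. \<forall>w\<in>space \<nu>. norm (\<xi> i w) \<le> C))"

definition simple_process ::
  "nat \<Rightarrow> (nat \<Rightarrow> real) \<Rightarrow> (nat \<Rightarrow> (real \<Rightarrow> real ^ 'n::finite) \<Rightarrow> real ^ 'n)
    \<Rightarrow> (real \<Rightarrow> real ^ 'n) \<Rightarrow> real \<Rightarrow> real ^ 'n"
  where "simple_process k t \<xi> w s = (\<Sum>i<k. indicator {t i<..t (Suc i)} s *\<^sub>R \<xi> i w)"

definition simple_integral ::
  "((real \<Rightarrow> real ^ 'n::finite) \<Rightarrow> (real \<Rightarrow> real ^ 'n)) \<Rightarrow> nat \<Rightarrow> (nat \<Rightarrow> real)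
    \<Rightarrow> (nat \<Rightarrow> (real \<Rightarrow> real ^ 'n) \<Rightarrow> real ^ 'n) \<Rightarrow> (real \<Rightarrow> real ^ 'n) \<Rightarrow> real"
  where "simple_integral \<beta> k t \<xi> w = (\<Sum>i<k. \<xi> i w \<bullet> (\<beta> w (t (Suc i)) - \<beta> w (t i)))"

definition has_ito_integral ::
  "(real \<Rightarrow> real ^ 'n::finite) measure \<Rightarrow> ((real \<Rightarrow> real ^ 'n) \<Rightarrow> (real \<Rightarrow> real ^ 'n))
    \<Rightarrow> ((real \<Rightarrow> real ^ 'n) \<Rightarrow> real \<Rightarrow> real ^ 'n) \<Rightarrow> ((real \<Rightarrow> real ^ 'n) \<Rightarrow> real) \<Rightarrow> bool"
  where "has_ito_integral \<nu> \<beta> \<phi> I \<longleftrightarrow>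
    I \<in> borel_measurable (completion \<nu>) \<and>
    (\<exists>k t \<xi>. (\<forall>m. simple_integrand \<nu> (k m) (t m) (\<xi> m)) \<and>
      (\<lambda>m. \<integral>\<^sup>+ w. (\<integral>\<^sup>+ s\<in>{0..1}. ennreal ((norm (simple_process (k m) (t m) (\<xi> m) w s - \<phi> w s))\<^sup>2)
                      \<partial>lborel) \<partial>completion \<nu>) \<longlonglongrightarrow> 0 \<and>
      (\<lambda>m. \<integral>\<^sup>+ w. ennreal ((simple_integral \<beta> (k m) (t m) (\<xi> m) w - I w)\<^sup>2)
             \<partial>completion \<nu>) \<longlonglongrightarrow> 0)"

(* For u in bounded_drifts, such an I exists and is unique up to \<nu>-null sets. *)
definition ito_delta ::
  "(real \<Rightarrow> real ^ 'n::finite) measure \<Rightarrow> ((real \<Rightarrow> real ^ 'n) \<Rightarrow> (real \<Rightarrow> real ^ 'n))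
    \<Rightarrow> ((real \<Rightarrow> real ^ 'n) \<Rightarrow> (real \<Rightarrow> real ^ 'n)) \<Rightarrow> (real \<Rightarrow> real ^ 'n) \<Rightarrow> real"
  where "ito_delta \<nu> \<beta> u =
    (SOME I. \<exists>du. adapted_density \<nu> u du \<and> has_ito_integral \<nu> \<beta> du I)"

(* The Girsanov density rho(-delta_beta u). *)
definition girsanov_density ::
  "(real \<Rightarrow> real ^ 'n::finite) measure \<Rightarrow> ((real \<Rightarrow> real ^ 'n) \<Rightarrow> (real \<Rightarrow> real ^ 'n))
    \<Rightarrow> ((real \<Rightarrow> real ^ 'n) \<Rightarrow> (real \<Rightarrow> real ^ 'n)) \<Rightarrow> (real \<Rightarrow> real ^ 'n) \<Rightarrow> real"
  where "girsanov_density \<nu> \<beta> u w = exp (- ito_delta \<nu> \<beta> u w - cm_norm_sq (u w) / 2)"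


definition image_law ::
  "(real \<Rightarrow> real ^ 'n::finite) measure \<Rightarrow> ((real \<Rightarrow> real ^ 'n) \<Rightarrow> (real \<Rightarrow> real ^ 'n))
    \<Rightarrow> (real \<Rightarrow> real ^ 'n) measure"
  where "image_law \<mu> U = distr \<mu> path_space U"

definition as_invertible ::
  "(real \<Rightarrow> real ^ 'n::finite) measure \<Rightarrow> ((real \<Rightarrow> real ^ 'n) \<Rightarrow> (real \<Rightarrow> real ^ 'n)) \<Rightarrow> bool"
  where "as_invertible \<nu> U \<longleftrightarrow>
    U \<in> measurable (completion \<nu>) path_space \<and>
    absolutely_continuous \<nu> (image_law (completion \<nu>) U) \<and>
    absolutely_continuous (image_law (completion \<nu>) U) \<nu> \<and>
    (\<exists>V \<in> measurable (completion \<nu>) path_space.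
       absolutely_continuous \<nu> (image_law (completion \<nu>) V) \<and>
       (AE w in \<nu>. V (U w) = w))"

(* E[L log L] with L = d\<theta>/d\<nu>, as positive minus negative part so that it may be infinite
   (the library's KL_divergence is 0 when the integral diverges). The negative part is at most
   1/e for a probability measure \<nu>, and 0 * ln 0 = 0. *)
definition rel_entropy :: "'a measure \<Rightarrow> 'a measure \<Rightarrow> ereal" where
  "rel_entropy \<theta> \<nu> =
    (let f = (\<lambda>x. enn2real (RN_deriv \<nu> \<theta> x) * ln (enn2real (RN_deriv \<nu> \<theta> x)))
     in enn2ereal (\<integral>\<^sup>+ x. ennreal (f x) \<partial>\<nu>) - enn2ereal (\<integral>\<^sup>+ x. ennreal (- f x) \<partial>\<nu>))"

end

theory Submission
  imports Defs
begin

text \<open>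
  Write \<open>X = \<beta> + u = \<beta> \<circ> W\<^sup>u\<close>, \<open>P = \<rho>(-\<delta>u) \<nu>\<close> and \<open>L = d(W\<^sup>u\<nu>)/d\<nu>\<close>. By (iii), \<open>\<rho>(-\<delta>u) L(W\<^sup>u)\<close>
  has \<open>\<nu>\<close>-mean 1, so with \<open>K = log L(W\<^sup>u)\<close> and \<open>R = - log \<rho>(-\<delta>u)\<close>, whose mean is \<open>E|u|\<^sup>2/2\<close>, the bound
  \<open>exp x \<ge> 1 + x\<close> at \<open>x = K - R\<close> gives \<open>E K \<le> E R\<close>, with equality iff \<open>K = R\<close> almost surely. As
  \<open>E K\<close> is the entropy, it remains to see that \<open>K = R\<close> iff \<open>W\<^sup>u\<close> is invertible.

  If \<open>W\<^sup>u\<close> is invertible, every event is a preimage under \<open>W\<^sup>u\<close> up to null sets, and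
  \<open>\<rho>(-\<delta>u) L(W\<^sup>u)\<close> has mean 1 on every such preimage.

  Conversely, if \<open>K = R\<close> then \<open>\<rho>(-\<delta>u)\<close> is measurable for \<open>X\<close>. Applying (iii) and (iv) to \<open>u\<close> plus
  steps \<open>1\<^sub>A x 1\<^bsub>(t,T]\<^esub>\<close> with \<open>A\<close> in \<open>F\<^sub>t\<close> shows that under \<open>P\<close> the increments of \<open>X\<close> after \<open>t\<close> are
  independent of \<open>F\<^sub>t\<close>. Hence, given the past of \<open>X\<close> at \<open>t\<close>, all of \<open>X\<close> is independent of \<open>F\<^sub>t\<close> under \<open>P\<close>, and also
  under \<open>\<nu>\<close> since the density between them is a function of \<open>X\<close>. So the conditional expectation of
  \<open>u(T) - u(t)\<close> given \<open>F\<^sub>t\<close>, which is that of \<open>X(T) - X(t)\<close>, is a function of \<open>X\<close>. Sums of these over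
  fine partitions converge to \<open>u\<close> because \<open>u\<close> is Lipschitz in time and martingale differences are
  orthogonal; thus \<open>u\<close>, then \<open>\<beta> = X - u\<close>, and then the path itself are functions of \<open>X\<close>, hence of \<open>W\<^sup>u\<close>.
\<close>

section \<open>Completed sub-sigma-algebras and path space\<close>

text \<open>The drift is adapted to the filtration of the path, which is a priori larger than that
  of \<open>X\<close>; what the inverse demands is that the two agree at time 1. Under
  \<open>P\<close> the conditioning is transparent, because (iii) and (iv) make \<open>X\<close> a
  Brownian motion there, even relative to the larger filtration. This relation between the two
  filtrations (immersion) survives a change of measure whose density belongs to the smaller one, and
  that is where \<open>K = R\<close> is spent.

  The independence under \<open>P\<close> is obtained from step perturbations: adding a step to
  \<open>u\<close> adds a single interval to the stochastic integral, so the new Girsanov density is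
  explicit. This presupposes control of the integral itself, which \<open>ito_delta\<close> selects
  by choice from a set of L2 limits; hence the isometry, the uniqueness of densities and an adapted
  approximation of the drift. All filtrations are completed, so that almost sure identities turn
  into measurability.\<close>

lemma measurable_completed_cong:
  assumes F: "space F = space M" "null_sets (completion M) \<subseteq> sets F"
    and f: "f \<in> measurable F K" and eq: "AE x in M. f x = g x"
    and g: "g \<in> space M \<rightarrow> space K"
  shows "g \<in> measurable F K"
proof (rule measurableI)
  fix x assume "x \<in> space F" then show "g x \<in> space K" using g F by auto
next
  fix B assume B: "B \<in> sets K"
  from eq obtain E where E: "E \<in> null_sets M" "{x \<in> space M. f x \<noteq> g x} \<subseteq> E"
    by (auto simp: eventually_ae_filter)
  \<comment> \<open>Completeness of \<open>F\<close> enters here: every subset of the exceptional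
    null set lies in \<open>F\<close>, so the preimages under \<open>f\<close> and \<open>g\<close>
    differ by members of \<open>F\<close>.\<close>
  have sub: "C \<in> sets F" if "C \<subseteq> E" for C
    using F(2) E that null_sets_completion_iff2[of C M] by blast
  have "g -` B \<inter> space F = (f -` B \<inter> space F - {x \<in> space M. f x \<noteq> g x}) \<union>
      (g -` B \<inter> {x \<in> space M. f x \<noteq> g x})"
    using F(1) by auto
  moreover have "{x \<in> space M. f x \<noteq> g x} \<in> sets F" "g -` B \<inter> {x \<in> space M. f x \<noteq> g x} \<in> sets F"
    using E by (auto intro!: sub)
  ultimately show "g -` B \<inter> space F \<in> sets F"
    using measurable_sets[OF f B] by auto
qed

text \<open>The sets agreeing almost everywhere with a member of
  \<open>sigma_sets (space M) E\<close> are closed under complements and countable unions, and a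
  null set agrees with the empty set. \<open>brownian_motion\<close> asserts independence for the
  uncompleted past; this carries it over to the completed one.\<close>

lemma sigma_sets_null_approx:
  assumes "A \<in> sigma_sets (space M) (E \<union> null_sets (completion M))"
  shows "\<exists>B\<in>sigma_sets (space M) E. AE x in M. x \<in> A \<longleftrightarrow> x \<in> B"
  using assms
proof induction
  case (Basic a)
  show ?case
  proof (cases "a \<in> E")
    case True then show ?thesis by (auto intro!: bexI[of _ a])
  next
    case False
    with Basic have "AE x in completion M. x \<notin> a" by (auto intro: AE_not_in)
    then show ?thesis
      by (auto intro!: bexI[of _ "{}"] sigma_sets.Empty simp: AE_completion_iff)
  qed
next
  case Empty show ?case by (auto intro!: bexI[of _ "{}"] sigma_sets.Empty)
next
  case (Compl a)
  then obtain B where B: "B \<in> sigma_sets (space M) E" "AE x in M. x \<in> a \<longleftrightarrow> x \<in> B" by auto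
  then have "AE x in M. x \<in> space M - a \<longleftrightarrow> x \<in> space M - B" by auto
  with B show ?case by (auto intro!: bexI[of _ "space M - B"] sigma_sets.Compl)
next
  case (Union a)
  then have "\<forall>i. \<exists>B. B \<in> sigma_sets (space M) E \<and> (AE x in M. x \<in> a i \<longleftrightarrow> x \<in> B)" by auto
  then obtain B where B: "\<And>i. B i \<in> sigma_sets (space M) E"
    "\<And>i. AE x in M. x \<in> a i \<longleftrightarrow> x \<in> B i" by metis
  then have "AE x in M. \<forall>i::nat. x \<in> a i \<longleftrightarrow> x \<in> B i" by (simp add: AE_all_countable)
  then have "AE x in M. x \<in> (\<Union>i. a i) \<longleftrightarrow> x \<in> (\<Union>i. B i)" by auto
  with B show ?case by (auto intro!: bexI[of _ "\<Union>i. B i"] sigma_sets.Union)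
qed

section \<open>Path space and completed filtrations\<close>

lemma space_path_space:
  "space path_space = {w. w \<in> extensional {0..1} \<and> continuous_on {0..1} w}"
  unfolding path_space_def by (auto simp: space_restrict_space space_PiM PiE_def Pi_def)

lemma measurable_path_space_iff:
  "f \<in> measurable M path_space \<longleftrightarrow>
    f \<in> space M \<rightarrow> space path_space \<and> (\<forall>t\<in>{0..1}. (\<lambda>x. f x t) \<in> borel_measurable M)"
proof -
  have "f \<in> measurable M path_space \<longleftrightarrow> f \<in> space M \<rightarrow> space path_space
      \<and> f \<in> measurable M (PiM {0..1} (\<lambda>_. borel))"
    unfolding path_space_def space_path_space[unfolded path_space_def]
    by (subst measurable_restrict_space2_iff) (auto simp: measurable_def space_PiM PiE_def Pi_iff)
  also have "\<dots> \<longleftrightarrow> f \<in> space M \<rightarrow> space path_space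
      \<and> (\<forall>t\<in>{0..1}. (\<lambda>x. f x t) \<in> borel_measurable M)"
  proof (intro conj_cong refl iffI)
    assume "f \<in> measurable M (PiM {0..1} (\<lambda>_. borel))"
    then show "\<forall>t\<in>{0..1}. (\<lambda>x. f x t) \<in> borel_measurable M"
      by (auto intro: measurable_compose[OF _ measurable_component_singleton])
  next
    assume s: "f \<in> space M \<rightarrow> space path_space"
      and "\<forall>t\<in>{0..1}. (\<lambda>x. f x t) \<in> borel_measurable M"
    then show "f \<in> measurable M (PiM {0..1} (\<lambda>_. borel))"
      by (intro measurable_PiM_single') (auto simp: space_path_space PiE_def)
  qed
  finally show ?thesis .
qed

lemma measurable_path_coord:
  "f \<in> measurable M path_space \<Longrightarrow> t \<in> {0..1} \<Longrightarrow> (\<lambda>x. f x t) \<in> borel_measurable M"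
  by (auto simp: measurable_path_space_iff)

lemma path_add_path_space:
  assumes "h \<in> space path_space" "k \<in> space path_space"
  shows "path_add h k \<in> space path_space"
proof -
  have "continuous_on {0..1} (\<lambda>t. h t + k t)"
    using assms unfolding space_path_space by (intro continuous_on_add) auto
  then have "continuous_on {0..1} (path_add h k)"
    by (rule continuous_on_eq) (simp add: path_add_def)
  then show ?thesis by (simp add: space_path_space path_add_def)
qed

lemma path_add_measurable:
  assumes f: "f \<in> measurable M path_space" and g: "g \<in> measurable M path_space"
  shows "(\<lambda>w. path_add (f w) (g w)) \<in> measurable M path_space"
  unfolding measurable_path_space_iff
proof (intro conjI ballI funcsetI)
  fix w assume "w \<in> space M"
  then show "path_add (f w) (g w) \<in> space path_space"
    using measurable_space[OF f] measurable_space[OF g] by (intro path_add_path_space) auto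
next
  fix t :: real assume "t \<in> {0..1}"
  then show "(\<lambda>w. path_add (f w) (g w) t) \<in> borel_measurable M"
    using measurable_path_coord[OF f] measurable_path_coord[OF g] by (simp add: path_add_def)
qed

locale path_prob = prob_space \<nu> for \<nu> :: "(real \<Rightarrow> real ^ 'n::finite) measure" +
  assumes sets_nu: "sets \<nu> = sets path_space"
begin

abbreviation "N \<equiv> completion \<nu>"

sublocale N: prob_space N
  by (rule prob_spaceI) (simp add: emeasure_space_1)

lemma space_nu: "space \<nu> = space path_space"
  using sets_nu by (rule sets_eq_imp_space_eq)

lemma id_N: "(\<lambda>w. w) \<in> measurable N path_space"
  using sets_nu by (intro measurable_completion) (simp cong: measurable_cong_sets)

lemma space_filtration [simp]: "space (completed_filtration \<nu> X t) = space \<nu>"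
  unfolding completed_filtration_def by (rule space_measure_of_conv)

lemma sets_filtration: 
  "sets (completed_filtration \<nu> X t) = sigma_sets (space \<nu>) (past_events \<nu> X t \<union> null_sets N)"
  unfolding completed_filtration_def
  by (rule sets_measure_of) (auto simp: past_events_def dest!: null_setsD2 sets.sets_into_space)

lemma filtration_null: "null_sets N \<subseteq> sets (completed_filtration \<nu> X t)"
  unfolding sets_filtration by auto

lemma filtration_coord:
  "s \<in> {0..t} \<Longrightarrow> (\<lambda>w. X w s) \<in> borel_measurable (completed_filtration \<nu> X t)"
  by (rule measurableI) (auto simp: sets_filtration past_events_def intro!: sigma_sets.Basic)

text \<open>Minimality of the generated sigma-algebra. Inclusions between filtrations reduce through
  it to a check of coordinates and null sets.\<close>

lemma filtration_least:
  assumes "space M = space \<nu>" "null_sets N \<subseteq> sets M"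
    and X: "\<And>s. s \<in> {0..t} \<Longrightarrow> (\<lambda>w. X w s) \<in> borel_measurable M"
  shows "sets (completed_filtration \<nu> X t) \<subseteq> sets M"
  unfolding sets_filtration assms(1)[symmetric]
  using assms(2) measurable_sets[OF X] assms(1)
  by (intro sets.sigma_sets_subset) (auto simp: past_events_def)

lemma filtration_mono:
  "s \<le> t \<Longrightarrow> sets (completed_filtration \<nu> X s) \<subseteq> sets (completed_filtration \<nu> X t)"
  by (intro filtration_least filtration_null filtration_coord) auto

lemma filtration_subalgebra:
  assumes "X \<in> measurable N path_space" "t \<le> 1"
  shows "subalgebra N (completed_filtration \<nu> X t)"
  unfolding subalgebra_def
  using filtration_least[of N t X] measurable_path_coord[OF assms(1)] assms(2) by auto

lemma filtration_measurable_mono: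
  "f \<in> measurable (completed_filtration \<nu> X s) K \<Longrightarrow> s \<le> t \<Longrightarrow>
    f \<in> measurable (completed_filtration \<nu> X t) K"
  using filtration_mono[of s t X] by (auto simp: measurable_def)

lemma filtration_cong:
  fixes f :: "_ \<Rightarrow> 'b::topological_space"
  shows "f \<in> borel_measurable (completed_filtration \<nu> X t) \<Longrightarrow> AE w in \<nu>. f w = g w \<Longrightarrow>
    g \<in> borel_measurable (completed_filtration \<nu> X t)"
  by (rule measurable_completed_cong[of _ \<nu>]) (auto intro: filtration_null[THEN subsetD])

lemma filtration_sigma_finite:
  assumes "X \<in> measurable N path_space" "t \<le> 1"
  shows "sigma_finite_subalgebra N (completed_filtration \<nu> X t)"
  by (intro finite_measure_subalgebra_is_sigma_finite finite_measure_subalgebra.intro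
      finite_measure_subalgebra_axioms.intro filtration_subalgebra assms N.finite_measure_axioms)

lemmas canonical_subalgebra = filtration_subalgebra[OF id_N]

lemma canonical_imp_N: "t \<le> 1 \<Longrightarrow> f \<in> measurable (canonical_filtration \<nu> t) K \<Longrightarrow> f \<in> measurable N K"
  using measurable_from_subalg[OF canonical_subalgebra] by auto

end

section \<open>Moments and independence\<close>

text \<open>Lebesgue measure on \<open>real ^ 'n\<close> is the image of a product indexed by the
  basis vectors \<open>axis i 1\<close>; after reindexing, this is the product formula for finite
  product measures.\<close>

lemma integral_lborel_vec_prod:
  fixes f :: "'n::finite \<Rightarrow> real \<Rightarrow> real"
  assumes f: "\<And>i. integrable lborel (f i)"
  shows "integrable lborel (\<lambda>x :: real ^ 'n. \<Prod>i\<in>UNIV. f i (x $ i))" (is ?int)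
    and "(\<integral>x. (\<Prod>i\<in>UNIV. f i (x $ i)) \<partial>(lborel :: (real ^ 'n) measure)) = (\<Prod>i\<in>UNIV. \<integral>x. f i x \<partial>lborel)" (is ?eq)
proof -
  let ?ax = "\<lambda>i :: 'n. axis i 1 :: real ^ 'n"
  \<comment> \<open>The factors are transported from the index type to the basis, over which the
    product measure is formed.\<close>
  define g where "g b = f (inv ?ax b)" for b
  have inj: "inj ?ax" by (auto intro!: injI simp: axis_eq_axis)
  then have g: "g (?ax i) = f i" for i using inv_f_f[OF inj] by (simp add: g_def)
  have B: "Basis = range ?ax" by (auto simp: Basis_vec_def)
  interpret product_sigma_finite "\<lambda>b :: real ^ 'n. lborel :: real measure" ..
  have gi: "integrable lborel (g b)" for b by (simp add: g_def f)
  have [measurable]: "f i \<in> borel_measurable borel" for i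
    using borel_measurable_integrable[OF f] by simp
  have eq: "(\<Prod>i\<in>UNIV. f i ((\<Sum>b\<in>Basis. w b *\<^sub>R b) $ i)) = (\<Prod>b\<in>Basis. g b (w b))" for w
  proof -
    have "(\<Sum>b\<in>Basis. w b *\<^sub>R b) $ i = w (?ax i)" for i
      using inner_sum_left_Basis[of "?ax i" w] by (simp add: B inner_axis)
    then show ?thesis unfolding B by (subst prod.reindex) (use inj in \<open>auto simp: g intro: inj_on_subset\<close>)
  qed
  have "integrable (PiM Basis (\<lambda>_. lborel)) (\<lambda>w. \<Prod>b\<in>Basis. g b (w b))"
    by (intro product_integrable_prod gi) auto
  then show ?int
    unfolding lborel_def[where 'a = "real ^ 'n"]
    by (subst integrable_distr_eq) (auto simp: eq lborel_eq_real[symmetric] simp del: sum_component)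
  have "(\<integral>x. (\<Prod>i\<in>UNIV. f i (x $ i)) \<partial>(lborel :: (real ^ 'n) measure)) =
      (\<integral>w. (\<Prod>b\<in>Basis. g b (w b)) \<partial>PiM Basis (\<lambda>_. lborel))"
    unfolding lborel_def[where 'a = "real ^ 'n"]
    by (subst integral_distr) (auto simp: eq lborel_eq_real[symmetric] simp del: sum_component)
  also have "\<dots> = (\<Prod>b\<in>Basis. integral\<^sup>L lborel (g b))"
    by (intro product_integral_prod gi) auto
  also have "\<dots> = (\<Prod>i\<in>UNIV. \<integral>x. f i x \<partial>lborel)"
    unfolding B by (subst prod.reindex) (use inj in \<open>auto simp: g intro: inj_on_subset\<close>)
  finally show ?eq .
qed

lemma integrable_mult_sq:
  fixes f g :: "'a \<Rightarrow> real"
  assumes [measurable]: "f \<in> borel_measurable M" "g \<in> borel_measurable M"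
    and "integrable M (\<lambda>x. (f x)\<^sup>2)" "integrable M (\<lambda>x. (g x)\<^sup>2)"
  shows "integrable M (\<lambda>x. f x * g x)"
proof (rule Bochner_Integration.integrable_bound)
  show "integrable M (\<lambda>x. (f x)\<^sup>2 + (g x)\<^sup>2)" using assms by auto
  have "\<bar>a * b\<bar> \<le> \<bar>a\<^sup>2 + b\<^sup>2\<bar>" for a b :: real
  proof -
    have "0 \<le> \<bar>a\<bar> * \<bar>b\<bar>" "2 * (\<bar>a\<bar> * \<bar>b\<bar>) \<le> a\<^sup>2 + b\<^sup>2"
      using sum_squares_bound[of "\<bar>a\<bar>" "\<bar>b\<bar>"] by auto
    then show ?thesis unfolding abs_mult by linarith
  qed
  then show "AE x in M. norm (f x * g x) \<le> norm ((f x)\<^sup>2 + (g x)\<^sup>2)" by auto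
qed auto

lemma integrable_add_sq:
  fixes f g :: "'a \<Rightarrow> real"
  assumes "f \<in> borel_measurable M" "g \<in> borel_measurable M"
    and "integrable M (\<lambda>x. (f x)\<^sup>2)" "integrable M (\<lambda>x. (g x)\<^sup>2)"
  shows "integrable M (\<lambda>x. (f x + g x)\<^sup>2)"
  using assms integrable_mult_sq[OF assms] by (auto simp: power2_sum mult.assoc)

lemma Int_stable_vimage: "Int_stable {X -` A \<inter> S |A. A \<in> sets K}"
proof (rule Int_stableI)
  fix a b assume "a \<in> {X -` A \<inter> S |A. A \<in> sets K}" "b \<in> {X -` A \<inter> S |A. A \<in> sets K}"
  then obtain A B where "A \<in> sets K" "B \<in> sets K" "a = X -` A \<inter> S" "b = X -` B \<inter> S" by auto
  then show "a \<inter> b \<in> {X -` A \<inter> S |A. A \<in> sets K}"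
    by (auto intro!: exI[of _ "A \<inter> B"])
qed

text \<open>Both families of preimages are closed under intersection, so independence on events
  extends to the sigma-algebras they generate and expectations factor. It serves twice: for
  increments of \<open>\<beta>\<close> under \<open>N\<close> and for increments of \<open>X\<close>
  under \<open>P\<close>.\<close>

lemma (in prob_space) indep_factor:
  fixes Y :: "'a \<Rightarrow> real"
  assumes F: "subalgebra M F" and Z[measurable]: "Z \<in> measurable M K"
    and ind: "\<And>A B. A \<in> sets F \<Longrightarrow> B \<in> sets K \<Longrightarrow>
      prob (A \<inter> (Z -` B \<inter> space M)) = prob A * prob (Z -` B \<inter> space M)"
    and Y: "Y \<in> borel_measurable F" "integrable M Y"
    and g[measurable]: "g \<in> borel_measurable K" and gi: "integrable M (\<lambda>x. g (Z x))"
  shows "integrable M (\<lambda>x. Y x * g (Z x))"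
    and "expectation (\<lambda>x. Y x * g (Z x)) = expectation Y * expectation (\<lambda>x. g (Z x))"
proof -
  have [measurable]: "Y \<in> borel_measurable M" using Y by auto
  let ?A = "{Y -` A \<inter> space M |A. A \<in> sets borel}"
  let ?B = "{(\<lambda>x. g (Z x)) -` A \<inter> space M |A. A \<in> sets borel}"
  have "indep_set ?A ?B"
  proof (rule indep_setI)
    fix a b assume a: "a \<in> ?A" and b: "b \<in> ?B"
    from a have a: "a \<in> sets F" using measurable_sets[OF Y(1)] F by (auto simp: subalgebra_def)
    from b obtain C where C: "C \<in> sets borel" "b = (\<lambda>x. g (Z x)) -` C \<inter> space M" by auto
    have b: "b = Z -` (g -` C \<inter> space K) \<inter> space M" 
      using measurable_space[OF Z] by (auto simp: C)
    show "prob (a \<inter> b) = prob a * prob b"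
      unfolding b using C by (intro ind a) auto
  qed auto
  moreover have "Int_stable ?A" "Int_stable ?B"
    by (rule Int_stable_vimage)+
  ultimately have "indep_var borel Y borel (\<lambda>x. g (Z x))"
    unfolding indep_var_eq by (auto intro!: indep_set_sigma_sets)
  from indep_var_integrable[OF this Y(2) gi] indep_var_lebesgue_integral[OF this Y(2) gi]
  show "integrable M (\<lambda>x. Y x * g (Z x))"
    "expectation (\<lambda>x. Y x * g (Z x)) = expectation Y * expectation (\<lambda>x. g (Z x))" by auto
qed

section \<open>Moments and martingale property of the Brownian increments\<close>

locale bm_space = path_prob \<nu> for \<nu> :: "(real \<Rightarrow> real ^ 'n::finite) measure" +
  fixes \<beta> :: "(real \<Rightarrow> real ^ 'n) \<Rightarrow> (real \<Rightarrow> real ^ 'n)"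
  assumes bm: "brownian_motion \<nu> \<beta>"
    and filtration_eq: "\<And>t. t \<in> {0..1} \<Longrightarrow>
          sets (completed_filtration \<nu> \<beta> t) = sets (canonical_filtration \<nu> t)"
begin

abbreviation "F \<equiv> canonical_filtration \<nu>"

lemma beta_meas: "\<beta> \<in> measurable N path_space"
  using bm unfolding brownian_motion_def by auto

lemma beta_coord [measurable]: "t \<in> {0..1} \<Longrightarrow> (\<lambda>w. \<beta> w t) \<in> borel_measurable N"
  by (rule measurable_path_coord[OF beta_meas])

lemma beta_adapted: "0 \<le> s \<Longrightarrow> s \<le> t \<Longrightarrow> t \<le> 1 \<Longrightarrow> (\<lambda>w. \<beta> w s) \<in> borel_measurable (F t)"
  using filtration_coord[of s t \<beta>] filtration_eq[of t]
  by (auto cong: measurable_cong_sets)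

lemma beta_incr_dist:
  assumes "0 \<le> s" "s < t" "t \<le> 1"
  shows "distributed N lborel (\<lambda>w. \<beta> w t - \<beta> w s)
         (\<lambda>x. ennreal (\<Prod>i\<in>UNIV. normal_density 0 (sqrt (t - s)) (x $ i)))"
  using bm assms unfolding brownian_motion_def by blast

text \<open>The Gaussian density of an increment is a product over the coordinates. Means and
  covariances follow by choosing one factor \<open>g i\<close> per coordinate.\<close>

lemma beta_incr_prod:
  fixes g :: "'n \<Rightarrow> real \<Rightarrow> real"
  assumes st: "0 \<le> s" "s < t" "t \<le> 1" and [measurable]: "\<And>i. g i \<in> borel_measurable borel"
    and g: "\<And>i. integrable lborel (\<lambda>x. normal_density 0 (sqrt (t - s)) x * g i x)"
  shows "integrable N (\<lambda>w. \<Prod>i\<in>UNIV. g i ((\<beta> w t - \<beta> w s) $ i))"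
    and "(\<integral>w. (\<Prod>i\<in>UNIV. g i ((\<beta> w t - \<beta> w s) $ i)) \<partial>N) =
       (\<Prod>i\<in>UNIV. \<integral>x. normal_density 0 (sqrt (t - s)) x * g i x \<partial>lborel)"
proof -
  note d = beta_incr_dist[OF st]
  have pos: "0 \<le> (\<Prod>i\<in>UNIV. normal_density 0 (sqrt (t - s)) (x $ i))" for x :: "real ^ 'n"
    by (intro prod_nonneg) (auto simp: normal_density_nonneg)
  note I = integral_lborel_vec_prod[OF g, unfolded prod.distrib]
  show "integrable N (\<lambda>w. \<Prod>i\<in>UNIV. g i ((\<beta> w t - \<beta> w s) $ i))"
    by (subst distributed_integrable[OF d, symmetric]) (auto simp: pos I)
  show "(\<integral>w. (\<Prod>i\<in>UNIV. g i ((\<beta> w t - \<beta> w s) $ i)) \<partial>N) =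
       (\<Prod>i\<in>UNIV. \<integral>x. normal_density 0 (sqrt (t - s)) x * g i x \<partial>lborel)"
    by (subst distributed_integral[OF d, symmetric]) (auto simp: pos I)
qed

lemma beta_incr_mean:
  assumes st: "0 \<le> s" "s \<le> t" "t \<le> 1"
  shows "integrable N (\<lambda>w. (\<beta> w t - \<beta> w s) $ j)" "(\<integral>w. (\<beta> w t - \<beta> w s) $ j \<partial>N) = 0"
proof -
  have "integrable N (\<lambda>w. (\<beta> w t - \<beta> w s) $ j) \<and> (\<integral>w. (\<beta> w t - \<beta> w s) $ j \<partial>N) = 0"
  proof (cases "s = t")
    case False
    then have st: "0 \<le> s" "s < t" "t \<le> 1" and pos: "0 < sqrt (t - s)" using st by auto
    define g where "g i x = (if i = j then x else 1)" for i and x :: real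
    have [measurable]: "g i \<in> borel_measurable borel" for i unfolding g_def by simp
    have eq: "(\<Prod>i\<in>UNIV. g i (x i)) = x j" for x
      unfolding g_def by simp
    have 1: "integrable lborel (\<lambda>x. normal_density 0 (sqrt (t - s)) x * g i x)" for i
      using integrable_normal_moment_nz_1[OF pos, of 0] integrable_normal_density[OF pos, of 0]
      by (cases "i = j") (auto simp: g_def)
    have "(\<Prod>i\<in>UNIV. \<integral>x. normal_density 0 (sqrt (t - s)) x * g i x \<partial>lborel) = 0"
      using integral_normal_moment_nz_1[OF pos, of 0]
      by (intro prod_zero) (auto intro!: exI[of _ j] simp: g_def)
    with beta_incr_prod[of s t g, OF st _ 1] show ?thesis by (simp add: eq)
  qed auto
  then show "integrable N (\<lambda>w. (\<beta> w t - \<beta> w s) $ j)" "(\<integral>w. (\<beta> w t - \<beta> w s) $ j \<partial>N) = 0" by auto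
qed

lemma beta_incr_cov:
  assumes st: "0 \<le> s" "s \<le> t" "t \<le> 1"
  shows "integrable N (\<lambda>w. (\<beta> w t - \<beta> w s) $ j * (\<beta> w t - \<beta> w s) $ k)"
    "(\<integral>w. (\<beta> w t - \<beta> w s) $ j * (\<beta> w t - \<beta> w s) $ k \<partial>N) = (if j = k then t - s else 0)"
proof -
  have "integrable N (\<lambda>w. (\<beta> w t - \<beta> w s) $ j * (\<beta> w t - \<beta> w s) $ k) \<and>
    (\<integral>w. (\<beta> w t - \<beta> w s) $ j * (\<beta> w t - \<beta> w s) $ k \<partial>N) = (if j = k then t - s else 0)"
  proof (cases "s = t")
    case False
    then have st: "0 \<le> s" "s < t" "t \<le> 1" and pos: "0 < sqrt (t - s)" using st by auto
    \<comment> \<open>One factor for each of the two indices: for \<open>j = k\<close> they meet in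
      one coordinate and give its second moment; otherwise the mean of coordinate \<open>j\<close>
      makes the whole product vanish.\<close>
    define g where "g i x = (if i = j then x else 1) * (if i = k then x else 1)"
      for i and x :: real
    have [measurable]: "g i \<in> borel_measurable borel" for i unfolding g_def by simp
    have eq: "(\<Prod>i\<in>UNIV. g i (x i)) = x j * x k" for x
      unfolding g_def prod.distrib by simp
    have 1: "integrable lborel (\<lambda>x. normal_density 0 (sqrt (t - s)) x * g i x)" for i
      using integrable_normal_moment_nz_1[OF pos, of 0] integrable_normal_density[OF pos, of 0]
        integrable_normal_moment[OF pos, of 0 2]
      by (cases "i = j"; cases "i = k") (auto simp: g_def power2_eq_square)
    have 2: "(\<Prod>i\<in>UNIV. \<integral>x. normal_density 0 (sqrt (t - s)) x * g i x \<partial>lborel) =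
      (if j = k then t - s else 0)"
    proof (cases "j = k")
      case True
      have "(\<integral>x. normal_density 0 (sqrt (t - s)) x * g i x \<partial>lborel) = (if i = j then t - s else 1)" for i
        using integral_normal_moment_even[OF pos, of 0 1] st integral_normal_density[OF pos, of 0]
        by (auto simp: g_def True power2_eq_square)
      then show ?thesis using True by simp
    next
      case False
      with integral_normal_moment_nz_1[OF pos, of 0]
      have "(\<integral>x. normal_density 0 (sqrt (t - s)) x * g j x \<partial>lborel) = 0" by (simp add: g_def)
      with False show ?thesis by (auto intro!: prod_zero exI[of _ j])
    qed
    show ?thesis using beta_incr_prod[of s t g, OF st _ 1] unfolding 2 eq by auto
  qed auto
  then show "integrable N (\<lambda>w. (\<beta> w t - \<beta> w s) $ j * (\<beta> w t - \<beta> w s) $ k)"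
    "(\<integral>w. (\<beta> w t - \<beta> w s) $ j * (\<beta> w t - \<beta> w s) $ k \<partial>N) = (if j = k then t - s else 0)" by auto
qed

text \<open>Independence is assumed from the uncompleted past of \<open>\<beta>\<close>. By the
  equality of filtrations, \<open>A\<close> belongs to the completed past of \<open>\<beta>\<close>,
  and there it can be replaced by an almost surely equal uncompleted event.\<close>

lemma beta_incr_indep:
  assumes st: "0 \<le> s" "s < t" "t \<le> 1" and A: "A \<in> sets (F s)" and B: "B \<in> sets borel"
  shows "N.prob (A \<inter> ((\<lambda>w. \<beta> w t - \<beta> w s) -` B \<inter> space N)) =
    N.prob A * N.prob ((\<lambda>w. \<beta> w t - \<beta> w s) -` B \<inter> space N)"
proof -
  have Am: "A \<in> sets N" using A canonical_subalgebra[of s] st by (auto simp: subalgebra_def)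
  from A have "A \<in> sigma_sets (space \<nu>) (past_events \<nu> \<beta> s \<union> null_sets N)"
    using filtration_eq[of s] st by (simp add: sets_filtration)
  from sigma_sets_null_approx[OF this] obtain A' where
    A': "A' \<in> sigma_sets (space \<nu>) (past_events \<nu> \<beta> s)" "AE w in \<nu>. w \<in> A \<longleftrightarrow> w \<in> A'" by auto
  from A'(2) have ae: "AE w in N. w \<in> A \<longleftrightarrow> w \<in> A'" by (simp add: AE_completion_iff)
  have ind: "N.indep_set (sigma_sets (space \<nu>) (past_events \<nu> \<beta> s))
         {(\<lambda>w. \<beta> w t - \<beta> w s) -` A \<inter> space \<nu> |A. A \<in> sets borel}"
    using bm st unfolding brownian_motion_def by auto
  have A'm: "A' \<in> sets N" using N.indep_setD_ev1[OF ind] A' by auto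
  let ?D = "(\<lambda>w. \<beta> w t - \<beta> w s) -` B \<inter> space N"
  have D: "?D \<in> sets N" using st B by (intro measurable_sets[of _ N borel]) auto
  have "N.prob (A \<inter> ?D) = N.prob (A' \<inter> ?D)"
    using ae D Am A'm by (intro N.finite_measure_eq_AE) auto
  also have "\<dots> = N.prob A' * N.prob ?D"
    using B by (intro N.indep_setD[OF ind] A') auto
  also have "N.prob A' = N.prob A"
    using ae Am A'm by (intro N.finite_measure_eq_AE) auto
  finally show ?thesis .
qed

lemma beta_incr_factor:
  fixes Y :: "_ \<Rightarrow> real" and g :: "real ^ 'n \<Rightarrow> real"
  assumes st: "0 \<le> s" "s < t" "t \<le> 1" and Y: "Y \<in> borel_measurable (F s)" "integrable N Y"
    and g: "g \<in> borel_measurable borel" "integrable N (\<lambda>w. g (\<beta> w t - \<beta> w s))"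
  shows "integrable N (\<lambda>w. Y w * g (\<beta> w t - \<beta> w s))"
    "(\<integral>w. Y w * g (\<beta> w t - \<beta> w s) \<partial>N) = (\<integral>w. Y w \<partial>N) * (\<integral>w. g (\<beta> w t - \<beta> w s) \<partial>N)"
proof -
  have s: "s \<le> 1" and Z: "(\<lambda>w. \<beta> w t - \<beta> w s) \<in> measurable N borel" using st by auto
  note * = N.indep_factor[OF canonical_subalgebra[OF s] Z beta_incr_indep[OF st] Y g]
  show "integrable N (\<lambda>w. Y w * g (\<beta> w t - \<beta> w s))" by (rule *)
  show "(\<integral>w. Y w * g (\<beta> w t - \<beta> w s) \<partial>N) = (\<integral>w. Y w \<partial>N) * (\<integral>w. g (\<beta> w t - \<beta> w s) \<partial>N)"
    by (rule *)
qed

lemma beta_incr_mart: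
  fixes Y :: "_ \<Rightarrow> real"
  assumes st: "0 \<le> s" "s \<le> t" "t \<le> 1" and Y: "Y \<in> borel_measurable (F s)" "integrable N Y"
  shows "integrable N (\<lambda>w. Y w * (\<beta> w t - \<beta> w s) $ j)"
    "(\<integral>w. Y w * (\<beta> w t - \<beta> w s) $ j \<partial>N) = 0"
proof -
  have "integrable N (\<lambda>w. Y w * (\<beta> w t - \<beta> w s) $ j) \<and> (\<integral>w. Y w * (\<beta> w t - \<beta> w s) $ j \<partial>N) = 0"
  proof (cases "s = t")
    case False
    then show ?thesis
      using beta_incr_factor[of s t Y "\<lambda>x. x $ j"] beta_incr_mean[OF st, of j] st Y by auto
  qed auto
  then show "integrable N (\<lambda>w. Y w * (\<beta> w t - \<beta> w s) $ j)"
    "(\<integral>w. Y w * (\<beta> w t - \<beta> w s) $ j \<partial>N) = 0" by auto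
qed

lemma beta_incr_mart2:
  fixes Y :: "_ \<Rightarrow> real"
  assumes st: "0 \<le> s" "s \<le> t" "t \<le> 1" and Y: "Y \<in> borel_measurable (F s)" "integrable N Y"
  shows "integrable N (\<lambda>w. Y w * ((\<beta> w t - \<beta> w s) $ j * (\<beta> w t - \<beta> w s) $ k))"
    "(\<integral>w. Y w * ((\<beta> w t - \<beta> w s) $ j * (\<beta> w t - \<beta> w s) $ k) \<partial>N) =
      (if j = k then (\<integral>w. Y w \<partial>N) * (t - s) else 0)"
proof -
  have "integrable N (\<lambda>w. Y w * ((\<beta> w t - \<beta> w s) $ j * (\<beta> w t - \<beta> w s) $ k)) \<and>
    (\<integral>w. Y w * ((\<beta> w t - \<beta> w s) $ j * (\<beta> w t - \<beta> w s) $ k) \<partial>N) =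
      (if j = k then (\<integral>w. Y w \<partial>N) * (t - s) else 0)"
  proof (cases "s = t")
    case False
    then show ?thesis
      using beta_incr_factor[of s t Y "\<lambda>x. x $ j * x $ k"] beta_incr_cov[OF st, of j k] st Y by auto
  qed auto
  then show "integrable N (\<lambda>w. Y w * ((\<beta> w t - \<beta> w s) $ j * (\<beta> w t - \<beta> w s) $ k))"
    "(\<integral>w. Y w * ((\<beta> w t - \<beta> w s) $ j * (\<beta> w t - \<beta> w s) $ k) \<partial>N) =
      (if j = k then (\<integral>w. Y w \<partial>N) * (t - s) else 0)" by auto
qed

end

section \<open>Elementary stochastic integrals\<close>

lemma borel_measurable_component [measurable (raw)]:
  fixes f :: "'a \<Rightarrow> real ^ 'n::finite"
  shows "f \<in> borel_measurable M \<Longrightarrow> (\<lambda>x. f x $ i) \<in> borel_measurable M"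
  by (rule measurable_compose[OF _ borel_measurable_continuous_onI]) (auto intro!: continuous_intros)

text \<open>Time as a probability space: its product with \<open>N\<close> is again one, so bounded
  integrands are integrable and Fubini applies directly.\<close>

definition unit_leb :: "real measure" where "unit_leb = restrict_space lborel {0..1}"

lemma space_unit_leb [simp]: "space unit_leb = {0..1}"
  by (simp add: unit_leb_def space_restrict_space)

lemma prob_space_unit_leb: "prob_space unit_leb"
  by (rule prob_spaceI) (simp add: unit_leb_def emeasure_restrict_space)

lemma measurable_unit_leb_borel [measurable (raw)]:
  "f \<in> borel_measurable borel \<Longrightarrow> f \<in> borel_measurable unit_leb"
  by (simp add: unit_leb_def measurable_restrict_space1)

lemma measurable_snd_unit_leb [measurable (raw)]:
  "f \<in> measurable M (K \<Otimes>\<^sub>M unit_leb) \<Longrightarrow> (\<lambda>x. snd (f x)) \<in> borel_measurable M"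
  by (rule measurable_compose[OF measurable_compose[OF _ measurable_snd] measurable_unit_leb_borel]) auto

lemma (in path_prob) bounded_integrable:
  fixes f :: "_ \<Rightarrow> 'b::{banach, second_countable_topology}"
  assumes "f \<in> borel_measurable N" "\<And>w. w \<in> space \<nu> \<Longrightarrow> norm (f w) \<le> C"
  shows "integrable N f"
  using assms by (intro N.integrable_const_bound[of _ C]) (auto intro!: AE_I2)

context bm_space
begin

sublocale R: prob_space unit_leb by (rule prob_space_unit_leb)
sublocale Q: pair_prob_space N unit_leb ..

abbreviation "Q \<equiv> N \<Otimes>\<^sub>M unit_leb"

lemma incr_meas:
  assumes "0 \<le> a" "a \<le> b" "b \<le> 1" "\<xi> \<in> borel_measurable (F a)"
  shows "(\<lambda>w. \<xi> w \<bullet> (\<beta> w b - \<beta> w a)) \<in> borel_measurable (F b)"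
  using assms filtration_measurable_mono[OF assms(4), of b]
  by (intro borel_measurable_inner borel_measurable_diff beta_adapted) auto

lemma bound_mult_integrable:
  fixes Y g :: "_ \<Rightarrow> real"
  assumes "integrable N Y" "g \<in> borel_measurable N" "\<And>w. w \<in> space \<nu> \<Longrightarrow> \<bar>g w\<bar> \<le> C"
  shows "integrable N (\<lambda>w. Y w * g w)"
proof (rule Bochner_Integration.integrable_bound)
  show "integrable N (\<lambda>w. C * Y w)" using assms by simp
  show "(\<lambda>w. Y w * g w) \<in> borel_measurable N" using assms by auto
  have "\<bar>Y w * g w\<bar> \<le> \<bar>C * Y w\<bar>" if "w \<in> space \<nu>" for w
    using assms(3)[OF that] unfolding abs_mult
    by (smt (verit, best) abs_ge_zero mult.commute mult_right_mono)
  then show "AE w in N. norm (Y w * g w) \<le> norm (C * Y w)" by (auto intro!: AE_I2)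
qed

lemma incr_sq:
  assumes "0 \<le> a" "a \<le> b" "b \<le> 1" "\<xi> \<in> borel_measurable (F a)"
    and C: "\<And>w. w \<in> space \<nu> \<Longrightarrow> norm (\<xi> w) \<le> C"
  shows "integrable N (\<lambda>w. (\<xi> w \<bullet> (\<beta> w b - \<beta> w a))\<^sup>2)"
proof (rule Bochner_Integration.integrable_bound)
  show "integrable N (\<lambda>w. C\<^sup>2 * (\<Sum>j\<in>UNIV. (\<beta> w b - \<beta> w a) $ j * (\<beta> w b - \<beta> w a) $ j))"
    by (intro integrable_mult_right Bochner_Integration.integrable_sum beta_incr_cov assms)
  show "(\<lambda>w. (\<xi> w \<bullet> (\<beta> w b - \<beta> w a))\<^sup>2) \<in> borel_measurable N"
    using canonical_imp_N[OF _ incr_meas[OF assms(1-4)]] assms by auto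
  show "AE w in N. norm ((\<xi> w \<bullet> (\<beta> w b - \<beta> w a))\<^sup>2) \<le>
      norm (C\<^sup>2 * (\<Sum>j\<in>UNIV. (\<beta> w b - \<beta> w a) $ j * (\<beta> w b - \<beta> w a) $ j))"
  proof (intro AE_I2)
    fix w assume "w \<in> space N"
    then have c: "norm (\<xi> w) \<le> C" using C by auto
    have "(\<xi> w \<bullet> (\<beta> w b - \<beta> w a))\<^sup>2 \<le> (norm (\<xi> w))\<^sup>2 * (norm (\<beta> w b - \<beta> w a))\<^sup>2"
      using Cauchy_Schwarz_ineq[of "\<xi> w" "\<beta> w b - \<beta> w a"] by (simp add: power2_norm_eq_inner)
    also have "\<dots> \<le> C\<^sup>2 * (norm (\<beta> w b - \<beta> w a))\<^sup>2"
      using c by (intro mult_right_mono power_mono) auto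
    also have "(norm (\<beta> w b - \<beta> w a))\<^sup>2 = (\<Sum>j\<in>UNIV. (\<beta> w b - \<beta> w a) $ j * (\<beta> w b - \<beta> w a) $ j)"
      unfolding power2_norm_eq_inner inner_vec_def by simp
    finally show "norm ((\<xi> w \<bullet> (\<beta> w b - \<beta> w a))\<^sup>2) \<le>
      norm (C\<^sup>2 * (\<Sum>j\<in>UNIV. (\<beta> w b - \<beta> w a) $ j * (\<beta> w b - \<beta> w a) $ j))" by simp
  qed
qed

lemma incr_orth:
  fixes Y :: "_ \<Rightarrow> real"
  assumes cd: "0 \<le> c" "c \<le> d" "d \<le> 1" and Y: "Y \<in> borel_measurable (F c)" "integrable N Y"
    and eta: "\<eta> \<in> borel_measurable (F c)" and C: "\<And>w. w \<in> space \<nu> \<Longrightarrow> norm (\<eta> w) \<le> C"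
  shows "(\<integral>w. Y w * (\<eta> w \<bullet> (\<beta> w d - \<beta> w c)) \<partial>N) = 0"
proof -
  have m: "(\<lambda>w. Y w * \<eta> w $ j) \<in> borel_measurable (F c)" for j
    using Y(1) eta by simp
  have i: "integrable N (\<lambda>w. Y w * \<eta> w $ j)" for j
  proof (rule bound_mult_integrable[OF Y(2)])
    show "(\<lambda>w. \<eta> w $ j) \<in> borel_measurable N" using canonical_imp_N[OF _ eta] cd by auto
    show "\<bar>\<eta> w $ j\<bar> \<le> C" if "w \<in> space \<nu>" for w
      using component_le_norm_cart[of "\<eta> w" j] C[OF that] by linarith
  qed
  have "(\<integral>w. Y w * (\<eta> w \<bullet> (\<beta> w d - \<beta> w c)) \<partial>N) =
      (\<integral>w. (\<Sum>j\<in>UNIV. Y w * \<eta> w $ j * (\<beta> w d - \<beta> w c) $ j) \<partial>N)"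
    by (simp add: inner_vec_def sum_distrib_left mult.assoc)
  also have "\<dots> = (\<Sum>j\<in>UNIV. \<integral>w. Y w * \<eta> w $ j * (\<beta> w d - \<beta> w c) $ j \<partial>N)"
    by (intro Bochner_Integration.integral_sum beta_incr_mart(1)[OF cd m i])
  also have "\<dots> = 0" using beta_incr_mart(2)[OF cd m i] by simp
  finally show ?thesis .
qed

lemma incr_same:
  assumes cd: "0 \<le> c" "c \<le> d" "d \<le> 1"
    and xi: "\<xi> \<in> borel_measurable (F c)" and C: "\<And>w. w \<in> space \<nu> \<Longrightarrow> norm (\<xi> w) \<le> C"
    and eta: "\<eta> \<in> borel_measurable (F c)" and C': "\<And>w. w \<in> space \<nu> \<Longrightarrow> norm (\<eta> w) \<le> C'"
  shows "(\<integral>w. (\<xi> w \<bullet> (\<beta> w d - \<beta> w c)) * (\<eta> w \<bullet> (\<beta> w d - \<beta> w c)) \<partial>N) = (d - c) * (\<integral>w. \<xi> w \<bullet> \<eta> w \<partial>N)"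
proof -
  have m: "(\<lambda>w. \<xi> w $ j * \<eta> w $ k) \<in> borel_measurable (F c)" for j k
    using xi eta by simp
  have N: "(\<lambda>w. \<xi> w $ j) \<in> borel_measurable N" "(\<lambda>w. \<eta> w $ j) \<in> borel_measurable N" for j
    using canonical_imp_N[OF _ eta] canonical_imp_N[OF _ xi] cd by auto
  have i: "integrable N (\<lambda>w. \<xi> w $ j * \<eta> w $ k)" for j k
  proof (rule bound_mult_integrable[OF bounded_integrable N(2)])
    show "(\<lambda>w. \<xi> w $ j) \<in> borel_measurable N" by (rule N)
    show "norm (\<xi> w $ j) \<le> C" if "w \<in> space \<nu>" for w
      using component_le_norm_cart[of "\<xi> w" j] C[OF that] by simp
    show "\<bar>\<eta> w $ k\<bar> \<le> C'" if "w \<in> space \<nu>" for w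
      using component_le_norm_cart[of "\<eta> w" k] C'[OF that] by linarith
  qed
  note b = beta_incr_mart2[OF cd m i]
  have "(\<integral>w. (\<xi> w \<bullet> (\<beta> w d - \<beta> w c)) * (\<eta> w \<bullet> (\<beta> w d - \<beta> w c)) \<partial>N) =
      (\<integral>w. (\<Sum>j\<in>UNIV. \<Sum>k\<in>UNIV. (\<xi> w $ j * \<eta> w $ k) * ((\<beta> w d - \<beta> w c) $ j * (\<beta> w d - \<beta> w c) $ k)) \<partial>N)"
    by (intro Bochner_Integration.integral_cong refl, unfold inner_vec_def sum_product,
        intro sum.cong refl) simp
  also have "\<dots> = (\<Sum>j\<in>UNIV. \<Sum>k\<in>UNIV. if j = k then (\<integral>w. \<xi> w $ j * \<eta> w $ k \<partial>N) * (d - c) else 0)"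
    by (subst Bochner_Integration.integral_sum, intro Bochner_Integration.integrable_sum b,
        subst Bochner_Integration.integral_sum, intro b, subst b, simp)
  also have "\<dots> = (\<Sum>j\<in>UNIV. (\<integral>w. \<xi> w $ j * \<eta> w $ j \<partial>N) * (d - c))"
    by simp
  also have "\<dots> = (d - c) * (\<integral>w. (\<Sum>j\<in>UNIV. \<xi> w $ j * \<eta> w $ j) \<partial>N)"
    using i by (simp add: sum_distrib_right[symmetric])
  finally show ?thesis by (simp add: inner_vec_def)
qed

text \<open>The length of the intersection of the intervals (a, b] and (c, d].\<close>

definition overlap :: "real \<Rightarrow> real \<Rightarrow> real \<Rightarrow> real \<Rightarrow> real" where
  "overlap a b c d = max 0 (min b d - max a c)"

text \<open>The increments are cut at \<open>c\<close> and at the smaller of \<open>b\<close> and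
  \<open>d\<close>. Parts over intervals that follow one another are orthogonal, by conditioning at
  the start of the later one; only the common interval contributes, through
  \<open>incr_same\<close>.\<close>

lemma incr_cross_aux:
  assumes ab: "0 \<le> a" "a \<le> b" "b \<le> 1" and cd: "0 \<le> c" "c \<le> d" "d \<le> 1" and ac: "a \<le> c"
    and xi: "\<xi> \<in> borel_measurable (F a)" and C: "\<And>w. w \<in> space \<nu> \<Longrightarrow> norm (\<xi> w) \<le> C"
    and eta: "\<eta> \<in> borel_measurable (F c)" and C': "\<And>w. w \<in> space \<nu> \<Longrightarrow> norm (\<eta> w) \<le> C'"
  shows "(\<integral>w. (\<xi> w \<bullet> (\<beta> w b - \<beta> w a)) * (\<eta> w \<bullet> (\<beta> w d - \<beta> w c)) \<partial>N) =
    overlap a b c d * (\<integral>w. \<xi> w \<bullet> \<eta> w \<partial>N)"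
proof -
  have mono: "\<zeta> \<in> borel_measurable (F s) \<Longrightarrow> s \<le> t \<Longrightarrow> \<zeta> \<in> borel_measurable (F t)"
    for \<zeta> :: "_ \<Rightarrow> real ^ 'n" and s t by (rule filtration_measurable_mono)
  have I: "integrable N (\<lambda>w. \<zeta> w \<bullet> (\<beta> w t - \<beta> w s))"
    "integrable N (\<lambda>w. (\<zeta> w \<bullet> (\<beta> w t - \<beta> w s))\<^sup>2)"
    "(\<lambda>w. \<zeta> w \<bullet> (\<beta> w t - \<beta> w s)) \<in> borel_measurable N"
    if "\<zeta> \<in> borel_measurable (F s)" "\<And>w. w \<in> space \<nu> \<Longrightarrow> norm (\<zeta> w) \<le> K"
      "0 \<le> s" "s \<le> t" "t \<le> 1" for \<zeta> s t K
    using incr_sq[of s t \<zeta> K] canonical_imp_N[OF _ incr_meas[of s t \<zeta>]] that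
    by (auto intro: N.square_integrable_imp_integrable)
  \<comment> \<open>The part of the first increment that ends by time \<open>c\<close> is known at
    \<open>c\<close>, so it acts as a coefficient of a centred increment.\<close>
  have far: "(\<integral>w. (\<xi> w \<bullet> (\<beta> w b' - \<beta> w a)) * (\<eta> w \<bullet> (\<beta> w d - \<beta> w c)) \<partial>N) = 0"
    if "a \<le> b'" "b' \<le> c" for b'
    using that ab cd incr_meas[of a b' \<xi>] I[OF xi C, of b'] xi
    by (intro incr_orth[OF cd _ _ eta C'] filtration_measurable_mono[where s = b' and t = c]) auto
  show ?thesis
  proof (cases "b \<le> c")
    case True with far[of b] ab ac show ?thesis by (auto simp: overlap_def)
  next
    case False
    then have bc: "c \<le> b" by simp
    \<comment> \<open>Both increments start at \<open>c\<close> here. The integrands are kept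
      arbitrary because the case \<open>d < b\<close> applies this with the two roles
      exchanged.\<close>
    have near: "(\<integral>w. (\<xi> w \<bullet> (\<beta> w b - \<beta> w c)) * (\<eta> w \<bullet> (\<beta> w d - \<beta> w c)) \<partial>N) =
        (min b d - c) * (\<integral>w. \<xi> w \<bullet> \<eta> w \<partial>N)"
      if xi: "\<xi> \<in> borel_measurable (F c)" "\<And>w. w \<in> space \<nu> \<Longrightarrow> norm (\<xi> w) \<le> C"
       and eta: "\<eta> \<in> borel_measurable (F c)" "\<And>w. w \<in> space \<nu> \<Longrightarrow> norm (\<eta> w) \<le> C'"
       and bd: "b \<le> d" "c \<le> b" "d \<le> 1" for b d C C' \<xi> \<eta>
    proof -
      have m: "\<eta> \<in> borel_measurable (F b)" using mono[OF eta(1)] bd by auto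
      have prod: "integrable N (\<lambda>w. (\<xi> w \<bullet> (\<beta> w b - \<beta> w c)) * (\<eta> w \<bullet> (\<beta> w b - \<beta> w c)))"
        "integrable N (\<lambda>w. (\<xi> w \<bullet> (\<beta> w b - \<beta> w c)) * (\<eta> w \<bullet> (\<beta> w d - \<beta> w b)))"
        using I[OF xi] I[OF eta] I[OF m eta(2)] cd bd by (auto intro!: integrable_mult_sq)
      have "(\<integral>w. (\<xi> w \<bullet> (\<beta> w b - \<beta> w c)) * (\<eta> w \<bullet> (\<beta> w d - \<beta> w c)) \<partial>N) =
        (\<integral>w. (\<xi> w \<bullet> (\<beta> w b - \<beta> w c)) * (\<eta> w \<bullet> (\<beta> w b - \<beta> w c)) +
          (\<xi> w \<bullet> (\<beta> w b - \<beta> w c)) * (\<eta> w \<bullet> (\<beta> w d - \<beta> w b)) \<partial>N)"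
        by (simp add: inner_diff_right algebra_simps)
      also have "\<dots> = (b - c) * (\<integral>w. \<xi> w \<bullet> \<eta> w \<partial>N)"
        using prod incr_same[OF cd(1) _ _ xi eta, of b]
          incr_orth[OF _ _ _ incr_meas[OF _ _ _ xi(1)] I(1)[OF xi], of b d \<eta> C'] m eta(2) cd bd
        by simp
      finally show ?thesis using bd by (simp add: min_def)
    qed
    have xi': "\<xi> \<in> borel_measurable (F c)" by (rule mono[OF xi ac])
    have n: "(\<integral>w. (\<xi> w \<bullet> (\<beta> w b - \<beta> w c)) * (\<eta> w \<bullet> (\<beta> w d - \<beta> w c)) \<partial>N) =
        (min b d - c) * (\<integral>w. \<xi> w \<bullet> \<eta> w \<partial>N)"
    proof (cases "b \<le> d")
      case True
      with near[OF xi' C eta C', of b d] bc cd show ?thesis by auto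
    next
      case False
      with near[OF eta C' xi' C, of d b] cd ab show ?thesis
        by (simp add: mult.commute inner_commute min.commute)
    qed
    have prod: "integrable N (\<lambda>w. (\<xi> w \<bullet> (\<beta> w c - \<beta> w a)) * (\<eta> w \<bullet> (\<beta> w d - \<beta> w c)))"
        "integrable N (\<lambda>w. (\<xi> w \<bullet> (\<beta> w b - \<beta> w c)) * (\<eta> w \<bullet> (\<beta> w d - \<beta> w c)))"
      using I[OF xi C, of c] I[OF xi' C, of b] I[OF eta C', of d] ab cd bc ac
      by (auto intro!: integrable_mult_sq)
    have "(\<integral>w. (\<xi> w \<bullet> (\<beta> w b - \<beta> w a)) * (\<eta> w \<bullet> (\<beta> w d - \<beta> w c)) \<partial>N) =
      (\<integral>w. (\<xi> w \<bullet> (\<beta> w c - \<beta> w a)) * (\<eta> w \<bullet> (\<beta> w d - \<beta> w c)) +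
        (\<xi> w \<bullet> (\<beta> w b - \<beta> w c)) * (\<eta> w \<bullet> (\<beta> w d - \<beta> w c)) \<partial>N)"
      by (simp add: inner_diff_right algebra_simps)
    also have "\<dots> = (min b d - c) * (\<integral>w. \<xi> w \<bullet> \<eta> w \<partial>N)"
      using prod far[of c] n ac by simp
    finally show ?thesis using ac bc cd by (simp add: overlap_def)
  qed
qed

lemma incr_cross:
  assumes ab: "0 \<le> a" "a \<le> b" "b \<le> 1" and cd: "0 \<le> c" "c \<le> d" "d \<le> 1"
    and xi: "\<xi> \<in> borel_measurable (F a)" and C: "\<And>w. w \<in> space \<nu> \<Longrightarrow> norm (\<xi> w) \<le> C"
    and eta: "\<eta> \<in> borel_measurable (F c)" and C': "\<And>w. w \<in> space \<nu> \<Longrightarrow> norm (\<eta> w) \<le> C'"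
  shows "(\<integral>w. (\<xi> w \<bullet> (\<beta> w b - \<beta> w a)) * (\<eta> w \<bullet> (\<beta> w d - \<beta> w c)) \<partial>N) =
    overlap a b c d * (\<integral>w. \<xi> w \<bullet> \<eta> w \<partial>N)"
proof (cases "a \<le> c")
  case True then show ?thesis by (rule incr_cross_aux[OF ab cd _ xi C eta C'])
next
  case False
  have "overlap a b c d = overlap c d a b" by (simp add: overlap_def max.commute min.commute)
  with False show ?thesis
    using incr_cross_aux[OF cd ab _ eta C' xi C] by (simp add: mult.commute inner_commute)
qed

end

section \<open>Elementary integrals and the Ito isometry\<close>

context bm_space
begin

text \<open>The intervals of the summands may overlap, so sums and differences of elementary integrands
  over different partitions need no common refinement.\<close>

inductive elem :: "((real \<Rightarrow> real ^ 'n) \<Rightarrow> real \<Rightarrow> real ^ 'n) \<Rightarrow> ((real \<Rightarrow> real ^ 'n) \<Rightarrow> real) \<Rightarrow> bool" where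
  elem_zero: "elem (\<lambda>_ _. 0) (\<lambda>_. 0)"
| elem_add: "elem \<phi> J \<Longrightarrow> 0 \<le> a \<Longrightarrow> a \<le> b \<Longrightarrow> b \<le> 1 \<Longrightarrow> \<xi> \<in> borel_measurable (F a) \<Longrightarrow>
    (\<And>w. w \<in> space \<nu> \<Longrightarrow> norm (\<xi> w) \<le> C) \<Longrightarrow>
    elem (\<lambda>w s. \<phi> w s + indicator {a<..b} s *\<^sub>R \<xi> w) (\<lambda>w. J w + \<xi> w \<bullet> (\<beta> w b - \<beta> w a))"

lemma elem_diff_add:
  assumes "elem \<phi>' J'" "elem \<phi> J"
  shows "elem (\<lambda>w s. \<phi> w s - \<phi>' w s) (\<lambda>w. J w - J' w)"
  using assms(1)
proof induction
  case elem_zero then show ?case using assms(2) by simp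
next
  case (elem_add \<phi>' J' a b \<xi> C)
  have "elem (\<lambda>w s. \<phi> w s - \<phi>' w s + indicator {a<..b} s *\<^sub>R - \<xi> w)
      (\<lambda>w. J w - J' w + (- \<xi> w) \<bullet> (\<beta> w b - \<beta> w a))"
    using elem_add.hyps by (intro elem.elem_add[OF elem_add.IH, where C = C]) auto
  then show ?case by (simp add: algebra_simps)
qed

lemma elem_meas: "elem \<phi> J \<Longrightarrow> case_prod \<phi> \<in> borel_measurable Q"
proof (induction rule: elem.induct)
  case (elem_add \<phi> J a b \<xi> C)
  have [measurable]: "case_prod \<phi> \<in> borel_measurable Q" by (rule elem_add.IH)
  have [measurable]: "\<xi> \<in> borel_measurable N"
    using elem_add.hyps(3,4) by (intro canonical_imp_N[OF _ elem_add.hyps(5)]) auto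
  have [measurable]: "{a<..b} \<in> sets borel" by auto
  have "(\<lambda>p. \<phi> (fst p) (snd p) + indicator {a<..b} (snd p) *\<^sub>R \<xi> (fst p)) \<in> borel_measurable Q"
    by measurable
  then show ?case by (simp add: case_prod_beta')
qed (simp add: case_prod_beta')

lemma elem_bounded: "elem \<phi> J \<Longrightarrow> \<exists>C. \<forall>w\<in>space \<nu>. \<forall>s. norm (\<phi> w s) \<le> C"
proof (induction rule: elem.induct)
  case (elem_add \<phi> J a b \<xi> C)
  then obtain K where K: "\<forall>w\<in>space \<nu>. \<forall>s. norm (\<phi> w s) \<le> K" by auto
  have "norm (\<phi> w s + indicator {a<..b} s *\<^sub>R \<xi> w) \<le> K + C" if "w \<in> space \<nu>" for w s
    using K elem_add.hyps(6)[OF that] that order_trans[OF norm_ge_zero elem_add.hyps(6)[OF that]]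
    by (intro norm_triangle_mono) (auto simp: indicator_def)
  then show ?case by blast
qed auto

lemma elem_adapted: "elem \<phi> J \<Longrightarrow> J \<in> borel_measurable N \<and> integrable N (\<lambda>w. (J w)\<^sup>2) \<and> (\<integral>w. J w \<partial>N) = 0"
proof (induction rule: elem.induct)
  case (elem_add \<phi> J a b \<xi> C)
  have m: "(\<lambda>w. \<xi> w \<bullet> (\<beta> w b - \<beta> w a)) \<in> borel_measurable N"
    using elem_add.hyps(4) by (rule canonical_imp_N[OF _ incr_meas[OF elem_add.hyps(2-5)]])
  have s: "integrable N (\<lambda>w. (\<xi> w \<bullet> (\<beta> w b - \<beta> w a))\<^sup>2)"
    by (rule incr_sq[OF elem_add.hyps(2-6)])
  have z: "(\<integral>w. \<xi> w \<bullet> (\<beta> w b - \<beta> w a) \<partial>N) = 0"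
    using incr_orth[OF elem_add.hyps(2-4) borel_measurable_const N.integrable_const elem_add.hyps(5,6), of 1]
    by (simp only: mult_1)
  from elem_add.IH have J: "J \<in> borel_measurable N" "integrable N (\<lambda>w. (J w)\<^sup>2)" "(\<integral>w. J w \<partial>N) = 0"
    by auto
  have "(\<integral>w. J w + \<xi> w \<bullet> (\<beta> w b - \<beta> w a) \<partial>N) = 0"
    unfolding Bochner_Integration.integral_add[OF N.square_integrable_imp_integrable[OF J(1,2)]
      N.square_integrable_imp_integrable[OF m s]] J z by simp
  with borel_measurable_add[OF J(1) m] integrable_add_sq[OF J(1) m J(2) s] show ?case by blast
qed auto

lemma Q_bounded_integrable:
  fixes f :: "_ \<Rightarrow> 'b::{banach, second_countable_topology}"
  assumes "f \<in> borel_measurable Q" "\<And>w s. w \<in> space \<nu> \<Longrightarrow> s \<in> {0..1} \<Longrightarrow> norm (f (w, s)) \<le> C"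
  shows "integrable Q f"
  using assms
  by (intro Q.P.integrable_const_bound[of _ C])
     (auto intro!: AE_I2 simp: space_pair_measure)

lemma measure_overlap:
  assumes "0 \<le> a" "b \<le> 1" "0 \<le> c" "d \<le> 1"
  shows "measure unit_leb ({a<..b} \<inter> {c<..d}) = overlap a b c d"
proof -
  have eq: "{a<..b} \<inter> {c<..d} = {max a c<..min b d}" by auto
  have sub: "{max a c<..min b d} \<subseteq> {0..1}" using assms by auto
  have "measure unit_leb ({max a c<..min b d}) = measure lborel {max a c<..min b d}"
    using sub unfolding unit_leb_def by (subst measure_restrict_space) auto
  also have "\<dots> = overlap a b c d"
    by (cases "max a c \<le> min b d") (auto simp: overlap_def)
  finally show ?thesis by (simp only: eq)
qed

lemma Q_piece:
  assumes ab: "0 \<le> a" "b \<le> 1" and cd: "0 \<le> c" "d \<le> 1"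
    and xi: "\<xi> \<in> borel_measurable N" and C: "\<And>w. w \<in> space \<nu> \<Longrightarrow> norm (\<xi> w) \<le> C"
    and eta: "\<eta> \<in> borel_measurable N" and C': "\<And>w. w \<in> space \<nu> \<Longrightarrow> norm (\<eta> w) \<le> C'"
  shows "(\<integral>p. (indicator {a<..b} (snd p) *\<^sub>R \<xi> (fst p)) \<bullet> (indicator {c<..d} (snd p) *\<^sub>R (\<eta> (fst p) :: real ^ 'n)) \<partial>Q)
    = overlap a b c d * (\<integral>w. \<xi> w \<bullet> \<eta> w \<partial>N)"
proof -
  note [measurable] = xi eta
  have [measurable]: "{a<..b} \<in> sets borel" "{c<..d} \<in> sets borel" by auto
  have eq: "(indicator {a<..b} s *\<^sub>R \<xi> w) \<bullet> (indicator {c<..d} s *\<^sub>R \<eta> w)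
      = indicator ({a<..b} \<inter> {c<..d}) s * (\<xi> w \<bullet> \<eta> w)" for s w
    by (auto simp: indicator_def)
  have "integrable Q (\<lambda>p. indicator ({a<..b} \<inter> {c<..d}) (snd p) * (\<xi> (fst p) \<bullet> \<eta> (fst p)))"
  proof (rule Q_bounded_integrable)
    show "(\<lambda>p. indicator ({a<..b} \<inter> {c<..d}) (snd p) * (\<xi> (fst p) \<bullet> \<eta> (fst p))) \<in> borel_measurable Q"
      by measurable
    fix w s assume w: "w \<in> space \<nu>"
    have "0 \<le> C" "0 \<le> C'" using C[OF w] C'[OF w] norm_ge_zero[of "\<xi> w"] norm_ge_zero[of "\<eta> w"] by linarith+
    then show "norm (indicator ({a<..b} \<inter> {c<..d}) (snd (w, s)) * (\<xi> (fst (w, s)) \<bullet> \<eta> (fst (w, s)))) \<le> C * C'"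
      using Cauchy_Schwarz_ineq2[of "\<xi> w" "\<eta> w"] mult_mono[OF C[OF w] C'[OF w]]
      by (auto simp: indicator_def)
  qed
  from Q.integral_fst'[OF this, symmetric]
  have "(\<integral>p. indicator ({a<..b} \<inter> {c<..d}) (snd p) * (\<xi> (fst p) \<bullet> \<eta> (fst p)) \<partial>Q) =
     (\<integral>w. (\<integral>s. indicator ({a<..b} \<inter> {c<..d}) s * (\<xi> w \<bullet> \<eta> w) \<partial>unit_leb) \<partial>N)" by simp
  also have "\<dots> = (\<integral>w. overlap a b c d * (\<xi> w \<bullet> \<eta> w) \<partial>N)"
  proof (intro Bochner_Integration.integral_cong refl)
    fix w
    have "{a<..b} \<inter> {c<..d} \<inter> space unit_leb = {a<..b} \<inter> {c<..d}"
      using ab cd by auto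
    moreover have "{a<..b} \<inter> {c<..d} \<in> sets unit_leb"
      using ab cd by (auto simp: unit_leb_def sets_restrict_space_iff)
    ultimately show "(\<integral>s. indicator ({a<..b} \<inter> {c<..d}) s * (\<xi> w \<bullet> \<eta> w) \<partial>unit_leb) = overlap a b c d * (\<xi> w \<bullet> \<eta> w)"
      using measure_overlap[OF ab cd] by (simp del: Int_greaterThanAtMost)
  qed
  finally show ?thesis by (simp add: eq del: inner_scaleR_left inner_scaleR_right)
qed

text \<open>The isometry is proved in polarised form, which is additive in each argument. This
  induction on the first integrand, against a single interval, reduces it to
  \<open>incr_cross\<close> and \<open>Q_piece\<close>; the next lemma is the induction on the
  second integrand.\<close>

lemma elem_cross_piece:
  assumes "elem \<phi> J" and cd: "0 \<le> c" "c \<le> d" "d \<le> 1"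
    and eta: "\<eta> \<in> borel_measurable (F c)" and C': "\<And>w. w \<in> space \<nu> \<Longrightarrow> norm (\<eta> w) \<le> C'"
  shows "(\<integral>w. J w * (\<eta> w \<bullet> (\<beta> w d - \<beta> w c)) \<partial>N) =
    (\<integral>p. \<phi> (fst p) (snd p) \<bullet> (indicator {c<..d} (snd p) *\<^sub>R \<eta> (fst p)) \<partial>Q)"
  using assms(1)
proof induction
  case (elem_add \<phi> J a b \<xi> C)
  have etaN: "\<eta> \<in> borel_measurable N" and xiN: "\<xi> \<in> borel_measurable N"
    using cd elem_add.hyps(3,4)
    by (intro canonical_imp_N[OF _ eta] canonical_imp_N[OF _ elem_add.hyps(5)]; simp)+
  note [measurable] = etaN xiN
  have [measurable]: "{a<..b} \<in> sets borel" "{c<..d} \<in> sets borel" by auto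
  have sq: "integrable N (\<lambda>w. (\<eta> w \<bullet> (\<beta> w d - \<beta> w c))\<^sup>2)" "(\<lambda>w. \<eta> w \<bullet> (\<beta> w d - \<beta> w c)) \<in> borel_measurable N"
    by (rule incr_sq[OF cd eta C'], simp) (rule canonical_imp_N[OF cd(3) incr_meas[OF cd eta]])
  have sq': "integrable N (\<lambda>w. (\<xi> w \<bullet> (\<beta> w b - \<beta> w a))\<^sup>2)" "(\<lambda>w. \<xi> w \<bullet> (\<beta> w b - \<beta> w a)) \<in> borel_measurable N"
    by (rule incr_sq[OF elem_add.hyps(2-6)], simp)
      (rule canonical_imp_N[OF elem_add.hyps(4) incr_meas[OF elem_add.hyps(2-5)]])
  have i1: "integrable N (\<lambda>w. J w * (\<eta> w \<bullet> (\<beta> w d - \<beta> w c)))"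
    using elem_adapted[OF elem_add.hyps(1)] sq by (intro integrable_mult_sq) auto
  have i2: "integrable N (\<lambda>w. (\<xi> w \<bullet> (\<beta> w b - \<beta> w a)) * (\<eta> w \<bullet> (\<beta> w d - \<beta> w c)))"
    using sq sq' by (intro integrable_mult_sq) auto
  have [measurable]: "case_prod \<phi> \<in> borel_measurable Q" by (rule elem_meas) fact
  obtain K where K: "\<forall>w\<in>space \<nu>. \<forall>s. norm (\<phi> w s) \<le> K" using elem_bounded[OF elem_add.hyps(1)] by auto
  have j1: "integrable Q (\<lambda>p. \<phi> (fst p) (snd p) \<bullet> (indicator {c<..d} (snd p) *\<^sub>R \<eta> (fst p)))"
  proof (rule Q_bounded_integrable)
    show "(\<lambda>p. \<phi> (fst p) (snd p) \<bullet> (indicator {c<..d} (snd p) *\<^sub>R \<eta> (fst p))) \<in> borel_measurable Q" by measurable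
    fix w s assume w: "w \<in> space \<nu>"
    then have 1: "norm (\<phi> w s) \<le> K" using K by auto
    have "0 \<le> K" "0 \<le> C'" using 1 C'[OF w] norm_ge_zero[of "\<phi> w s"] norm_ge_zero[of "\<eta> w"] by linarith+
    then show "norm (\<phi> (fst (w, s)) (snd (w, s)) \<bullet> (indicator {c<..d} (snd (w, s)) *\<^sub>R \<eta> (fst (w, s)))) \<le> K * C'"
      using Cauchy_Schwarz_ineq2[of "\<phi> w s" "\<eta> w"] mult_mono[OF 1 C'[OF w]]
      by (auto simp: indicator_def)
  qed
  have j2: "integrable Q (\<lambda>p. (indicator {a<..b} (snd p) *\<^sub>R \<xi> (fst p)) \<bullet> (indicator {c<..d} (snd p) *\<^sub>R \<eta> (fst p)))"
  proof (rule Q_bounded_integrable)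
    show "(\<lambda>p. (indicator {a<..b} (snd p) *\<^sub>R \<xi> (fst p)) \<bullet> (indicator {c<..d} (snd p) *\<^sub>R \<eta> (fst p))) \<in> borel_measurable Q" by measurable
    fix w s assume w: "w \<in> space \<nu>"
    note 1 = elem_add.hyps(6)[OF w]
    have "0 \<le> C" "0 \<le> C'" using 1 C'[OF w] norm_ge_zero[of "\<xi> w"] norm_ge_zero[of "\<eta> w"] by linarith+
    then show "norm ((indicator {a<..b} (snd (w, s)) *\<^sub>R \<xi> (fst (w, s))) \<bullet> (indicator {c<..d} (snd (w, s)) *\<^sub>R \<eta> (fst (w, s)))) \<le> C * C'"
      using Cauchy_Schwarz_ineq2[of "\<xi> w" "\<eta> w"] mult_mono[OF 1 C'[OF w]]
      by (auto simp: indicator_def)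
  qed
  have "(\<integral>w. (J w + \<xi> w \<bullet> (\<beta> w b - \<beta> w a)) * (\<eta> w \<bullet> (\<beta> w d - \<beta> w c)) \<partial>N) =
      (\<integral>w. J w * (\<eta> w \<bullet> (\<beta> w d - \<beta> w c)) \<partial>N) +
      (\<integral>w. (\<xi> w \<bullet> (\<beta> w b - \<beta> w a)) * (\<eta> w \<bullet> (\<beta> w d - \<beta> w c)) \<partial>N)"
    unfolding distrib_right by (rule Bochner_Integration.integral_add[OF i1 i2])
  also have "(\<integral>w. (\<xi> w \<bullet> (\<beta> w b - \<beta> w a)) * (\<eta> w \<bullet> (\<beta> w d - \<beta> w c)) \<partial>N) =
      overlap a b c d * (\<integral>w. \<xi> w \<bullet> \<eta> w \<partial>N)"
    by (rule incr_cross[OF elem_add.hyps(2-4) cd elem_add.hyps(5,6) eta C'])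
  also have "\<dots> = (\<integral>p. (indicator {a<..b} (snd p) *\<^sub>R \<xi> (fst p)) \<bullet> (indicator {c<..d} (snd p) *\<^sub>R \<eta> (fst p)) \<partial>Q)"
    by (rule Q_piece[OF elem_add.hyps(2,4) cd(1,3) xiN elem_add.hyps(6) etaN C', symmetric])
  finally show ?case
    unfolding inner_add_left using elem_add.IH
    by (subst Bochner_Integration.integral_add[OF j1 j2]) simp
qed simp

lemma elem_isometry_inner:
  assumes "elem \<phi>' J'" "elem \<phi> J"
  shows "(\<integral>w. J w * J' w \<partial>N) = (\<integral>p. \<phi> (fst p) (snd p) \<bullet> \<phi>' (fst p) (snd p) \<partial>Q)"
  using assms(1)
proof induction
  case (elem_add \<phi>' J' a b \<xi> C)
  have xiN: "\<xi> \<in> borel_measurable N"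
    using elem_add.hyps(3,4) by (intro canonical_imp_N[OF _ elem_add.hyps(5)]) auto
  note [measurable] = xiN
  have [measurable]: "{a<..b} \<in> sets borel" by auto
  have sq': "integrable N (\<lambda>w. (\<xi> w \<bullet> (\<beta> w b - \<beta> w a))\<^sup>2)" "(\<lambda>w. \<xi> w \<bullet> (\<beta> w b - \<beta> w a)) \<in> borel_measurable N"
    by (rule incr_sq[OF elem_add.hyps(2-6)], simp)
      (rule canonical_imp_N[OF elem_add.hyps(4) incr_meas[OF elem_add.hyps(2-5)]])
  have i1: "integrable N (\<lambda>w. J w * J' w)"
    using elem_adapted[OF elem_add.hyps(1)] elem_adapted[OF assms(2)] by (intro integrable_mult_sq) auto
  have i2: "integrable N (\<lambda>w. J w * (\<xi> w \<bullet> (\<beta> w b - \<beta> w a)))"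
    using sq' elem_adapted[OF assms(2)] by (intro integrable_mult_sq) auto
  have [measurable]: "case_prod \<phi> \<in> borel_measurable Q" "case_prod \<phi>' \<in> borel_measurable Q"
    by (rule elem_meas, fact)+
  obtain K where K: "\<forall>w\<in>space \<nu>. \<forall>s. norm (\<phi> w s) \<le> K" using elem_bounded[OF assms(2)] by auto
  obtain K' where K': "\<forall>w\<in>space \<nu>. \<forall>s. norm (\<phi>' w s) \<le> K'" using elem_bounded[OF elem_add.hyps(1)] by auto
  have j1: "integrable Q (\<lambda>p. \<phi> (fst p) (snd p) \<bullet> \<phi>' (fst p) (snd p))"
  proof (rule Q_bounded_integrable)
    show "(\<lambda>p. \<phi> (fst p) (snd p) \<bullet> \<phi>' (fst p) (snd p)) \<in> borel_measurable Q" by measurable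
    fix w s assume w: "w \<in> space \<nu>"
    then have 1: "norm (\<phi> w s) \<le> K" "norm (\<phi>' w s) \<le> K'" using K K' by auto
    have "0 \<le> K" using 1 norm_ge_zero[of "\<phi> w s"] by linarith
    then show "norm (\<phi> (fst (w, s)) (snd (w, s)) \<bullet> \<phi>' (fst (w, s)) (snd (w, s))) \<le> K * K'"
      using Cauchy_Schwarz_ineq2[of "\<phi> w s" "\<phi>' w s"] mult_mono[OF 1] by simp
  qed
  have j2: "integrable Q (\<lambda>p. \<phi> (fst p) (snd p) \<bullet> (indicator {a<..b} (snd p) *\<^sub>R \<xi> (fst p)))"
  proof (rule Q_bounded_integrable)
    show "(\<lambda>p. \<phi> (fst p) (snd p) \<bullet> (indicator {a<..b} (snd p) *\<^sub>R \<xi> (fst p))) \<in> borel_measurable Q" by measurable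
    fix w s assume w: "w \<in> space \<nu>"
    then have 1: "norm (\<phi> w s) \<le> K" using K by auto
    have "0 \<le> K" "0 \<le> C" using 1 elem_add.hyps(6)[OF w] norm_ge_zero[of "\<phi> w s"] norm_ge_zero[of "\<xi> w"] by linarith+
    then show "norm (\<phi> (fst (w, s)) (snd (w, s)) \<bullet> (indicator {a<..b} (snd (w, s)) *\<^sub>R \<xi> (fst (w, s)))) \<le> K * C"
      using Cauchy_Schwarz_ineq2[of "\<phi> w s" "\<xi> w"] mult_mono[OF 1 elem_add.hyps(6)[OF w]]
      by (auto simp: indicator_def)
  qed
  show ?case
    unfolding inner_add_right distrib_left
    using elem_add.IH elem_cross_piece[OF assms(2) elem_add.hyps(2-6)]
    by (subst Bochner_Integration.integral_add[OF j1 j2], subst Bochner_Integration.integral_add[OF i1 i2]) simp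
qed simp

text \<open>The squared L2 distance of two integrands, written exactly as the double integral in
  \<open>has_ito_integral\<close> so that the two can be folded into each other.\<close>

definition sqdist :: "((real \<Rightarrow> real ^ 'n) \<Rightarrow> real \<Rightarrow> real ^ 'n) \<Rightarrow> ((real \<Rightarrow> real ^ 'n) \<Rightarrow> real \<Rightarrow> real ^ 'n) \<Rightarrow> ennreal" where
  "sqdist \<phi> \<psi> = (\<integral>\<^sup>+ w. (\<integral>\<^sup>+ s\<in>{0..1}. ennreal ((norm (\<phi> w s - \<psi> w s))\<^sup>2) \<partial>lborel) \<partial>N)"

lemma sqdist_Q:
  assumes [measurable]: "case_prod \<phi> \<in> borel_measurable Q" "case_prod \<psi> \<in> borel_measurable Q"
  shows "sqdist \<phi> \<psi> = (\<integral>\<^sup>+ p. ennreal ((norm (\<phi> (fst p) (snd p) - \<psi> (fst p) (snd p)))\<^sup>2) \<partial>Q)"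
proof -
  have "(\<integral>\<^sup>+ p. ennreal ((norm (\<phi> (fst p) (snd p) - \<psi> (fst p) (snd p)))\<^sup>2) \<partial>Q) =
      (\<integral>\<^sup>+ w. (\<integral>\<^sup>+ s. ennreal ((norm (\<phi> w s - \<psi> w s))\<^sup>2) \<partial>unit_leb) \<partial>N)"
    by (subst R.nn_integral_fst[symmetric]) auto
  then show ?thesis unfolding sqdist_def
    by (simp add: unit_leb_def nn_integral_restrict_space mult.commute)
qed

lemma elem_isometry:
  assumes "elem \<phi> J" "elem \<psi> K"
  shows "(\<integral>\<^sup>+ w. ennreal ((J w - K w)\<^sup>2) \<partial>N) = sqdist \<phi> \<psi>"
proof -
  note e = elem_diff_add[OF assms(2,1)]
  note m = elem_meas[OF assms(1)] elem_meas[OF assms(2)]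
  note [measurable] = m
  obtain C where C: "\<forall>w\<in>space \<nu>. \<forall>s. norm (\<phi> w s - \<psi> w s) \<le> C" using elem_bounded[OF e] by auto
  have j1: "integrable Q (\<lambda>p. (norm (\<phi> (fst p) (snd p) - \<psi> (fst p) (snd p)))\<^sup>2)"
  proof (rule Q_bounded_integrable)
    show "norm ((norm (\<phi> (fst (w, s)) (snd (w, s)) - \<psi> (fst (w, s)) (snd (w, s))))\<^sup>2) \<le> C\<^sup>2"
      if "w \<in> space \<nu>" for w s
      using C that by (auto intro!: power_mono)
  qed measurable
  have "(\<integral>\<^sup>+ w. ennreal ((J w - K w)\<^sup>2) \<partial>N) = ennreal (\<integral>w. (J w - K w)\<^sup>2 \<partial>N)"
    using elem_adapted[OF e] by (intro nn_integral_eq_integral) auto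
  also have "(\<integral>w. (J w - K w)\<^sup>2 \<partial>N) = (\<integral>p. (norm (\<phi> (fst p) (snd p) - \<psi> (fst p) (snd p)))\<^sup>2 \<partial>Q)"
    using elem_isometry_inner[OF e e] by (simp add: power2_eq_square[symmetric] power2_norm_eq_inner)
  also have "ennreal \<dots> = sqdist \<phi> \<psi>"
    unfolding sqdist_Q[OF m] by (intro nn_integral_eq_integral[symmetric] j1) auto
  finally show ?thesis .
qed

lemma elem_simple:
  assumes "simple_integrand \<nu> k t \<xi>"
  shows "elem (simple_process k t \<xi>) (simple_integral \<beta> k t \<xi>)"
proof -
  have t: "t 0 = 0" "t k = 1" "\<And>i. i < k \<Longrightarrow> t i < t (Suc i)"
    and xi: "\<And>i. i < k \<Longrightarrow> \<xi> i \<in> borel_measurable (F (t i))"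
      "\<And>i. i < k \<Longrightarrow> \<exists>C. \<forall>w\<in>space \<nu>. norm (\<xi> i w) \<le> C"
    using assms unfolding simple_integrand_def by auto
  have lo: "0 \<le> t i" if "i \<le> k" for i
    using that
  proof (induction i)
    case (Suc i) then show ?case using t(3)[of i] by auto
  qed (simp add: t)
  have hi: "t i \<le> 1" if "i \<le> k" for i
    using that
  proof (induction rule: inc_induct)
    case (step m) then show ?case using t(3)[of m] by auto
  qed (simp add: t)
  have "elem (simple_process m t \<xi>) (simple_integral \<beta> m t \<xi>)" if "m \<le> k" for m
    using that
  proof (induction m)
    case 0 then show ?case using elem_zero by (simp add: simple_process_def[abs_def] simple_integral_def[abs_def])
  next
    case (Suc m)
    then obtain C where C: "\<forall>w\<in>space \<nu>. norm (\<xi> m w) \<le> C" using xi(2)[of m] by auto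
    have "elem (\<lambda>w s. simple_process m t \<xi> w s + indicator {t m<..t (Suc m)} s *\<^sub>R \<xi> m w)
       (\<lambda>w. simple_integral \<beta> m t \<xi> w + \<xi> m w \<bullet> (\<beta> w (t (Suc m)) - \<beta> w (t m)))"
      using Suc C lo[of m] hi[of "Suc m"] t(3)[of m] xi(1)[of m] by (intro elem_add[where C = C]) auto
    then show ?case
      unfolding simple_process_def[abs_def] simple_integral_def[abs_def] sum.lessThan_Suc .
  qed
  from this[of k] show ?thesis by simp
qed

end

section \<open>Densities and their averages\<close>

lemma has_density_unit_leb:
  "has_density h g \<longleftrightarrow> g \<in> borel_measurable unit_leb \<and> integrable unit_leb (\<lambda>s. (norm (g s))\<^sup>2) \<and>
    h = (\<lambda>t\<in>{0..1}. \<integral>s. indicator {0..t} s *\<^sub>R g s \<partial>unit_leb)"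
proof -
  have "(LINT s:{0..t}|lborel. g s) = (\<integral>s. indicator {0..t} s *\<^sub>R g s \<partial>unit_leb)" if "t \<in> {0..1}" for t
    unfolding unit_leb_def set_lebesgue_integral_def
    using that
    by (subst integral_restrict_space)
       (auto intro!: Bochner_Integration.integral_cong simp: indicator_def)
  then have "(\<lambda>t\<in>{0..1}. LINT s:{0..t}|lborel. g s) = (\<lambda>t\<in>{0..1}. \<integral>s. indicator {0..t} s *\<^sub>R g s \<partial>unit_leb)"
    by (intro restrict_ext)
  then show ?thesis
    unfolding has_density_def set_borel_measurable_def set_integrable_def unit_leb_def
    by (simp add: borel_measurable_restrict_space_iff integrable_restrict_space)
qed

definition cell :: "nat \<Rightarrow> nat \<Rightarrow> real set" where
  "cell m i = {real i / real m<..real (Suc i) / real m}"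

text \<open>The average over a cell is used on the next cell, so that averages of an adapted density
  are again adapted.\<close>

definition avg_step :: "nat \<Rightarrow> (real \<Rightarrow> 'b) \<Rightarrow> nat \<Rightarrow> 'b::{banach, second_countable_topology}" where
  "avg_step m g i = (if i = 0 then 0 else real m *\<^sub>R (\<integral>r. indicator (cell m (i - 1)) r *\<^sub>R g r \<partial>unit_leb))"

definition avg :: "nat \<Rightarrow> (real \<Rightarrow> 'b) \<Rightarrow> real \<Rightarrow> 'b::{banach, second_countable_topology}" where
  "avg m g s = (\<Sum>i<m. indicator (cell m i) s *\<^sub>R avg_step m g i)"

lemma cell_borel [measurable]: "cell m i \<in> sets borel"
  by (simp add: cell_def)

lemma cell_unique: "s \<in> cell m i \<Longrightarrow> s \<in> cell m j \<Longrightarrow> i = j"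
proof (induction i j rule: linorder_wlog)
  case (le i j)
  show ?case
  proof (rule ccontr)
    assume "i \<noteq> j"
    with le have "real (Suc i) / real m \<le> real j / real m" by (intro divide_right_mono) auto
    with le show False by (auto simp: cell_def)
  qed
qed auto

lemma avg_cell:
  assumes "s \<in> cell m i" "i < m"
  shows "avg m g s = avg_step m g i"
proof -
  have "avg m g s = (\<Sum>j<m. if j = i then avg_step m g j else 0)"
    unfolding avg_def
  proof (intro sum.cong refl)
    fix j
    show "indicator (cell m j) s *\<^sub>R avg_step m g j = (if j = i then avg_step m g j else 0)"
      using assms(1) cell_unique[OF assms(1), of j] by (cases "j = i") (auto simp: indicator_def)
  qed
  then show ?thesis using assms by simp
qed

lemma cell_cover:
  assumes "0 < s" "s \<le> 1" "0 < m"
  obtains i where "i < m" "s \<in> cell m i"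
proof -
  \<comment> \<open>A ceiling rather than a floor, since cells are open on the left and closed on
    the right.\<close>
  define i where "i = nat (\<lceil>s * m\<rceil> - 1)"
  have p: "0 < s * m" using assms by simp
  then have c: "\<lceil>s * m\<rceil> \<ge> 1" by linarith
  then have i: "real i = of_int \<lceil>s * m\<rceil> - 1" by (simp add: i_def)
  then have "real i < s * m" "s * m \<le> real (Suc i)" by linarith+
  then have mem: "s \<in> cell m i" using assms by (simp add: cell_def field_simps)
  have "s * m \<le> real m" using assms by (simp add: mult_left_le_one_le)
  then have "\<lceil>s * m\<rceil> \<le> int m" by linarith
  with c have "i < m" unfolding i_def by linarith
  with mem show ?thesis using that by blast
qed

lemma cell_subset: "i < m \<Longrightarrow> cell m i \<subseteq> {0..1}"
proof -
  assume i: "i < m"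
  then have le: "real (Suc i) / real m \<le> 1" by (simp add: divide_le_eq)
  moreover have "0 \<le> real i / real m" by simp
  ultimately show "cell m i \<subseteq> {0..1}"
    by (intro subsetI) (simp only: cell_def greaterThanAtMost_iff atLeastAtMost_iff, linarith)
qed

lemma measure_cell: "i < m \<Longrightarrow> measure unit_leb (cell m i) = 1 / m"
proof -
  assume i: "i < m"
  then have "measure unit_leb (cell m i) = measure lborel (cell m i)"
    using cell_subset[OF i] unfolding unit_leb_def by (subst measure_restrict_space) auto
  also have "\<dots> = real (Suc i) / real m - real i / real m"
    unfolding cell_def by (rule measure_lborel_Ioc) (simp add: divide_right_mono)
  also have "\<dots> = 1 / m" by (simp add: diff_divide_distrib[symmetric])
  finally show ?thesis .
qed

context
  fixes g :: "real \<Rightarrow> 'b::{banach, second_countable_topology}"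
  assumes g: "integrable unit_leb g"
begin

interpretation R: prob_space unit_leb by (rule prob_space_unit_leb)

lemma g_meas [measurable]: "g \<in> borel_measurable unit_leb"
  using g by auto

lemma cell_integrable: 
  "A \<in> sets borel \<Longrightarrow> integrable unit_leb (\<lambda>r. indicator A r *\<^sub>R g r)"
  by (rule Bochner_Integration.integrable_bound[OF g]) (auto simp: indicator_def)

lemma avg_integrable: "integrable unit_leb (avg m g)"
proof -
  have "integrable unit_leb (indicat_real (cell m i))" for i
    by (intro R.integrable_const_bound[of _ 1]) auto
  then have "integrable unit_leb (\<lambda>s. \<Sum>i<m. indicator (cell m i) s *\<^sub>R avg_step m g i)"
    by (intro Bochner_Integration.integrable_sum integrable_scaleR_left) auto
  then show ?thesis by (simp add: avg_def[abs_def])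
qed

text \<open>Each cell has mass \<open>1 / m\<close>, so an average contributes at most the integral
  of \<open>norm (g r)\<close> over the cell from which it was taken, and these cells are disjoint.
  The uniform bound allows convergence to be proved on a dense class only.\<close>

lemma avg_contraction: "(\<integral>s. norm (avg m g s) \<partial>unit_leb) \<le> (\<integral>s. norm (g s) \<partial>unit_leb)"
proof (cases "m = 0")
  case True then show ?thesis by (simp add: avg_def)
next
  case False
  have ind: "integrable unit_leb (indicat_real (cell m i))" for i
    by (intro R.integrable_const_bound[of _ 1]) auto
  have ci: "integrable unit_leb (\<lambda>r. indicator (cell m i) r * norm (g r))" for i
    using integrable_norm[OF cell_integrable[OF cell_borel, of m i]] by simp
  have step: "norm (avg_step m g i) / m \<le> (\<integral>r. indicator (cell m (i - 1)) r * norm (g r) \<partial>unit_leb)"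
    if "i \<noteq> 0" for i
    using integral_norm_bound[of unit_leb "\<lambda>r. indicator (cell m (i - 1)) r *\<^sub>R g r"] that False
    by (simp add: avg_step_def)
  have "(\<integral>s. norm (avg m g s) \<partial>unit_leb) \<le> (\<integral>s. (\<Sum>i<m. indicator (cell m i) s * norm (avg_step m g i)) \<partial>unit_leb)"
  proof (rule integral_mono)
    show "integrable unit_leb (\<lambda>s. norm (avg m g s))" by (intro integrable_norm avg_integrable)
    show "integrable unit_leb (\<lambda>s. \<Sum>i<m. indicator (cell m i) s * norm (avg_step m g i))"
      by (intro Bochner_Integration.integrable_sum integrable_mult_left ind)
    show "norm (avg m g s) \<le> (\<Sum>i<m. indicator (cell m i) s * norm (avg_step m g i))" for s
      unfolding avg_def by (rule order_trans[OF norm_sum]) (intro sum_mono, simp)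
  qed
  also have "\<dots> = (\<Sum>i<m. norm (avg_step m g i) / m)"
  proof (subst Bochner_Integration.integral_sum)
    show "integrable unit_leb (\<lambda>s. indicator (cell m i) s * norm (avg_step m g i))" for i
      by (intro integrable_mult_left ind)
    have "(\<integral>s. indicator (cell m i) s * norm (avg_step m g i) \<partial>unit_leb) = norm (avg_step m g i) / m"
      if "i < m" for i
      using measure_cell[OF that] cell_subset[OF that] by (simp add: Int_absorb2)
    then show "(\<Sum>i<m. \<integral>s. indicator (cell m i) s * norm (avg_step m g i) \<partial>unit_leb) = (\<Sum>i<m. norm (avg_step m g i) / m)"
      by (intro sum.cong) auto
  qed
  \<comment> \<open>The first cell has no predecessor and carries the value 0.\<close>
  also have "\<dots> = (\<Sum>i\<in>{1..<m}. norm (avg_step m g i) / m)"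
    using False by (intro sum.mono_neutral_right) (auto simp: avg_step_def not_less_eq)
  also have "\<dots> \<le> (\<Sum>i\<in>{1..<m}. \<integral>r. indicator (cell m (i - 1)) r * norm (g r) \<partial>unit_leb)"
    by (intro sum_mono step) auto
  also have "\<dots> = (\<integral>r. (\<Sum>i\<in>{1..<m}. indicator (cell m (i - 1)) r * norm (g r)) \<partial>unit_leb)"
    using ci by (intro Bochner_Integration.integral_sum[symmetric]) auto
  also have "\<dots> \<le> (\<integral>r. norm (g r) \<partial>unit_leb)"
  proof (intro integral_mono)
    fix r
    have disj: "disjoint_family_on (\<lambda>i. cell m (i - 1)) {1..<m}"
    proof (unfold disjoint_family_on_def, intro ballI impI)
      fix i j assume "i \<in> {1..<m}" "j \<in> {1..<m}" "i \<noteq> j"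
      then have "i - 1 \<noteq> j - 1" by auto
      then show "cell m (i - 1) \<inter> cell m (j - 1) = {}" using cell_unique[of _ m "i - 1" "j - 1"] by auto
    qed
    have "(\<Sum>i\<in>{1..<m}. indicat_real (cell m (i - 1)) r) \<le> 1"
      by (subst indicator_UN_disjoint[OF _ disj, symmetric]) (auto simp: indicator_def)
    from mult_right_mono[OF this, of "norm (g r)"]
    show "(\<Sum>i\<in>{1..<m}. indicator (cell m (i - 1)) r * norm (g r)) \<le> norm (g r)"
      unfolding sum_distrib_right by simp
  next
    show "integrable unit_leb (\<lambda>r. \<Sum>i\<in>{1..<m}. indicator (cell m (i - 1)) r * norm (g r))"
      by (intro Bochner_Integration.integrable_sum ci)
  qed (rule integrable_norm[OF g])
  finally show ?thesis .
qed

end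

lemma avg_step_add:
  assumes "integrable unit_leb f" "integrable unit_leb g"
  shows "avg_step m (\<lambda>s. f s + g s) i = avg_step m f i + avg_step m g i"
  using cell_integrable[OF assms(1)] cell_integrable[OF assms(2)]
  by (simp add: avg_step_def scaleR_add_right)

lemma avg_add:
  assumes "integrable unit_leb f" "integrable unit_leb g"
  shows "avg m (\<lambda>s. f s + g s) s = avg m f s + avg m g s"
  by (simp add: avg_def avg_step_add[OF assms] scaleR_add_right sum.distrib)

lemma avg_uminus: "avg m (\<lambda>s. - g s) s = - avg m g s"
proof -
  have "avg_step m (\<lambda>s. - g s) i = - avg_step m g i" for i by (simp add: avg_step_def)
  then show ?thesis by (simp add: avg_def sum_negf)
qed

lemma avg_diff:
  assumes "integrable unit_leb f" "integrable unit_leb g"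
  shows "avg m (\<lambda>s. f s - g s) s = avg m f s - avg m g s"
  using avg_add[of f "\<lambda>s. - g s" m s] assms by (simp add: avg_uminus)

section \<open>L1 convergence of the shifted averages\<close>

definition avg_conv :: "(real \<Rightarrow> 'b::{banach, second_countable_topology}) \<Rightarrow> bool" where
  "avg_conv g \<longleftrightarrow> (\<lambda>m. \<integral>s. norm (avg m g s - g s) \<partial>unit_leb) \<longlonglongrightarrow> 0"

lemma avg_conv_zero: "avg_conv (\<lambda>s. 0 :: 'b::{banach, second_countable_topology})"
proof -
  have "avg_step m (\<lambda>s. 0 :: 'b) i = 0" for m i by (simp add: avg_step_def)
  then show ?thesis by (simp add: avg_conv_def avg_def)
qed

lemma avg_conv_add:
  assumes f: "integrable unit_leb f" "avg_conv f" and g: "integrable unit_leb g" "avg_conv g"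
  shows "avg_conv (\<lambda>s. f s + g s)"
  unfolding avg_conv_def
proof (rule tendsto_sandwich[OF _ _ tendsto_const])
  show "(\<lambda>m. (\<integral>s. norm (avg m f s - f s) \<partial>unit_leb) + (\<integral>s. norm (avg m g s - g s) \<partial>unit_leb)) \<longlonglongrightarrow> 0"
    using tendsto_add[OF f(2)[unfolded avg_conv_def] g(2)[unfolded avg_conv_def]] by simp
  show "\<forall>\<^sub>F m in sequentially. (\<integral>s. norm (avg m (\<lambda>s. f s + g s) s - (f s + g s)) \<partial>unit_leb) \<le>
     (\<integral>s. norm (avg m f s - f s) \<partial>unit_leb) + (\<integral>s. norm (avg m g s - g s) \<partial>unit_leb)"
  proof (intro always_eventually allI)
    fix m
    have i: "integrable unit_leb (\<lambda>s. avg m f s - f s)" "integrable unit_leb (\<lambda>s. avg m g s - g s)"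
      using avg_integrable f g by auto
    have e: "avg m (\<lambda>s. f s + g s) s - (f s + g s) = (avg m f s - f s) + (avg m g s - g s)" for s
      by (simp add: avg_add[OF f(1) g(1)])
    show "(\<integral>s. norm (avg m (\<lambda>s. f s + g s) s - (f s + g s)) \<partial>unit_leb) \<le>
     (\<integral>s. norm (avg m f s - f s) \<partial>unit_leb) + (\<integral>s. norm (avg m g s - g s) \<partial>unit_leb)"
      unfolding e Bochner_Integration.integral_add[OF integrable_norm[OF i(1)] integrable_norm[OF i(2)], symmetric]
      by (intro integral_mono integrable_norm Bochner_Integration.integrable_add i norm_triangle_ineq)
  qed
qed auto

text \<open>The error splits into the average of \<open>g - f\<close>, the error of
  \<open>f\<close>, and \<open>g - f\<close> itself. \<open>avg_contraction\<close> bounds the first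
  of these by the last, which accounts for the thirds of \<open>e\<close>.\<close>

lemma avg_conv_approx:
  assumes g: "integrable unit_leb g"
    and ap: "\<And>e. 0 < e \<Longrightarrow> \<exists>f. integrable unit_leb f \<and> avg_conv f \<and> (\<integral>s. norm (g s - f s) \<partial>unit_leb) < e"
  shows "avg_conv g"
  unfolding avg_conv_def
proof (rule LIMSEQ_I)
  fix e :: real assume e: "0 < e"
  then obtain f where f: "integrable unit_leb f" "avg_conv f" "(\<integral>s. norm (g s - f s) \<partial>unit_leb) < e / 3"
    using ap[of "e / 3"] by auto
  from LIMSEQ_D[OF f(2)[unfolded avg_conv_def], of "e / 3"] e
  obtain m0 where m0: "\<And>m. m \<ge> m0 \<Longrightarrow> (\<integral>s. norm (avg m f s - f s) \<partial>unit_leb) < e / 3" by auto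
  have d: "integrable unit_leb (\<lambda>s. g s - f s)" using f g by auto
  have "norm ((\<integral>s. norm (avg m g s - g s) \<partial>unit_leb) - 0) < e" if "m \<ge> m0" for m
  proof -
    have i: "integrable unit_leb (\<lambda>s. norm (avg m (\<lambda>s. g s - f s) s))"
      "integrable unit_leb (\<lambda>s. norm (avg m f s - f s))" "integrable unit_leb (\<lambda>s. norm (g s - f s))"
      using avg_integrable[OF d] avg_integrable[OF f(1)] f d by auto
    have "norm (avg m g s - g s) \<le> norm (avg m (\<lambda>s. g s - f s) s) + norm (avg m f s - f s) + norm (g s - f s)" for s
    proof -
      have "avg m g s - g s = avg m (\<lambda>s. g s - f s) s + (avg m f s - f s) - (g s - f s)"
        by (simp add: avg_diff[OF g f(1)])
      then show ?thesis
        by (simp only:) (rule order_trans[OF norm_triangle_ineq4], intro add_right_mono norm_triangle_ineq)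
    qed
    then have "(\<integral>s. norm (avg m g s - g s) \<partial>unit_leb) \<le>
      (\<integral>s. norm (avg m (\<lambda>s. g s - f s) s) + norm (avg m f s - f s) + norm (g s - f s) \<partial>unit_leb)"
      using i avg_integrable[OF g] g by (intro integral_mono) auto
    also have "\<dots> < e"
      using i avg_contraction[OF d, of m] f(3) m0[OF that] by simp
    finally show ?thesis by simp
  qed
  then show "\<exists>m0. \<forall>m\<ge>m0. norm ((\<integral>s. norm (avg m g s - g s) \<partial>unit_leb) - 0) < e" by blast
qed

lemma unit_leb_bounded_integrable:
  fixes f :: "real \<Rightarrow> 'b::{banach, second_countable_topology}"
  assumes "f \<in> borel_measurable unit_leb" "\<And>s. norm (f s) \<le> C"
  shows "integrable unit_leb f"
proof -
  interpret R: prob_space unit_leb by (rule prob_space_unit_leb)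
  show ?thesis using assms by (intro R.integrable_const_bound[of _ C]) auto
qed

text \<open>Away from the jump the average over the previous cell is exact. Errors can occur only on
  the first cell and within two cell lengths after \<open>a\<close>, which together have length at
  most \<open>3 / m\<close>.\<close>

lemma avg_conv_atMost:
  fixes c :: "'b::{banach, second_countable_topology}"
  shows "avg_conv (\<lambda>s. indicator {..a} s *\<^sub>R c)"
  unfolding avg_conv_def
proof (rule tendsto_sandwich[OF _ _ tendsto_const])
  let ?g = "\<lambda>s. indicator {..a} s *\<^sub>R c"
  interpret R: prob_space unit_leb by (rule prob_space_unit_leb)
  have g: "integrable unit_leb ?g"
    by (rule unit_leb_bounded_integrable[of _ "norm c"]) (auto simp: indicator_def)
  show "(\<lambda>m. 3 * norm c / real m) \<longlonglongrightarrow> 0"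
    using tendsto_mult[OF tendsto_const[of "3 * norm c"] lim_inverse_n] by (simp add: divide_inverse)
  show "\<forall>\<^sub>F m in sequentially. (\<integral>s. norm (avg m ?g s - ?g s) \<partial>unit_leb) \<le> 3 * norm c / real m"
    using eventually_gt_at_top[of 0]
  proof eventually_elim
    fix m :: nat assume m: "0 < m"
    \<comment> \<open>An error of \<open>norm c\<close> is allowed on the first cell, where the
      shifted average is 0, and on two cell lengths after the jump.\<close>
    let ?b = "\<lambda>s. norm c * (indicator {0<..1/m} s + indicator {a<..a+2/m} s)"
    have big: "norm c \<le> ?b s" if "s \<in> {0<..1/m} \<union> {a<..a+2/m}" for s
    proof -
      have "norm c * 1 \<le> ?b s" using that by (intro mult_left_mono) (auto simp: indicator_def)
      then show ?thesis by simp
    qed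
    have nn: "0 \<le> ?b s" for s by (auto simp: indicator_def)
    have bound: "norm (avg m ?g s - ?g s) \<le> ?b s" if s: "0 < s" "s \<le> 1" for s
    proof -
      obtain i where i: "i < m" "s \<in> cell m i" using cell_cover[OF s m] .
      have av: "avg m ?g s = avg_step m ?g i" by (rule avg_cell[OF i(2,1)])
      show ?thesis
      proof (cases "i = 0")
        case True
        then have "s \<in> {0<..1/m}" using i by (simp add: cell_def)
        moreover have "norm (avg m ?g s - ?g s) \<le> norm c"
          using av True by (simp add: avg_step_def indicator_def)
        ultimately show ?thesis using order_trans[OF _ big[of s]] by blast
      next
        case False
        define p where "p = (\<integral>r. indicat_real (cell m (i - 1)) r * indicator {..a} r \<partial>unit_leb)"
        have st: "avg m ?g s = (m * p) *\<^sub>R c"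
        proof -
          have "(\<integral>r. indicator (cell m (i - 1)) r *\<^sub>R ?g r \<partial>unit_leb) = p *\<^sub>R c"
            unfolding p_def using m
            by (subst integral_scaleR_left[symmetric])
               (auto intro!: unit_leb_bounded_integrable[of _ 1] simp: indicator_def)
          then show ?thesis using False by (simp add: av avg_step_def)
        qed
        have mc: "measure unit_leb (cell m (i - 1)) = 1 / m"
          using i False by (intro measure_cell) auto
        have sub: "cell m (i - 1) \<inter> space unit_leb = cell m (i - 1)"
        proof -
          have "i - 1 < m" using i by linarith
          from cell_subset[OF this] show ?thesis by auto
        qed
        have Ic: "(\<integral>r. indicat_real (cell m (i - 1)) r \<partial>unit_leb) = 1 / m"
          using mc sub by simp
        have p: "0 \<le> p" "p \<le> 1 / m"
        proof -
          show "0 \<le> p" unfolding p_def by (intro integral_nonneg_AE) auto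
          have "p \<le> (\<integral>r. indicat_real (cell m (i - 1)) r \<partial>unit_leb)"
            unfolding p_def
            by (intro integral_mono unit_leb_bounded_integrable[of _ 1]) (auto simp: indicator_def)
          then show "p \<le> 1 / m" by (simp only: Ic)
        qed
        then have mp: "0 \<le> m * p" "m * p \<le> 1" using m by (auto simp: field_simps)
        consider "s \<le> a" | "a < s" "s \<le> a + 2 / m" | "a + 2 / m < s" by linarith
        then show ?thesis
        proof cases
          case 1
          have "p = (\<integral>r. indicat_real (cell m (i - 1)) r \<partial>unit_leb)"
            unfolding p_def
            using i False 1 by (intro Bochner_Integration.integral_cong) (auto simp: cell_def indicator_def)
          then have "p = 1 / m" by (simp only: Ic)
          then have "avg m ?g s - ?g s = 0" using 1 m by (simp add: st)
          then show ?thesis using nn[of s] by (simp only: norm_zero)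
        next
          case 2
          have "norm ((m * p) *\<^sub>R c) \<le> norm c"
            using mult_right_mono[OF mp(2), of "norm c"] by (simp add: abs_of_nonneg[OF mp(1)])
          moreover have "?g s = 0" using 2 by simp
          ultimately have "norm (avg m ?g s - ?g s) \<le> norm c" by (simp only: st diff_0_right)
          then show ?thesis using order_trans[OF _ big[of s]] 2 by auto
        next
          \<comment> \<open>The previous cell starts no earlier than \<open>s - 2 / m\<close>, hence
            beyond the jump, and its average is exactly 0.\<close>
          case 3
          have "p = (\<integral>r. 0 \<partial>unit_leb)"
            unfolding p_def
          proof (intro Bochner_Integration.integral_cong refl)
            fix r
            have "real (i - 1) / m \<ge> s - 2 / m"
            proof -
              have "real (i - 1) = real (Suc i) - 2" using False by simp
              then have "real (i - 1) / m = real (Suc i) / m - 2 / m" by (simp only: diff_divide_distrib)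
              moreover have "s \<le> real (Suc i) / m" using i(2) by (simp add: cell_def)
              ultimately show ?thesis by linarith
            qed
            then show "indicat_real (cell m (i - 1)) r * indicator {..a} r = 0"
              using 3 by (auto simp: cell_def indicator_def)
          qed
          then have "p = 0" by simp
          moreover have "\<not> s \<le> a"
            using 3 m divide_nonneg_nonneg[of 2 "real m"] by linarith
          ultimately have "avg m ?g s - ?g s = 0" using 3 m by (simp add: st)
          then show ?thesis using nn[of s] by (simp only: norm_zero)
        qed
      qed
    qed
    have i1: "integrable unit_leb (\<lambda>s. norm (avg m ?g s - ?g s))" using avg_integrable[OF g] g by auto
    have i2: "integrable unit_leb ?b"
      by (rule unit_leb_bounded_integrable[of _ "norm c * 2"]) (auto simp: indicator_def)
    have ind: "integrable unit_leb (indicat_real A)" if "A \<in> sets borel" for A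
      using that by (intro unit_leb_bounded_integrable[of _ 1]) (auto simp: indicator_def)
    have "AE s in unit_leb. s \<noteq> 0"
    proof -
      have "AE s in lborel. s \<noteq> (0::real)" by (rule AE_lborel_singleton)
      then show ?thesis unfolding unit_leb_def by (subst AE_restrict_space_iff) (auto elim: eventually_mono)
    qed
    then have "AE s in unit_leb. norm (avg m ?g s - ?g s) \<le> ?b s"
      using AE_space by eventually_elim (auto intro!: bound)
    then have "(\<integral>s. norm (avg m ?g s - ?g s) \<partial>unit_leb) \<le> (\<integral>s. ?b s \<partial>unit_leb)"
      by (intro integral_mono_AE i1 i2)
    also have "\<dots> = norm c * (measure unit_leb ({0<..1/m} \<inter> {0..1}) + measure unit_leb ({a<..a+2/m} \<inter> {0..1}))"
      using ind by simp
    also have "\<dots> \<le> norm c * (1 / m + 2 / m)"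
    proof (intro mult_left_mono add_mono)
      have *: "measure unit_leb ({x<..y} \<inter> {0..1}) \<le> y - x" if "x \<le> y" for x y
      proof -
        have "measure unit_leb ({x<..y} \<inter> {0..1}) \<le> measure lborel {x<..y}"
          unfolding unit_leb_def
          by (subst measure_restrict_space) (auto intro!: measure_mono_fmeasurable simp: fmeasurable_def emeasure_lborel_Ioc[OF that])
        then show ?thesis using that by simp
      qed
      show "measure unit_leb ({0<..1/m} \<inter> {0..1}) \<le> 1 / m" using *[of 0 "1 / m"] by simp
      show "measure unit_leb ({a<..a+2/m} \<inter> {0..1}) \<le> 2 / m" using *[of a "a + 2 / m"] by simp
    qed simp
    also have "\<dots> = 3 * norm c / m" by (simp add: field_simps)
    finally show "(\<integral>s. norm (avg m ?g s - ?g s) \<partial>unit_leb) \<le> 3 * norm c / m" .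
  qed
qed auto

text \<open>Half-lines generate the Borel sets and are closed under intersection, so it suffices
  that the sets for which the averages converge form a Dynkin system.\<close>

lemma avg_conv_indicator:
  fixes c :: "'b::{banach, second_countable_topology}"
  assumes "A \<in> sets borel"
  shows "avg_conv (\<lambda>s. indicator A s *\<^sub>R c)"
proof -
  have bd: "integrable unit_leb (\<lambda>s. indicator B s *\<^sub>R c)" if "B \<in> sets borel" for B
    using that by (intro unit_leb_bounded_integrable[of _ "norm c"]) (auto simp: indicator_def)
  have borel: "sets borel = sigma_sets UNIV (range (\<lambda>a::real. {..a}))"
    by (simp add: borel_eq_atMost)
  \<comment> \<open>Dominated convergence turns a bounded pointwise limit into L1 approximation, to
    which \<open>avg_conv_approx\<close> applies. It handles both the whole line and countable
    unions.\<close>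
  have bounded_lim: "avg_conv f" if f: "integrable unit_leb f"
    and X: "\<And>n. integrable unit_leb (Y n)" "\<And>n. avg_conv (Y n)"
      "\<And>s. (\<lambda>n. Y n s) \<longlonglongrightarrow> f s" "\<And>n s. norm (Y n s) \<le> K"
    for f :: "real \<Rightarrow> 'b" and Y and K :: real
  proof (rule avg_conv_approx[OF f])
    fix e :: real assume e: "0 < e"
    have "(\<lambda>n. \<integral>s. norm (f s - Y n s) \<partial>unit_leb) \<longlonglongrightarrow> (\<integral>s. 0 \<partial>unit_leb)"
    proof (rule integral_dominated_convergence[where w = "\<lambda>s. norm (f s) + K"])
      interpret R: prob_space unit_leb by (rule prob_space_unit_leb)
      show "integrable unit_leb (\<lambda>s. norm (f s) + K)" using f by auto
      show "AE s in unit_leb. (\<lambda>n. norm (f s - Y n s)) \<longlonglongrightarrow> 0"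
        using X(3) by (auto intro!: AE_I2 tendsto_eq_intros simp: tendsto_norm_zero_iff)
      show "AE s in unit_leb. norm (norm (f s - Y n s)) \<le> norm (f s) + K" for n
      proof (intro AE_I2)
        fix s
        show "norm (norm (f s - Y n s)) \<le> norm (f s) + K"
          using X(4)[of n s] norm_triangle_ineq4[of "f s" "Y n s"] by simp
      qed
    qed (use f X(1) in auto)
    from LIMSEQ_D[OF this e] obtain n where "(\<integral>s. norm (f s - Y n s) \<partial>unit_leb) < e" by auto
    with X show "\<exists>f'. integrable unit_leb f' \<and> avg_conv f' \<and> (\<integral>s. norm (f s - f' s) \<partial>unit_leb) < e" by blast
  qed
  have Is: "Int_stable (range (\<lambda>a::real. {..a}))" by (auto simp: Int_stable_def)
  \<comment> \<open>The whole line is a limit of half-lines; complements are then differences of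
    convergent families.\<close>
  have univ: "avg_conv (\<lambda>s. c)"
  proof (rule bounded_lim[where Y = "\<lambda>n s. indicator {..real n} s *\<^sub>R c" and K = "norm c"])
    show "integrable unit_leb (\<lambda>s. c)" by (rule unit_leb_bounded_integrable[of _ "norm c"]) auto
    show "(\<lambda>n. indicator {..real n} s *\<^sub>R c) \<longlonglongrightarrow> c" for s
    proof (rule tendsto_eventually)
      obtain n0 :: nat where "s \<le> n0" using real_arch_simple by blast
      then show "\<forall>\<^sub>F n in sequentially. indicator {..real n} s *\<^sub>R c = c"
        by (intro eventually_sequentiallyI[of n0]) (auto simp: indicator_def)
    qed
    show "avg_conv (\<lambda>s. indicator {..real n} s *\<^sub>R c)" for n by (rule avg_conv_atMost)
    show "integrable unit_leb (\<lambda>s. indicator {..real n} s *\<^sub>R c)" for n by (rule bd) simp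
    show "norm (indicator {..real n} s *\<^sub>R c) \<le> norm c" for n s by (simp add: indicator_def)
  qed
  have "range (\<lambda>a::real. {..a}) \<subseteq> Pow UNIV" by simp
  from Is this assms[unfolded borel] show ?thesis
  proof (induction rule: sigma_sets_induct_disjoint)
    case (basic A) then show ?case by (auto intro: avg_conv_atMost)
  next
    case empty then show ?case using avg_conv_zero by simp
  next
    case (compl A)
    then have A: "A \<in> sets borel" by (simp add: borel)
    have "avg_conv (\<lambda>s. - (indicator A s *\<^sub>R c))"
      using compl by (simp add: avg_conv_def avg_uminus norm_minus_commute)
    then have "avg_conv (\<lambda>s. c + - (indicator A s *\<^sub>R c))"
      using bd[OF A] by (intro avg_conv_add univ) (auto intro!: unit_leb_bounded_integrable[of _ "norm c"])
    moreover have "c + - (indicator A s *\<^sub>R c) = indicator (UNIV - A) s *\<^sub>R c" for s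
      by (simp add: indicator_def)
    ultimately show ?case by (simp only:)
  next
    case (union A)
    then have A: "A i \<in> sets borel" for i by (auto simp: borel)
    define B where "B n = (\<Union>i<n. A i)" for n
    have B: "B n \<in> sets borel" for n using A by (auto simp: B_def)
    have cB: "avg_conv (\<lambda>s. indicator (B n) s *\<^sub>R c)" for n
    proof (induction n)
      case 0 show ?case using avg_conv_zero by (simp add: B_def)
    next
      case (Suc n)
      have "A i \<inter> A n = {}" if "i < n" for i
        using disjoint_family_onD[OF union(1), of i n] that by simp
      then have "B n \<inter> A n = {}" by (auto simp: B_def)
      moreover have "B (Suc n) = B n \<union> A n" by (auto simp: B_def less_Suc_eq)
      ultimately have "indicator (B (Suc n)) s *\<^sub>R c = indicator (B n) s *\<^sub>R c + indicator (A n) s *\<^sub>R c" for s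
        by (auto simp: indicator_def)
      then show ?case using avg_conv_add[OF bd[OF B] Suc bd[OF A] union(3)] by simp
    qed
    show ?case
    proof (rule bounded_lim[where Y = "\<lambda>n s. indicator (B n) s *\<^sub>R c" and K = "norm c"])
      show "(\<lambda>n. indicator (B n) s *\<^sub>R c) \<longlonglongrightarrow> indicator (\<Union> (range A)) s *\<^sub>R c" for s
      proof (cases "s \<in> \<Union> (range A)")
        case True
        then obtain i where "s \<in> A i" by auto
        then have "\<forall>\<^sub>F n in sequentially. indicator (B n) s *\<^sub>R c = indicator (\<Union> (range A)) s *\<^sub>R c"
          by (intro eventually_sequentiallyI[of "Suc i"]) (auto simp: B_def indicator_def less_eq_Suc_le)
        then show ?thesis by (rule tendsto_eventually)
      next
        case False
        then have "s \<notin> B n" for n by (auto simp: B_def)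
        with False show ?thesis by simp
      qed
      show "integrable unit_leb (\<lambda>s. indicator (\<Union> (range A)) s *\<^sub>R c)" using A by (intro bd) auto
      show "integrable unit_leb (\<lambda>s. indicator (B n) s *\<^sub>R c)" for n by (intro bd B)
      show "avg_conv (\<lambda>s. indicator (B n) s *\<^sub>R c)" for n by (rule cB)
      show "norm (indicator (B n) s *\<^sub>R c) \<le> norm c" for n s by (simp add: indicator_def)
    qed
  qed
qed

lemma avg_convergence:
  fixes g :: "real \<Rightarrow> 'b::{banach, second_countable_topology}"
  assumes "integrable unit_leb g"
  shows "avg_conv g"
  using assms
proof (induction rule: integrable_induct)
  case (base A c)
  from base(1) have "A \<in> sets borel" by (auto simp: unit_leb_def sets_restrict_space)
  then show ?case by (rule avg_conv_indicator)
next
  case (add f g) then show ?case by (intro avg_conv_add)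
next
  case (lim f s)
  show ?case
  proof (rule avg_conv_approx[OF lim.hyps(4)])
    fix e :: real assume e: "0 < e"
    have "(\<lambda>n. \<integral>x. norm (f x - s n x) \<partial>unit_leb) \<longlonglongrightarrow> (\<integral>x. 0 \<partial>unit_leb)"
    proof (rule integral_dominated_convergence[where w = "\<lambda>x. norm (f x) + 2 * norm (f x)"])
      show "integrable unit_leb (\<lambda>x. norm (f x) + 2 * norm (f x))" using lim by auto
      show "AE x in unit_leb. (\<lambda>n. norm (f x - s n x)) \<longlonglongrightarrow> 0"
        using lim.hyps(2) by (auto intro!: AE_I2 tendsto_eq_intros simp: tendsto_norm_zero_iff)
      show "AE x in unit_leb. norm (norm (f x - s n x)) \<le> norm (f x) + 2 * norm (f x)" for n
      proof (intro AE_I2)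
        fix x assume "x \<in> space unit_leb"
        then show "norm (norm (f x - s n x)) \<le> norm (f x) + 2 * norm (f x)"
          using lim.hyps(3)[of x n] norm_triangle_ineq4[of "f x" "s n x"] by auto
      qed
    qed (use lim in auto)
    from LIMSEQ_D[OF this e] obtain n where "(\<integral>x. norm (f x - s n x) \<partial>unit_leb) < e" by auto
    with lim show "\<exists>f'. integrable unit_leb f' \<and> avg_conv f' \<and> (\<integral>s. norm (f s - f' s) \<partial>unit_leb) < e" by blast
  qed
qed

lemma square_integrable_unit_leb:
  fixes g :: "real \<Rightarrow> 'b::{banach, second_countable_topology}"
  assumes "g \<in> borel_measurable unit_leb" "integrable unit_leb (\<lambda>s. (norm (g s))\<^sup>2)"
  shows "integrable unit_leb g"
proof -
  interpret R: prob_space unit_leb by (rule prob_space_unit_leb)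
  have "(\<lambda>s. norm (g s)) \<in> borel_measurable unit_leb" using assms(1) by measurable
  from R.square_integrable_imp_integrable[OF this assms(2)]
  have "integrable unit_leb (\<lambda>s. norm (g s))" .
  then show ?thesis using assms(1) by (simp add: integrable_norm_iff)
qed

lemma has_density_integrable: "has_density h g \<Longrightarrow> integrable unit_leb g"
  by (auto simp: has_density_unit_leb intro: square_integrable_unit_leb)

text \<open>By the fundamental theorem, a cell average of the density is a difference quotient of
  the path. Averages thus depend on \<open>h\<close> alone, and they can be read from the drift at
  grid times.\<close>

lemma avg_step_density:
  assumes h: "has_density h g" and i: "i \<noteq> 0" "i \<le> m"
  shows "avg_step m g i = real m *\<^sub>R (h (i / m) - h (real (i - 1) / m))"
proof -
  have m: "0 < real m" using i by auto
  have le: "real (i - 1) / m \<le> i / m" by (intro divide_right_mono) auto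
  have I: "i / m \<in> {0..1}" "real (i - 1) / m \<in> {0..1}"
    using i m by (auto simp: divide_le_eq)
  have eq: "indicator {0..i / m} s *\<^sub>R g s - indicator {0..real (i - 1) / m} s *\<^sub>R g s = indicator (cell m (i - 1)) s *\<^sub>R g s"
    if "0 \<le> s" for s
    using i le that by (auto simp: cell_def indicator_def)
  have int: "integrable unit_leb (\<lambda>s. indicator {0..a} s *\<^sub>R g s)" for a :: real
    using cell_integrable[OF has_density_integrable[OF h], of "{0..a}"] by simp
  have "h (i / m) - h (real (i - 1) / m) = 
      (\<integral>s. indicator {0..i / m} s *\<^sub>R g s - indicator {0..real (i - 1) / m} s *\<^sub>R g s \<partial>unit_leb)"
    using h I unfolding has_density_unit_leb
    by (subst Bochner_Integration.integral_diff[OF int int]) simp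
  also have "\<dots> = (\<integral>s. indicator (cell m (i - 1)) s *\<^sub>R g s \<partial>unit_leb)"
    by (intro Bochner_Integration.integral_cong refl eq) simp
  finally show ?thesis using i by (simp add: avg_step_def)
qed

text \<open>Two densities of \<open>h\<close> have the same cell averages, and these converge in L1
  to each of them.\<close>

lemma has_density_unique:
  assumes g: "has_density h g" and f: "has_density h f"
  shows "AE s in unit_leb. g s = f s"
proof -
  have st: "avg_step m g i = avg_step m f i" if "i < m" for m i
  proof (cases "i = 0")
    case False
    then show ?thesis using avg_step_density[OF g False, of m] avg_step_density[OF f False, of m] that by simp
  qed (simp add: avg_step_def)
  have av: "avg m g s = avg m f s" for m s
    unfolding avg_def by (intro sum.cong) (auto simp: st)
  note gi = has_density_integrable[OF g] and fi = has_density_integrable[OF f]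
  have le: "(\<integral>s. norm (g s - f s) \<partial>unit_leb) \<le> (\<integral>s. norm (avg m g s - g s) \<partial>unit_leb) + (\<integral>s. norm (avg m f s - f s) \<partial>unit_leb)" for m
  proof -
    have i: "integrable unit_leb (\<lambda>s. norm (avg m g s - g s))" "integrable unit_leb (\<lambda>s. norm (avg m f s - f s))"
      by (intro integrable_norm Bochner_Integration.integrable_diff avg_integrable gi fi)+
    have "norm (g s - f s) \<le> norm (avg m g s - g s) + norm (avg m f s - f s)" for s
      using norm_triangle_ineq4[of "avg m f s - f s" "avg m g s - g s"] by (simp add: av)
    then show ?thesis
      unfolding Bochner_Integration.integral_add[OF i, symmetric]
      using gi fi i by (intro integral_mono) auto
  qed
  have "(\<lambda>m. (\<integral>s. norm (avg m g s - g s) \<partial>unit_leb) + (\<integral>s. norm (avg m f s - f s) \<partial>unit_leb)) \<longlonglongrightarrow> 0 + 0"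
    using avg_convergence[OF gi] avg_convergence[OF fi] unfolding avg_conv_def by (intro tendsto_add)
  then have "(\<integral>s. norm (g s - f s) \<partial>unit_leb) \<le> 0"
    using le by (intro LIMSEQ_le_const[of _ 0]) auto
  then have "(\<integral>s. norm (g s - f s) \<partial>unit_leb) = 0"
    by (intro antisym integral_nonneg_AE) auto
  then have "AE s in unit_leb. norm (g s - f s) = 0"
    using gi fi by (subst (asm) integral_nonneg_eq_0_iff_AE) auto
  then show ?thesis by auto
qed

text \<open>Uniqueness of the density removes the arbitrary choice in
  \<open>cm_norm_sq\<close>.\<close>

lemma cm_norm_sq_eq:
  assumes "has_density h g"
  shows "cm_norm_sq h = (\<integral>s. (norm (g s))\<^sup>2 \<partial>unit_leb)"
proof -
  let ?f = "SOME g. has_density h g"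
  have f: "has_density h ?f" using assms by (rule someI[of "has_density h"])
  have "cm_norm_sq h = (\<integral>s. (norm (?f s))\<^sup>2 \<partial>unit_leb)"
    unfolding cm_norm_sq_def unit_leb_def set_lebesgue_integral_def
    by (subst integral_restrict_space) auto
  also have "\<dots> = (\<integral>s. (norm (g s))\<^sup>2 \<partial>unit_leb)"
  proof (rule integral_cong_AE)
    have [measurable]: "?f \<in> borel_measurable unit_leb" "g \<in> borel_measurable unit_leb"
      using f assms unfolding has_density_unit_leb by blast+
    show "(\<lambda>s. (norm (?f s))\<^sup>2) \<in> borel_measurable unit_leb" "(\<lambda>s. (norm (g s))\<^sup>2) \<in> borel_measurable unit_leb"
      by measurable
    show "AE s in unit_leb. (norm (?f s))\<^sup>2 = (norm (g s))\<^sup>2"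
      using has_density_unique[OF f assms] by eventually_elim simp
  qed
  finally show ?thesis .
qed

text \<open>Clipping the conditional expectation to \<open>[- C, C]\<close> alters it on a null set
  only and gives a bound at every point, so that later products are integrable without almost sure
  reasoning.\<close>

lemma (in prob_space) bounded_cond_exp:
  fixes f :: "'a \<Rightarrow> real"
  assumes G: "subalgebra M G" and f: "f \<in> borel_measurable M" "\<And>x. x \<in> space M \<Longrightarrow> \<bar>f x\<bar> \<le> C"
    and C: "0 \<le> C"
  obtains f' where "f' \<in> borel_measurable G" "\<And>x. \<bar>f' x\<bar> \<le> C"
    "\<And>g. g \<in> borel_measurable G \<Longrightarrow> integrable M g \<Longrightarrow> (\<integral>x. g x * f x \<partial>M) = (\<integral>x. g x * f' x \<partial>M)"
proof -
  interpret G: sigma_finite_subalgebra M G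
    by (intro finite_measure_subalgebra_is_sigma_finite finite_measure_subalgebra.intro
      finite_measure_subalgebra_axioms.intro G finite_measure_axioms)
  define f' where "f' x = max (- C) (min C (real_cond_exp M G f x))" for x
  have fi: "integrable M f" using f by (intro integrable_const_bound[of _ C]) (auto intro!: AE_I2)
  have m: "f' \<in> borel_measurable G" unfolding f'_def by measurable
  have b: "f x \<le> C \<and> - C \<le> f x" if "x \<in> space M" for x using f(2)[OF that] by linarith
  have le: "AE x in M. f x \<le> C" and ge: "AE x in M. f x \<ge> - C"
    using b by (auto intro!: AE_I2)
  have ae: "AE x in M. real_cond_exp M G f x = f' x"
    using G.real_cond_exp_le_c[OF fi le] G.real_cond_exp_ge_c[OF fi ge]
    by eventually_elim (auto simp: f'_def)
  show ?thesis
  proof (rule that[OF m])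
    show "\<bar>f' x\<bar> \<le> C" for x using C by (auto simp: f'_def)
    fix g :: "'a \<Rightarrow> real" assume g: "g \<in> borel_measurable G" "integrable M g"
    have i: "integrable M (\<lambda>x. g x * f x)"
    proof (rule Bochner_Integration.integrable_bound)
      show "integrable M (\<lambda>x. C * g x)" using g by simp
      show "AE x in M. norm (g x * f x) \<le> norm (C * g x)"
      proof (intro AE_I2)
        fix x assume "x \<in> space M"
        from mult_left_mono[OF f(2)[OF this], of "\<bar>g x\<bar>"] C
        show "norm (g x * f x) \<le> norm (C * g x)" by (simp add: abs_mult mult.commute)
      qed
    qed (use g f in auto)
    have gM: "g \<in> borel_measurable M" using g by auto
    have "(\<integral>x. g x * f x \<partial>M) = (\<integral>x. g x * real_cond_exp M G f x \<partial>M)"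
      by (rule G.real_cond_exp_intg(2)[symmetric, OF i g(1) f(1)])
    also have "\<dots> = (\<integral>x. g x * f' x \<partial>M)"
      using ae gM measurable_from_subalg[OF G m] by (intro integral_cong_AE) auto
    finally show "(\<integral>x. g x * f x \<partial>M) = (\<integral>x. g x * f' x \<partial>M)" .
  qed
qed

section \<open>Square-integrable limits\<close>

lemma square_diff_le: "ennreal ((a - b)\<^sup>2) \<le> 2 * ennreal ((a - c)\<^sup>2) + 2 * ennreal ((b - c)\<^sup>2)"
proof -
  have "(a - b)\<^sup>2 \<le> 2 * (a - c)\<^sup>2 + 2 * (b - c)\<^sup>2"
    using zero_le_power2[of "(a - c) + (b - c)"] by (simp add: power2_eq_square algebra_simps)
  then have "ennreal ((a - b)\<^sup>2) \<le> ennreal (2 * (a - c)\<^sup>2 + 2 * (b - c)\<^sup>2)" by (rule ennreal_leI)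
  also have "\<dots> = 2 * ennreal ((a - c)\<^sup>2) + 2 * ennreal ((b - c)\<^sup>2)"
    by (simp add: ennreal_plus ennreal_mult)
  finally show ?thesis .
qed

lemma nn_square_diff_le:
  fixes f g h :: "'a \<Rightarrow> real"
  assumes [measurable]: "f \<in> borel_measurable M" "g \<in> borel_measurable M" "h \<in> borel_measurable M"
  shows "(\<integral>\<^sup>+x. ennreal ((f x - g x)\<^sup>2) \<partial>M) \<le>
    2 * (\<integral>\<^sup>+x. ennreal ((f x - h x)\<^sup>2) \<partial>M) + 2 * (\<integral>\<^sup>+x. ennreal ((g x - h x)\<^sup>2) \<partial>M)"
proof -
  have "(\<integral>\<^sup>+x. ennreal ((f x - g x)\<^sup>2) \<partial>M) \<le> (\<integral>\<^sup>+x. 2 * ennreal ((f x - h x)\<^sup>2) + 2 * ennreal ((g x - h x)\<^sup>2) \<partial>M)"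
    by (intro nn_integral_mono square_diff_le)
  also have "\<dots> = 2 * (\<integral>\<^sup>+x. ennreal ((f x - h x)\<^sup>2) \<partial>M) + 2 * (\<integral>\<^sup>+x. ennreal ((g x - h x)\<^sup>2) \<partial>M)"
    by (simp add: nn_integral_add nn_integral_cmult)
  finally show ?thesis .
qed

lemma ennreal_double_tendsto_0:
  fixes a b :: "nat \<Rightarrow> ennreal"
  assumes "a \<longlonglongrightarrow> 0" "b \<longlonglongrightarrow> 0" "\<And>n. c n \<le> 2 * a n + 2 * b n"
  shows "c \<longlonglongrightarrow> 0"
proof (rule tendsto_sandwich[OF _ _ tendsto_const])
  have "(\<lambda>n. 2 * a n + 2 * b n) \<longlonglongrightarrow> 2 * 0 + 2 * 0"
    using assms by (intro tendsto_add ennreal_tendsto_cmult) auto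
  then show "(\<lambda>n. 2 * a n + 2 * b n) \<longlonglongrightarrow> 0" by simp
qed (use assms in auto)

lemma L2_limit_unique:
  fixes f g :: "'a \<Rightarrow> real"
  assumes [measurable]: "f \<in> borel_measurable M" "g \<in> borel_measurable M" "\<And>n. X n \<in> borel_measurable M"
    and f: "(\<lambda>n. \<integral>\<^sup>+x. ennreal ((X n x - f x)\<^sup>2) \<partial>M) \<longlonglongrightarrow> 0"
    and g: "(\<lambda>n. \<integral>\<^sup>+x. ennreal ((X n x - g x)\<^sup>2) \<partial>M) \<longlonglongrightarrow> 0"
  shows "AE x in M. f x = g x"
proof -
  have "(\<lambda>n. \<integral>\<^sup>+x. ennreal ((f x - g x)\<^sup>2) \<partial>M) \<longlonglongrightarrow> 0"
  proof (rule ennreal_double_tendsto_0[OF f g])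
    show "(\<integral>\<^sup>+x. ennreal ((f x - g x)\<^sup>2) \<partial>M) \<le>
      2 * (\<integral>\<^sup>+x. ennreal ((X n x - f x)\<^sup>2) \<partial>M) + 2 * (\<integral>\<^sup>+x. ennreal ((X n x - g x)\<^sup>2) \<partial>M)" for n
      using nn_square_diff_le[of f M g "X n"] by (simp add: power2_commute)
  qed
  then have "(\<integral>\<^sup>+x. ennreal ((f x - g x)\<^sup>2) \<partial>M) = 0" by (simp add: LIMSEQ_const_iff)
  then have "AE x in M. ennreal ((f x - g x)\<^sup>2) = 0" by (subst (asm) nn_integral_0_iff_AE) auto
  then show ?thesis by (auto simp: ennreal_eq_0_iff)
qed

text \<open>The classical argument: a subsequence whose successive distances are summable converges
  almost everywhere, and Fatou's lemma upgrades this to mean-square convergence of the full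
  sequence.\<close>

lemma (in prob_space) L2_complete:
  fixes X :: "nat \<Rightarrow> 'a \<Rightarrow> real"
  assumes X[measurable]: "\<And>n. X n \<in> borel_measurable M"
    and cauchy: "\<And>e. 0 < e \<Longrightarrow> \<exists>n0. \<forall>m\<ge>n0. \<forall>k\<ge>n0. (\<integral>\<^sup>+x. ennreal ((X m x - X k x)\<^sup>2) \<partial>M) \<le> ennreal e"
  shows "\<exists>I\<in>borel_measurable M. (\<lambda>n. \<integral>\<^sup>+x. ennreal ((X n x - I x)\<^sup>2) \<partial>M) \<longlonglongrightarrow> 0"
proof -
  have "\<forall>n. \<exists>n0. \<forall>m\<ge>n0. \<forall>k\<ge>n0. (\<integral>\<^sup>+x. ennreal ((X m x - X k x)\<^sup>2) \<partial>M) \<le> ennreal ((1/4)^n)"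
    using cauchy by simp
  from choice[OF this] obtain q where
    "\<forall>n. \<forall>m\<ge>q n. \<forall>k\<ge>q n. (\<integral>\<^sup>+x. ennreal ((X m x - X k x)\<^sup>2) \<partial>M) \<le> ennreal ((1/4)^n)"
    by blast
  then have q: "(\<integral>\<^sup>+x. ennreal ((X m x - X k x)\<^sup>2) \<partial>M) \<le> ennreal ((1/4)^n)"
    if "m \<ge> q n" "k \<ge> q n" for n m k using that by blast
  \<comment> \<open>The maximum keeps \<open>r n\<close> and \<open>r (Suc n)\<close> both beyond
    \<open>q n\<close>; adding \<open>n\<close> makes the indices unbounded.\<close>
  define r where "r n = Max (q ` {..n}) + n" for n
  have rq: "q n \<le> r n" for n
    unfolding r_def by (intro trans_le_add1 Max_ge) auto
  have rmono: "q n \<le> r (Suc n)" for n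
    unfolding r_def by (intro trans_le_add1 Max_ge) auto
  have rn: "n \<le> r n" for n by (simp add: r_def)
  define D where "D n x = X (r (Suc n)) x - X (r n) x" for n x
  have [measurable]: "D n \<in> borel_measurable M" for n unfolding D_def by measurable
  have D2: "(\<integral>\<^sup>+x. ennreal ((D n x)\<^sup>2) \<partial>M) \<le> ennreal ((1/4)^n)" for n
    unfolding D_def by (rule q[OF rmono rq])
  have D1: "(\<integral>\<^sup>+x. ennreal \<bar>D n x\<bar> \<partial>M) \<le> ennreal (2 * (1/2)^n)" for n
  proof -
    \<comment> \<open>The weight \<open>2^n\<close> balances the two terms: second moments of order
      \<open>(1/4)^n\<close> yield first moments of order \<open>(1/2)^n\<close>, which are
      summable.\<close>
    have "\<bar>d\<bar> \<le> 2^n * d\<^sup>2 + (1/2)^n" for d :: real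
    proof -
      have "0 \<le> 2^n * (\<bar>d\<bar> - (1/2)^n)\<^sup>2" by simp
      also have "\<dots> = 2^n * d\<^sup>2 - 2 * (2^n * (1/2)^n) * \<bar>d\<bar> + (2^n * (1/2)^n) * (1/2)^n"
        by (simp add: power2_eq_square algebra_simps)
      also have "2^n * (1/2)^n = (1::real)" by (simp add: power_mult_distrib[symmetric])
      finally show ?thesis using abs_ge_zero[of d] by linarith
    qed
    then have "ennreal \<bar>D n x\<bar> \<le> ennreal (2^n) * ennreal ((D n x)\<^sup>2) + ennreal ((1/2)^n)" for x
      by (simp add: ennreal_mult[symmetric] ennreal_plus[symmetric] del: ennreal_plus)
    then have "(\<integral>\<^sup>+x. ennreal \<bar>D n x\<bar> \<partial>M) \<le> (\<integral>\<^sup>+x. ennreal (2^n) * ennreal ((D n x)\<^sup>2) + ennreal ((1/2)^n) \<partial>M)"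
      by (intro nn_integral_mono)
    also have "\<dots> = ennreal (2^n) * (\<integral>\<^sup>+x. ennreal ((D n x)\<^sup>2) \<partial>M) + ennreal ((1/2)^n)"
      by (simp add: nn_integral_add nn_integral_cmult emeasure_space_1)
    also have "\<dots> \<le> ennreal (2^n) * ennreal ((1/4)^n) + ennreal ((1/2)^n)"
      by (intro add_right_mono mult_left_mono D2) auto
    also have "\<dots> = ennreal (2 * (1/2)^n)"
    proof -
      have "2^n * (1/4)^n = ((1/2)^n :: real)" by (simp add: power_mult_distrib[symmetric])
      then show ?thesis by (simp add: ennreal_mult[symmetric] ennreal_plus[symmetric] del: ennreal_plus)
    qed
    finally show ?thesis .
  qed
  have "(\<integral>\<^sup>+x. (\<Sum>n. ennreal \<bar>D n x\<bar>) \<partial>M) = (\<Sum>n. \<integral>\<^sup>+x. ennreal \<bar>D n x\<bar> \<partial>M)"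
    by (rule nn_integral_suminf) measurable
  also have "\<dots> \<le> (\<Sum>n. ennreal (2 * (1/2)^n))"
    by (intro suminf_le D1) auto
  also have "\<dots> < \<infinity>"
    by (subst suminf_ennreal2) (auto intro!: summable_mult)
  finally have "AE x in M. (\<Sum>n. ennreal \<bar>D n x\<bar>) \<noteq> \<infinity>"
    by (intro nn_integral_noteq_infinite) auto
  then have conv: "AE x in M. convergent (\<lambda>n. X (r n) x)"
  proof eventually_elim
    case (elim x)
    then have "summable (\<lambda>n. \<bar>D n x\<bar>)" by (intro summable_suminf_not_top) auto
    then have "summable (\<lambda>n. D n x)" by (rule summable_rabs_cancel)
    then have "convergent (\<lambda>n. \<Sum>i<n. D i x)" by (simp add: summable_iff_convergent)
    then have "convergent (\<lambda>n. (\<Sum>i<n. D i x) + X (r 0) x)" by (intro convergent_add convergent_const)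
    moreover have "(\<Sum>i<n. D i x) + X (r 0) x = X (r n) x" for n
      unfolding D_def by (induction n) auto
    ultimately show ?case by simp
  qed
  define I where "I x = lim (\<lambda>n. X (r n) x)" for x
  have [measurable]: "I \<in> borel_measurable M" unfolding I_def by measurable
  show ?thesis
  proof (intro bexI[of _ I])
    show "(\<lambda>n. \<integral>\<^sup>+x. ennreal ((X n x - I x)\<^sup>2) \<partial>M) \<longlonglongrightarrow> 0"
    proof (rule order_tendstoI)
      fix a :: ennreal assume "0 < a"
      then obtain e :: real where e: "0 < e" "ennreal e < a"
      proof (cases a rule: ennreal_cases)
        case (real r)
        then show ?thesis using that[of "r / 2"] \<open>0 < a\<close> by (auto simp: ennreal_less_iff)
      next
        case top then show ?thesis using that[of 1] by simp
      qed
      from cauchy[OF e(1)] obtain n0 where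
        "\<forall>m\<ge>n0. \<forall>k\<ge>n0. (\<integral>\<^sup>+x. ennreal ((X m x - X k x)\<^sup>2) \<partial>M) \<le> ennreal e" by blast
      then have n0: "(\<integral>\<^sup>+x. ennreal ((X m x - X k x)\<^sup>2) \<partial>M) \<le> ennreal e"
        if "m \<ge> n0" "k \<ge> n0" for m k using that by blast
      have "(\<integral>\<^sup>+x. ennreal ((X m x - I x)\<^sup>2) \<partial>M) \<le> ennreal e" if m: "m \<ge> n0" for m
      proof -
        \<comment> \<open>Fatou along the subsequence: \<open>X (r k)\<close> tends to
          \<open>I\<close> almost everywhere while its distance to \<open>X m\<close> stays at most
          \<open>e\<close>.\<close>
        have "(\<integral>\<^sup>+x. ennreal ((X m x - I x)\<^sup>2) \<partial>M) = (\<integral>\<^sup>+x. liminf (\<lambda>k. ennreal ((X m x - X (r k) x)\<^sup>2)) \<partial>M)"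
        proof (rule nn_integral_cong_AE)
          show "AE x in M. ennreal ((X m x - I x)\<^sup>2) = liminf (\<lambda>k. ennreal ((X m x - X (r k) x)\<^sup>2))"
            using conv
          proof eventually_elim
            case (elim x)
            then have "(\<lambda>k. X (r k) x) \<longlonglongrightarrow> I x" by (simp add: I_def convergent_LIMSEQ_iff)
            then have "(\<lambda>k. ennreal ((X m x - X (r k) x)\<^sup>2)) \<longlonglongrightarrow> ennreal ((X m x - I x)\<^sup>2)"
              by (intro tendsto_ennrealI tendsto_intros)
            then show ?case by (intro lim_imp_Liminf[symmetric]) auto
          qed
        qed
        also have "\<dots> \<le> liminf (\<lambda>k. \<integral>\<^sup>+x. ennreal ((X m x - X (r k) x)\<^sup>2) \<partial>M)"
          by (rule nn_integral_liminf) measurable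
        also have "\<dots> \<le> ennreal e"
        proof (rule Liminf_le)
          show "\<forall>\<^sub>F k in sequentially. (\<integral>\<^sup>+x. ennreal ((X m x - X (r k) x)\<^sup>2) \<partial>M) \<le> ennreal e"
            using n0[OF m] rn by (intro eventually_sequentiallyI[of n0]) (auto intro: order_trans)
        qed simp
        finally show ?thesis .
      qed
      then show "\<forall>\<^sub>F n in sequentially. (\<integral>\<^sup>+x. ennreal ((X n x - I x)\<^sup>2) \<partial>M) < a"
        using e by (intro eventually_sequentiallyI[of n0]) (auto intro: le_less_trans)
    qed auto
  qed measurable
qed

section \<open>Drifts and their stochastic integrals\<close>

lemma borel_measurable_vecI:
  fixes f :: "'a \<Rightarrow> real ^ 'n::finite"
  assumes "\<And>j. (\<lambda>x. f x $ j) \<in> borel_measurable M"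
  shows "f \<in> borel_measurable M"
  using assms by (subst borel_measurable_euclidean_space) (auto simp: Basis_vec_def inner_axis)

lemma measure_unit_leb_space [simp]: "measure unit_leb {0..1} = 1"
  using prob_space.prob_space[OF prob_space_unit_leb] by simp

context bm_space
begin

text \<open>Names the density and the bound, of which \<open>bounded_drifts\<close> asserts only the
  existence, and states the bound path by path, the form in which the time integrals use it.\<close>

definition bdrift where
  "bdrift v dv C \<longleftrightarrow> v \<in> measurable N path_space \<and> case_prod dv \<in> borel_measurable Q \<and>
     (\<forall>t\<in>{0..1}. (\<lambda>w. dv w t) \<in> borel_measurable (F t)) \<and>
     (AE w in N. has_density (v w) (dv w)) \<and>
     (AE w in N. AE s in unit_leb. norm (dv w s) \<le> C) \<and> 0 \<le> C"

lemma adapted_density_iff: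
  "adapted_density \<nu> v dv \<longleftrightarrow> case_prod dv \<in> borel_measurable Q \<and>
     (\<forall>t\<in>{0..1}. (\<lambda>w. dv w t) \<in> borel_measurable (F t)) \<and> (AE w in N. has_density (v w) (dv w))"
  unfolding adapted_density_def unit_leb_def AE_completion_iff ..

lemma bounded_driftsE:
  assumes "v \<in> bounded_drifts \<nu>"
  obtains dv C where "bdrift v dv C" "adapted_density \<nu> v dv"
proof -
  from assms obtain dv C where 1: "adapted_density \<nu> v dv"
    "AE p in Q. norm (case_prod dv p) \<le> C" and 2: "v \<in> measurable N path_space"
    unfolding bounded_drifts_def adapted_L0_def unit_leb_def by blast
  \<comment> \<open>The constant in \<open>bounded_drifts\<close> may have either sign;
    \<open>max 0 C\<close> can serve as a factor in estimates.\<close>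
  from Q.AE_pair[OF 1(2)] have "AE w in N. AE s in unit_leb. norm (dv w s) \<le> max 0 C"
    by (auto elim!: eventually_mono)
  with 1(1) 2 have "bdrift v dv (max 0 C)" unfolding bdrift_def adapted_density_iff by auto
  with 1(1) show ?thesis using that by blast
qed

lemma bdriftD:
  assumes "bdrift v dv C"
  shows "v \<in> measurable N path_space" "case_prod dv \<in> borel_measurable Q"
    "t \<in> {0..1} \<Longrightarrow> (\<lambda>w. dv w t) \<in> borel_measurable (F t)"
    "AE w in N. has_density (v w) (dv w)"
    "AE w in N. AE s in unit_leb. norm (dv w s) \<le> C" "0 \<le> C"
  using assms unfolding bdrift_def by blast+

text \<open>Admits constructed drifts to the assumptions on \<open>W\<close>.
  \<open>adapted_L0\<close> requires Cameron-Martin values at every path, whereas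
  \<open>bdrift\<close> speaks almost surely, hence the extra premise.\<close>

lemma bdrift_bounded_drifts:
  assumes v: "bdrift v dv C" and cm: "\<And>w. w \<in> space \<nu> \<Longrightarrow> v w \<in> cameron_martin"
  shows "v \<in> bounded_drifts \<nu>"
proof -
  note [measurable] = bdriftD(2)[OF v]
  note vm = bdriftD(1)[OF v]
  have a: "adapted_density \<nu> v dv"
    unfolding adapted_density_iff by (intro conjI ballI bdriftD[OF v])
  have ae: "AE p in Q. norm (case_prod dv p) \<le> C"
  proof (rule Q.AE_pair_measure)
    show "{p \<in> space Q. norm (case_prod dv p) \<le> C} \<in> sets Q" by measurable
    show "AE w in N. AE s in unit_leb. norm (case_prod dv (w, s)) \<le> C"
      using bdriftD(5)[OF v] by simp
  qed
  have "v \<in> adapted_L0 \<nu>"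
    unfolding adapted_L0_def by (intro CollectI conjI ballI exI[of _ dv] vm cm a)
  then show ?thesis
    unfolding bounded_drifts_def
    by (intro CollectI conjI exI[of _ dv] exI[of _ C] a ae[unfolded unit_leb_def])
qed

lemma bdrift_value:
  assumes v: "bdrift v dv C" and t: "t \<in> {0..1}"
  shows "AE w in N. v w t = (\<integral>s. indicator {0..t} s *\<^sub>R dv w s \<partial>unit_leb)"
  using bdriftD(4)[OF v] by eventually_elim (use t in \<open>simp add: has_density_unit_leb\<close>)

text \<open>The Lipschitz bound in time, responsible for the quadratically small error per step in
  \<open>drift_approx\<close>.\<close>

lemma bdrift_incr_bound:
  assumes v: "bdrift v dv C" and st: "0 \<le> s" "s \<le> t" "t \<le> 1"
  shows "AE w in N. norm (v w t - v w s) \<le> C * (t - s)"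
proof -
  have t: "t \<in> {0..1}" and s: "s \<in> {0..1}" using st by auto
  show ?thesis
    using bdriftD(4)[OF v] bdriftD(5)[OF v]
  proof eventually_elim
    case (elim w)
    have val: "v w r = (\<integral>s. indicator {0..r} s *\<^sub>R dv w s \<partial>unit_leb)" if "r \<in> {0..1}" for r
      using elim(1) that by (simp add: has_density_unit_leb)
    note g = has_density_integrable[OF elim(1)]
    have ci: "integrable unit_leb (\<lambda>r. indicator {0..a} r *\<^sub>R dv w r)" for a :: real
      using cell_integrable[OF g] by simp
    have ci': "integrable unit_leb (\<lambda>r. indicator {s<..t} r *\<^sub>R dv w r)"
      using cell_integrable[OF g] by simp
    have "v w t - v w s = (\<integral>r. indicator {0..t} r *\<^sub>R dv w r - indicator {0..s} r *\<^sub>R dv w r \<partial>unit_leb)"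
      unfolding val[OF t] val[OF s] by (rule Bochner_Integration.integral_diff[OF ci ci, symmetric])
    also have "\<dots> = (\<integral>r. indicator {s<..t} r *\<^sub>R dv w r \<partial>unit_leb)"
      using st by (intro Bochner_Integration.integral_cong refl) (auto simp: indicator_def)
    finally have eq: "v w t - v w s = (\<integral>r. indicator {s<..t} r *\<^sub>R dv w r \<partial>unit_leb)" .
    have ind: "integrable unit_leb (\<lambda>r. C * indicat_real {s<..t} r)"
      using bdriftD(6)[OF v] by (intro unit_leb_bounded_integrable[of _ C]) (auto simp: indicator_def)
    have "norm (v w t - v w s) \<le> (\<integral>r. norm (indicator {s<..t} r *\<^sub>R dv w r) \<partial>unit_leb)"
      unfolding eq by (rule integral_norm_bound)
    also have "\<dots> \<le> (\<integral>r. C * indicat_real {s<..t} r \<partial>unit_leb)"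
    proof (rule integral_mono_AE[OF integrable_norm[OF ci'] ind])
      show "AE r in unit_leb. norm (indicator {s<..t} r *\<^sub>R dv w r) \<le> C * indicat_real {s<..t} r"
        using elim(2) by eventually_elim (auto simp: indicator_def)
    qed
    also have "\<dots> = C * measure unit_leb {s<..t}"
    proof -
      have "{s<..t} \<inter> {0..1} = {s<..t}" using st by auto
      then show ?thesis by simp
    qed
    also have "measure unit_leb {s<..t} = t - s"
      using measure_overlap[of s t s t] st by (simp add: overlap_def)
    finally show ?case .
  qed
qed

text \<open>The density is only adapted and jointly measurable, not progressive. Conditional expectation
  given \<open>F\<^sub>t\<close> commutes with the integral over \<open>[0, t]\<close>, so the integral agrees almost surely with its
  own conditional expectation.\<close>

lemma bdrift_adapted:
  assumes v: "bdrift v dv C" and t: "t \<in> {0..1}"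
  shows "(\<lambda>w. v w t) \<in> borel_measurable (F t)"
proof -
  note C = bdriftD(6)[OF v]
  have Gsub: "subalgebra N (F t)" using t by (intro canonical_subalgebra) auto
  have comp: "(\<lambda>w. v w t $ j) \<in> borel_measurable (F t)" for j
  proof -
    \<comment> \<open>A version of component \<open>j\<close> that is bounded at every point and cut
      off after time \<open>t\<close>, so that each of its sections is
      \<open>F t\<close>-measurable.\<close>
    define d where "d w s = (if \<bar>dv w s $ j\<bar> \<le> C then indicator {0..t} s * dv w s $ j else 0)" for w s
    have [measurable]: "case_prod dv \<in> borel_measurable Q" by (rule bdriftD(2)[OF v])
    have dm: "case_prod d \<in> borel_measurable Q"
    proof -
      have "(\<lambda>p. if \<bar>dv (fst p) (snd p) $ j\<bar> \<le> C then indicator {0..t} (snd p) * dv (fst p) (snd p) $ j else 0) \<in> borel_measurable Q"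
        by measurable
      then show ?thesis by (simp add: d_def case_prod_beta')
    qed
    note [measurable] = dm
    have db: "\<bar>d w s\<bar> \<le> C" for w s using C by (auto simp: d_def indicator_def)
    have da: "(\<lambda>w. d w s) \<in> borel_measurable (F t)" if s: "s \<in> {0..1}" for s
    proof (cases "s \<le> t")
      case True
      have [measurable]: "(\<lambda>w. dv w s) \<in> borel_measurable (F t)"
        using filtration_measurable_mono[OF bdriftD(3)[OF v s] True] .
      show ?thesis unfolding d_def by measurable
    next
      case False
      then have "d w s = 0" for w by (simp add: d_def)
      then show ?thesis by simp
    qed
    define f where "f w = (\<integral>s. d w s \<partial>unit_leb)" for w
    have fm[measurable]: "f \<in> borel_measurable N"
      unfolding f_def by (rule R.borel_measurable_lebesgue_integral) (simp add: dm)
    have fb: "\<bar>f w\<bar> \<le> C" if "w \<in> space \<nu>" for w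
    proof -
      have "(\<lambda>s. d w s) \<in> borel_measurable unit_leb"
        using measurable_compose[OF measurable_Pair1'[of w N unit_leb] dm] that by simp
      then have i: "integrable unit_leb (d w)" by (rule unit_leb_bounded_integrable[of _ C]) (simp add: db)
      have "\<bar>f w\<bar> \<le> (\<integral>s. \<bar>d w s\<bar> \<partial>unit_leb)" unfolding f_def by (rule integral_abs_bound)
      also have "\<dots> \<le> (\<integral>s. C \<partial>unit_leb)" using i db by (intro integral_mono) auto
      finally show ?thesis by (simp add: R.prob_space)
    qed
    obtain f' where f': "f' \<in> borel_measurable (F t)" "\<And>w. \<bar>f' w\<bar> \<le> C"
      "\<And>g. g \<in> borel_measurable (F t) \<Longrightarrow> integrable N g \<Longrightarrow> (\<integral>w. g w * f w \<partial>N) = (\<integral>w. g w * f' w \<partial>N)"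
      using N.bounded_cond_exp[OF Gsub fm _ C] fb by auto
    have f'N[measurable]: "f' \<in> borel_measurable N" by (rule measurable_from_subalg[OF Gsub f'(1)])
    have int: "integrable N f" "integrable N f'" "integrable N (\<lambda>w. f w * f w)"
      "integrable N (\<lambda>w. f w * f' w)" "integrable N (\<lambda>w. f' w * f' w)"
    proof -
      have b: "integrable N (\<lambda>w. h w * k w)"
        if [measurable]: "h \<in> borel_measurable N" "k \<in> borel_measurable N"
          and hk: "\<And>w. w \<in> space \<nu> \<Longrightarrow> \<bar>h w\<bar> \<le> C" "\<And>w. w \<in> space \<nu> \<Longrightarrow> \<bar>k w\<bar> \<le> C" for h k
      proof (rule bounded_integrable[of _ "C * C"])
        fix w assume "w \<in> space \<nu>"
        then show "norm (h w * k w) \<le> C * C"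
          unfolding real_norm_def abs_mult using C by (intro mult_mono hk) auto
      qed measurable
      show "integrable N f" by (rule bounded_integrable[of _ C]) (auto simp: fb)
      show "integrable N f'" by (rule bounded_integrable[of _ C]) (auto simp: f'(2))
      show "integrable N (\<lambda>w. f w * f w)" by (rule b) (auto simp: fb)
      show "integrable N (\<lambda>w. f w * f' w)" by (rule b) (auto simp: fb f'(2))
      show "integrable N (\<lambda>w. f' w * f' w)" by (rule b) (auto simp: f'(2))
    qed
    have swap: "(\<integral>w. h w * f w \<partial>N) = (\<integral>s. (\<integral>w. h w * d w s \<partial>N) \<partial>unit_leb)"
      if [measurable]: "h \<in> borel_measurable N" and hb: "\<And>w. w \<in> space \<nu> \<Longrightarrow> \<bar>h w\<bar> \<le> C" for h
    proof -
      have i: "integrable Q (\<lambda>(w, s). h w * d w s)"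
      proof (rule Q_bounded_integrable[of _ "C * C"])
        have "(\<lambda>p. h (fst p) * d (fst p) (snd p)) \<in> borel_measurable Q" by measurable
        then show "(\<lambda>(w, s). h w * d w s) \<in> borel_measurable Q" by (simp add: case_prod_beta')
        fix w s assume "w \<in> space \<nu>"
        then show "norm (case (w, s) of (w, s) \<Rightarrow> h w * d w s) \<le> C * C"
          using hb[of w] db[of w s] C by (simp add: abs_mult mult_mono)
      qed
      have "(\<integral>w. h w * f w \<partial>N) = (\<integral>w. (\<integral>s. h w * d w s \<partial>unit_leb) \<partial>N)" by (simp add: f_def)
      also have "\<dots> = (\<integral>s. (\<integral>w. h w * d w s \<partial>N) \<partial>unit_leb)"
        by (rule Q.Fubini_integral[OF i, symmetric])
      finally show ?thesis .
    qed
    \<comment> \<open>Tested against the \<open>F t\<close>-measurable section of \<open>d\<close>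
      at time \<open>s\<close>, the variable \<open>f\<close> may be exchanged for its conditional
      expectation \<open>f'\<close>.\<close>
    have ds: "(\<integral>w. f w * d w s \<partial>N) = (\<integral>w. f' w * d w s \<partial>N)" if "s \<in> {0..1}" for s
    proof -
      have "integrable N (\<lambda>w. d w s)"
        using db measurable_from_subalg[OF Gsub da[OF that]] by (intro bounded_integrable[of _ C]) auto
      from f'(3)[OF da[OF that] this] show ?thesis by (simp add: mult.commute)
    qed
    have "(\<integral>w. f w * f w \<partial>N) = (\<integral>s. (\<integral>w. f w * d w s \<partial>N) \<partial>unit_leb)" using fb by (intro swap) auto
    also have "\<dots> = (\<integral>s. (\<integral>w. f' w * d w s \<partial>N) \<partial>unit_leb)"
      by (intro Bochner_Integration.integral_cong refl ds) simp
    also have "\<dots> = (\<integral>w. f' w * f w \<partial>N)" using f'(2) by (intro swap[symmetric]) auto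
    \<comment> \<open>Together with the next line, the means of f f, f f' and f' f' coincide, so (f
      - f')^2 has mean zero.\<close>
    finally have 1: "(\<integral>w. f w * f w \<partial>N) = (\<integral>w. f' w * f w \<partial>N)" .
    have 2: "(\<integral>w. f' w * f w \<partial>N) = (\<integral>w. f' w * f' w \<partial>N)" by (rule f'(3)[OF f'(1) int(2)])
    have eq: "(f w - f' w)\<^sup>2 = f w * f w - 2 * (f w * f' w) + f' w * f' w" for w
      by (simp add: power2_eq_square algebra_simps)
    have i: "integrable N (\<lambda>w. (f w - f' w)\<^sup>2)" unfolding eq using int by auto
    have "(\<integral>w. (f w - f' w)\<^sup>2 \<partial>N) = 0"
      unfolding eq using int 1 2 by (simp add: mult.commute)
    then have "AE w in N. (f w - f' w)\<^sup>2 = 0"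
      using i by (subst (asm) integral_nonneg_eq_0_iff_AE) auto
    moreover have "AE w in N. f w = v w t $ j"
      using bdrift_value[OF v t] bdriftD(5)[OF v] bdriftD(4)[OF v]
    proof eventually_elim
      case (elim w)
      have ci: "integrable unit_leb (\<lambda>r. indicator {0..t} r *\<^sub>R dv w r)"
        using cell_integrable[OF has_density_integrable[OF elim(3)]] by simp
      have [measurable]: "dv w \<in> borel_measurable unit_leb" 
        using has_density_integrable[OF elim(3)] by auto
      have "f w = (\<integral>s. (indicator {0..t} s *\<^sub>R dv w s) $ j \<partial>unit_leb)"
        unfolding f_def
      proof (rule integral_cong_AE)
        show "AE s in unit_leb. d w s = (indicator {0..t} s *\<^sub>R dv w s) $ j"
          using elim(2)
        proof eventually_elim
          case (elim s)
          then have "\<bar>dv w s $ j\<bar> \<le> C" using component_le_norm_cart[of "dv w s" j] by linarith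
          then show ?case by (simp add: d_def)
        qed
        show "d w \<in> borel_measurable unit_leb" unfolding d_def by measurable
        show "(\<lambda>s. (indicator {0..t} s *\<^sub>R dv w s) $ j) \<in> borel_measurable unit_leb" by measurable
      qed
      also have "\<dots> = (\<integral>s. indicator {0..t} s *\<^sub>R dv w s \<partial>unit_leb) $ j"
        by (rule integral_bounded_linear[OF bounded_linear_vec_nth ci])
      finally show ?case using elim(1) by simp
    qed
    ultimately have "AE w in N. f' w = v w t $ j" by eventually_elim simp
    then show ?thesis by (intro filtration_cong[OF f'(1)]) (simp add: AE_completion_iff)
  qed
  then show ?thesis
    by (rule borel_measurable_vecI)
qed

text \<open>Almost surely the shifted cell average of the density, but formed from values of
  \<open>v\<close> at grid times and therefore adapted. The cut-off at \<open>C\<close> provides the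
  bound at every path that \<open>simple_integrand\<close> demands.\<close>

definition drift_step where
  "drift_step v C m i w = (let x = real m *\<^sub>R (v w (real i / real m) - v w (real (i - 1) / real m))
     in if i = 0 \<or> norm x > C then 0 else x :: real ^ 'n)"

lemma drift_step_simple:
  assumes v: "bdrift v dv C" and m: "0 < m"
  shows "simple_integrand \<nu> m (\<lambda>i. real i / real m) (drift_step v C m)"
  unfolding simple_integrand_def
proof (intro conjI allI impI)
  fix i assume i: "i < m"
  show "real i / real m < real (Suc i) / real m" using m by (intro divide_strict_right_mono) auto
  have I: "real i / real m \<in> {0..1}" "real (i - 1) / real m \<in> {0..1}" 
    using i m by (auto simp: divide_le_eq)
  have le: "real (i - 1) / real m \<le> real i / real m" by (intro divide_right_mono) auto
  have [measurable]: "(\<lambda>w. v w (real i / real m)) \<in> borel_measurable (F (real i / real m))"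
    "(\<lambda>w. v w (real (i - 1) / real m)) \<in> borel_measurable (F (real i / real m))"
    using bdrift_adapted[OF v I(1)] filtration_measurable_mono[OF bdrift_adapted[OF v I(2)] le] by auto
  show "drift_step v C m i \<in> borel_measurable (F (real i / real m))"
    unfolding drift_step_def Let_def by measurable
  show "\<exists>K. \<forall>w\<in>space \<nu>. norm (drift_step v C m i w) \<le> K"
    by (intro exI[of _ "max 0 C"]) (auto simp: drift_step_def Let_def)
qed (use m in auto)

abbreviation "drift_simple v C m \<equiv> simple_process m (\<lambda>i. real i / real m) (drift_step v C m)"

lemma drift_simple_elem:
  "bdrift v dv C \<Longrightarrow> 0 < m \<Longrightarrow>
    elem (drift_simple v C m) (simple_integral \<beta> m (\<lambda>i. real i / real m) (drift_step v C m))"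
  by (intro elem_simple drift_step_simple)

text \<open>A density bounded by \<open>C\<close> has cell averages bounded by \<open>C\<close>, so
  the cut-off in \<open>drift_step\<close> is almost surely inactive.\<close>

lemma drift_simple_avg:
  assumes v: "bdrift v dv C" and m: "0 < m"
  shows "AE w in N. \<forall>s. drift_simple v C m w s = avg m (dv w) s \<and> norm (avg m (dv w) s) \<le> C"
  using bdriftD(4)[OF v] bdriftD(5)[OF v]
proof eventually_elim
  case (elim w)
  note C = bdriftD(6)[OF v]
  note g = has_density_integrable[OF elim(1)]
  have bound: "norm (avg_step m (dv w) i) \<le> C" if i: "i < m" for i
  proof (cases "i = 0")
    case False
    have ci: "integrable unit_leb (\<lambda>r. indicator (cell m (i - 1)) r *\<^sub>R dv w r)"
      using cell_integrable[OF g] by simp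
    have ind: "integrable unit_leb (\<lambda>r. C * indicat_real (cell m (i - 1)) r)"
      using C by (intro unit_leb_bounded_integrable[of _ C]) (auto simp: indicator_def)
    have i1: "i - 1 < m" using i by linarith
    have "norm (\<integral>r. indicator (cell m (i - 1)) r *\<^sub>R dv w r \<partial>unit_leb) \<le> (\<integral>r. norm (indicator (cell m (i - 1)) r *\<^sub>R dv w r) \<partial>unit_leb)"
      by (rule integral_norm_bound)
    also have "\<dots> \<le> (\<integral>r. C * indicat_real (cell m (i - 1)) r \<partial>unit_leb)"
    proof (rule integral_mono_AE[OF integrable_norm[OF ci] ind])
      show "AE r in unit_leb. norm (indicator (cell m (i - 1)) r *\<^sub>R dv w r) \<le> C * indicat_real (cell m (i - 1)) r"
        using elim(2) by eventually_elim (auto simp: indicator_def)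
    qed
    also have "\<dots> = C / m"
      using measure_cell[OF i1] cell_subset[OF i1] by (simp add: Int_absorb2)
    finally show ?thesis using False m by (simp add: avg_step_def field_simps)
  qed (use C in \<open>simp add: avg_step_def\<close>)
  have step: "drift_step v C m i w = avg_step m (dv w) i" if i: "i < m" for i
  proof (cases "i = 0")
    case False
    show ?thesis
      using avg_step_density[OF elim(1) False, of m] bound[OF i] i False
      by (simp add: drift_step_def Let_def)
  qed (simp add: drift_step_def avg_step_def)
  show ?case
  proof (intro allI conjI)
    fix s
    show "drift_simple v C m w s = avg m (dv w) s"
      unfolding simple_process_def avg_def cell_def by (intro sum.cong) (auto simp: step)
    show "norm (avg m (dv w) s) \<le> C"
    proof (cases "\<exists>i<m. s \<in> cell m i")
      case True
      then obtain i where i: "i < m" "s \<in> cell m i" by blast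
      then show ?thesis using avg_cell[OF i(2,1), of "dv w"] bound[OF i(1)] by simp
    next
      case False
      then have "avg m (dv w) s = 0" unfolding avg_def by (intro sum.neutral) auto
      then show ?thesis using C by simp
    qed
  qed
qed

text \<open>The averages converge only in L1 for each path. As both they and the density are bounded
  by \<open>C\<close>, the squared error is at most \<open>2 * C\<close> times the error, which
  gives L2 convergence in time; dominated convergence over the paths follows.\<close>

lemma drift_simple_conv:
  assumes v: "bdrift v dv C"
  shows "(\<lambda>m. sqdist (drift_simple v C (Suc m)) dv) \<longlonglongrightarrow> 0"
proof -
  note C = bdriftD(6)[OF v]
  have [measurable]: "case_prod dv \<in> borel_measurable Q" by (rule bdriftD(2)[OF v])
  have sm[measurable]: "case_prod (drift_simple v C (Suc m)) \<in> borel_measurable Q" for m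
    by (rule elem_meas[OF drift_simple_elem[OF v]]) simp
  let ?h = "\<lambda>m w. \<integral>\<^sup>+ s. ennreal ((norm (drift_simple v C (Suc m) w s - dv w s))\<^sup>2) \<partial>unit_leb"
  have hm: "?h m \<in> borel_measurable N" for m
  proof (rule R.borel_measurable_nn_integral)
    have "(\<lambda>p. ennreal ((norm (drift_simple v C (Suc m) (fst p) (snd p) - dv (fst p) (snd p)))\<^sup>2)) \<in> borel_measurable Q"
      by measurable
    then show "(\<lambda>(w, s). ennreal ((norm (drift_simple v C (Suc m) w s - dv w s))\<^sup>2)) \<in> borel_measurable Q"
      by (simp add: case_prod_beta')
  qed
  have sq: "sqdist (drift_simple v C (Suc m)) dv = (\<integral>\<^sup>+w. ?h m w \<partial>N)" for m
    unfolding sqdist_def unit_leb_def by (simp add: nn_integral_restrict_space mult.commute)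
  have all: "AE w in N. \<forall>m. \<forall>s. drift_simple v C (Suc m) w s = avg (Suc m) (dv w) s \<and> norm (avg (Suc m) (dv w) s) \<le> C"
    by (subst AE_all_countable, intro allI drift_simple_avg[OF v]) simp
  have key: "AE w in N. (\<forall>m. ?h m w \<le> ennreal (4 * C\<^sup>2)) \<and> (\<lambda>m. ?h m w) \<longlonglongrightarrow> 0"
    using all bdriftD(4)[OF v] bdriftD(5)[OF v]
  proof eventually_elim
    case (elim w)
    note g = has_density_integrable[OF elim(2)]
    let ?n = "\<lambda>m s. norm (avg (Suc m) (dv w) s - dv w s)"
    have ni: "integrable unit_leb (?n m)" for m
      by (intro integrable_norm Bochner_Integration.integrable_diff avg_integrable g)
    have nb: "AE s in unit_leb. ?n m s \<le> 2 * C" for m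
      using elim(3)
    proof eventually_elim
      case s: (elim s)
      have "norm (avg (Suc m) (dv w) s) \<le> C" using elim(1) by blast
      then show ?case using s norm_triangle_ineq4[of "avg (Suc m) (dv w) s" "dv w s"] by linarith
    qed
    have he: "?h m w = (\<integral>\<^sup>+ s. ennreal ((?n m s)\<^sup>2) \<partial>unit_leb)" for m
      using elim(1) by simp
    have h1: "?h m w \<le> ennreal (2 * C * (\<integral>s. ?n m s \<partial>unit_leb))" for m
    proof -
      have "?h m w \<le> (\<integral>\<^sup>+ s. ennreal (2 * C * ?n m s) \<partial>unit_leb)"
        unfolding he
      proof (rule nn_integral_mono_AE)
        show "AE s in unit_leb. ennreal ((?n m s)\<^sup>2) \<le> ennreal (2 * C * ?n m s)"
          using nb[of m] by eventually_elim (auto intro!: ennreal_leI mult_right_mono simp: power2_eq_square)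
      qed
      also have "\<dots> = ennreal (\<integral>s. 2 * C * ?n m s \<partial>unit_leb)"
        using ni[of m] C by (intro nn_integral_eq_integral integrable_mult_right) auto
      finally show ?thesis by simp
    qed
    have h2: "?h m w \<le> ennreal (4 * C\<^sup>2)" for m
    proof -
      have "(\<integral>s. ?n m s \<partial>unit_leb) \<le> (\<integral>s. 2 * C \<partial>unit_leb)"
        by (intro integral_mono_AE ni nb) simp
      then have "2 * C * (\<integral>s. ?n m s \<partial>unit_leb) \<le> 2 * C * (2 * C)"
        using C by (intro mult_left_mono) (auto simp: R.prob_space)
      then have "ennreal (2 * C * (\<integral>s. ?n m s \<partial>unit_leb)) \<le> ennreal (4 * C\<^sup>2)"
        by (intro ennreal_leI) (simp add: power2_eq_square)
      with h1[of m] show ?thesis by (rule order_trans)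
    qed
    have "(\<lambda>m. 2 * C * (\<integral>s. ?n m s \<partial>unit_leb)) \<longlonglongrightarrow> 2 * C * 0"
      using LIMSEQ_Suc[OF avg_convergence[OF g, unfolded avg_conv_def]] by (intro tendsto_mult tendsto_const)
    then have "(\<lambda>m. ennreal (2 * C * (\<integral>s. ?n m s \<partial>unit_leb))) \<longlonglongrightarrow> ennreal 0"
      by (intro tendsto_ennrealI) simp
    then have lim: "(\<lambda>m. ennreal (2 * C * (\<integral>s. ?n m s \<partial>unit_leb))) \<longlonglongrightarrow> 0" by simp
    have "(\<lambda>m. ?h m w) \<longlonglongrightarrow> 0"
    proof (rule tendsto_sandwich[OF _ _ tendsto_const lim])
      show "\<forall>\<^sub>F m in sequentially. 0 \<le> ?h m w" by simp
      show "\<forall>\<^sub>F m in sequentially. ?h m w \<le> ennreal (2 * C * (\<integral>s. ?n m s \<partial>unit_leb))"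
        by (intro always_eventually allI h1)
    qed
    with h2 show ?case by blast
  qed
  have "(\<lambda>m. \<integral>\<^sup>+w. ?h m w \<partial>N) \<longlonglongrightarrow> (\<integral>\<^sup>+w. 0 \<partial>N)"
  proof (rule nn_integral_dominated_convergence[where w = "\<lambda>_. ennreal (4 * C\<^sup>2)"])
    show "AE w in N. ?h m w \<le> ennreal (4 * C\<^sup>2)" for m using key by eventually_elim blast
    show "AE w in N. (\<lambda>m. ?h m w) \<longlonglongrightarrow> 0" using key by eventually_elim blast
    show "(\<integral>\<^sup>+w. ennreal (4 * C\<^sup>2) \<partial>N) < \<infinity>" by (simp add: emeasure_space_1)
  qed (use hm in auto)
  then show ?thesis by (simp only: sq nn_integral_const mult_zero_left)
qed

end

section \<open>Existence, uniqueness and mean of the Ito integral\<close>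

context bm_space
begin

lemma sqdist_unit:
  "sqdist \<phi> \<psi> = (\<integral>\<^sup>+ w. (\<integral>\<^sup>+ s. ennreal ((norm (\<phi> w s - \<psi> w s))\<^sup>2) \<partial>unit_leb) \<partial>N)"
  unfolding sqdist_def unit_leb_def by (simp add: nn_integral_restrict_space mult.commute)

lemma sqdist_cong:
  assumes "AE w in N. AE s in unit_leb. \<phi> w s = \<phi>' w s"
  shows "sqdist \<psi> \<phi> = sqdist \<psi> \<phi>'"
  unfolding sqdist_unit
proof (rule nn_integral_cong_AE)
  show "AE w in N. (\<integral>\<^sup>+ s. ennreal ((norm (\<psi> w s - \<phi> w s))\<^sup>2) \<partial>unit_leb) =
      (\<integral>\<^sup>+ s. ennreal ((norm (\<psi> w s - \<phi>' w s))\<^sup>2) \<partial>unit_leb)"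
    using assms
  proof eventually_elim
    case (elim w)
    show ?case
    proof (rule nn_integral_cong_AE)
      show "AE s in unit_leb. ennreal ((norm (\<psi> w s - \<phi> w s))\<^sup>2) = ennreal ((norm (\<psi> w s - \<phi>' w s))\<^sup>2)"
        using elim by eventually_elim simp
    qed
  qed
qed

lemma sqdist_triangle:
  assumes [measurable]: "case_prod a \<in> borel_measurable Q" "case_prod b \<in> borel_measurable Q" "case_prod c \<in> borel_measurable Q"
  shows "sqdist a b \<le> 2 * sqdist a c + 2 * sqdist b c"
proof -
  have le: "ennreal ((norm (x - y))\<^sup>2) \<le> 2 * ennreal ((norm (x - z))\<^sup>2) + 2 * ennreal ((norm (y - z))\<^sup>2)"
    for x y z :: "real ^ 'n"
  proof -
    have "norm (x - y) \<le> norm (x - z) + norm (y - z)"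
      using norm_triangle_ineq4[of "x - z" "y - z"] by simp
    then have "(norm (x - y))\<^sup>2 \<le> (norm (x - z) + norm (y - z))\<^sup>2" by (intro power_mono) auto
    also have "\<dots> \<le> 2 * (norm (x - z))\<^sup>2 + 2 * (norm (y - z))\<^sup>2"
      using zero_le_power2[of "norm (x - z) - norm (y - z)"] by (simp add: power2_eq_square algebra_simps)
    finally have "ennreal ((norm (x - y))\<^sup>2) \<le> ennreal (2 * (norm (x - z))\<^sup>2 + 2 * (norm (y - z))\<^sup>2)"
      by (rule ennreal_leI)
    also have "\<dots> = 2 * ennreal ((norm (x - z))\<^sup>2) + 2 * ennreal ((norm (y - z))\<^sup>2)"
      by (simp add: ennreal_plus ennreal_mult)
    finally show ?thesis .
  qed
  note Q = sqdist_Q[OF assms(1,2)] sqdist_Q[OF assms(1,3)] sqdist_Q[OF assms(2,3)]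
  have "sqdist a b \<le> (\<integral>\<^sup>+ p. 2 * ennreal ((norm (a (fst p) (snd p) - c (fst p) (snd p)))\<^sup>2)
      + 2 * ennreal ((norm (b (fst p) (snd p) - c (fst p) (snd p)))\<^sup>2) \<partial>Q)"
    unfolding Q by (intro nn_integral_mono le)
  also have "\<dots> = 2 * sqdist a c + 2 * sqdist b c"
    unfolding Q by (subst nn_integral_add) (simp_all add: nn_integral_cmult)
  finally show ?thesis .
qed

lemma elem_J_meas: "elem \<phi> J \<Longrightarrow> J \<in> borel_measurable N"
  using elem_adapted by blast

text \<open>\<open>has_ito_integral\<close> provides one approximating sequence. Any other
  elementary sequence with the same limit is asymptotically equal to it, and the isometry passes
  this on to the integrals.\<close>

lemma ito_approx:
  assumes I: "has_ito_integral \<nu> \<beta> \<phi> I" and \<phi>: "case_prod \<phi> \<in> borel_measurable Q"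
    and e: "\<And>n. elem (\<psi> n) (J n)" and lim: "(\<lambda>n. sqdist (\<psi> n) \<phi>) \<longlonglongrightarrow> 0"
  shows "I \<in> borel_measurable N" "(\<lambda>n. \<integral>\<^sup>+w. ennreal ((J n w - I w)\<^sup>2) \<partial>N) \<longlonglongrightarrow> 0"
proof -
  from I show Im: "I \<in> borel_measurable N" unfolding has_ito_integral_def by blast
  from I obtain k t \<xi> where s: "\<And>m. simple_integrand \<nu> (k m) (t m) (\<xi> m)"
    and l1: "(\<lambda>m. sqdist (simple_process (k m) (t m) (\<xi> m)) \<phi>) \<longlonglongrightarrow> 0"
    and l2: "(\<lambda>m. \<integral>\<^sup>+ w. ennreal ((simple_integral \<beta> (k m) (t m) (\<xi> m) w - I w)\<^sup>2) \<partial>N) \<longlonglongrightarrow> 0"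
    unfolding has_ito_integral_def sqdist_def by blast
  let ?p = "\<lambda>m. simple_process (k m) (t m) (\<xi> m)" and ?S = "\<lambda>m. simple_integral \<beta> (k m) (t m) (\<xi> m)"
  have es: "elem (?p m) (?S m)" for m by (rule elem_simple[OF s])
  have "(\<lambda>n. sqdist (\<psi> n) (?p n)) \<longlonglongrightarrow> 0"
    by (rule ennreal_double_tendsto_0[OF lim l1 sqdist_triangle[OF elem_meas[OF e] elem_meas[OF es] \<phi>]])
  then have l3: "(\<lambda>n. \<integral>\<^sup>+w. ennreal ((J n w - ?S n w)\<^sup>2) \<partial>N) \<longlonglongrightarrow> 0"
    by (simp only: elem_isometry[OF e es])
  show "(\<lambda>n. \<integral>\<^sup>+w. ennreal ((J n w - I w)\<^sup>2) \<partial>N) \<longlonglongrightarrow> 0"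
  proof (rule ennreal_double_tendsto_0[OF l3 l2])
    show "(\<integral>\<^sup>+w. ennreal ((J n w - I w)\<^sup>2) \<partial>N) \<le>
      2 * (\<integral>\<^sup>+w. ennreal ((J n w - ?S n w)\<^sup>2) \<partial>N) + 2 * (\<integral>\<^sup>+w. ennreal ((?S n w - I w)\<^sup>2) \<partial>N)" for n
      using nn_square_diff_le[OF elem_J_meas[OF e] Im elem_J_meas[OF es], of n n]
      by (simp only: power2_commute[of "I _"])
  qed
qed

lemma drift_elem_seq:
  assumes v: "bdrift v dv C"
  shows "\<exists>\<psi> J. (\<forall>n :: nat. elem (\<psi> n) (J n)) \<and> (\<lambda>n. sqdist (\<psi> n) dv) \<longlonglongrightarrow> 0"
  by (rule exI[of _ "\<lambda>m. drift_simple v C (Suc m)"], rule exI, intro conjI allI,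
      rule drift_simple_elem[OF v], simp, rule drift_simple_conv[OF v])

text \<open>The step approximations converge to the density, so by the isometry their integrals form
  a Cauchy sequence in L2.\<close>

lemma ito_exists:
  assumes v: "bdrift v dv C"
  shows "\<exists>I. has_ito_integral \<nu> \<beta> dv I"
proof -
  let ?p = "\<lambda>m. drift_simple v C (Suc m)"
  let ?S = "\<lambda>m. simple_integral \<beta> (Suc m) (\<lambda>i. real i / real (Suc m)) (drift_step v C (Suc m))"
  note conv = drift_simple_conv[OF v]
  have e: "elem (?p m) (?S m)" for m by (rule drift_simple_elem[OF v]) simp
  have "\<exists>I\<in>borel_measurable N. (\<lambda>n. \<integral>\<^sup>+w. ennreal ((?S n w - I w)\<^sup>2) \<partial>N) \<longlonglongrightarrow> 0"
  proof (rule N.L2_complete)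
    show "?S m \<in> borel_measurable N" for m by (rule elem_J_meas[OF e])
    fix r :: real assume r: "0 < r"
    then have "\<forall>\<^sub>F m in sequentially. sqdist (?p m) dv < ennreal (r / 4)"
      by (intro order_tendstoD(2)[OF conv]) auto
    then obtain n0 where n0: "\<forall>m\<ge>n0. sqdist (?p m) dv < ennreal (r / 4)"
      unfolding eventually_sequentially by blast
    have "(\<integral>\<^sup>+w. ennreal ((?S m w - ?S k w)\<^sup>2) \<partial>N) \<le> ennreal r" if m: "m \<ge> n0" and k: "k \<ge> n0" for m k
    proof -
      have "(\<integral>\<^sup>+w. ennreal ((?S m w - ?S k w)\<^sup>2) \<partial>N) = sqdist (?p m) (?p k)"
        by (rule elem_isometry[OF e e])
      also have "\<dots> \<le> 2 * sqdist (?p m) dv + 2 * sqdist (?p k) dv"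
        by (rule sqdist_triangle[OF elem_meas[OF e] elem_meas[OF e] bdriftD(2)[OF v]])
      also have "\<dots> \<le> 2 * ennreal (r / 4) + 2 * ennreal (r / 4)"
        using n0 m k by (intro add_mono mult_left_mono less_imp_le) auto
      also have "\<dots> = ennreal 2 * ennreal (r / 4) + ennreal 2 * ennreal (r / 4)" by simp
      also have "\<dots> = ennreal r"
        using r by (subst (1 2) ennreal_mult[symmetric]) (auto simp: ennreal_plus[symmetric] simp del: ennreal_plus)
      finally show ?thesis .
    qed
    then show "\<exists>n0. \<forall>m\<ge>n0. \<forall>k\<ge>n0. (\<integral>\<^sup>+w. ennreal ((?S m w - ?S k w)\<^sup>2) \<partial>N) \<le> ennreal r"
      by (intro exI[of _ n0] allI impI)
  qed
  then obtain I where I: "I \<in> borel_measurable N" "(\<lambda>n. \<integral>\<^sup>+w. ennreal ((?S n w - I w)\<^sup>2) \<partial>N) \<longlonglongrightarrow> 0" by blast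
  show ?thesis
    unfolding has_ito_integral_def
  proof (intro exI[of _ I] conjI I(1) exI[of _ Suc] exI[of _ "\<lambda>m i. real i / real (Suc m)"]
      exI[of _ "\<lambda>m. drift_step v C (Suc m)"] allI)
    show "simple_integrand \<nu> (Suc m) (\<lambda>i. real i / real (Suc m)) (drift_step v C (Suc m))" for m
      by (rule drift_step_simple[OF v]) simp
  qed (use conv[unfolded sqdist_def] I(2) in auto)
qed

text \<open>\<open>ito_delta\<close> is a choice over both the density and the integral. Uniqueness
  of densities moves a given approximation to the chosen density, where \<open>ito_approx\<close>
  applies.\<close>

lemma ito_delta_approx:
  assumes v: "v \<in> bounded_drifts \<nu>" "bdrift v dv C"
    and e: "\<And>n. elem (\<psi> n) (J n)" and lim: "(\<lambda>n. sqdist (\<psi> n) dv) \<longlonglongrightarrow> 0"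
  shows "ito_delta \<nu> \<beta> v \<in> borel_measurable N"
    "(\<lambda>n. \<integral>\<^sup>+w. ennreal ((J n w - ito_delta \<nu> \<beta> v w)\<^sup>2) \<partial>N) \<longlonglongrightarrow> 0"
proof -
  from v(1) obtain d1 C1 where d1: "bdrift v d1 C1" "adapted_density \<nu> v d1" by (rule bounded_driftsE)
  from ito_exists[OF d1(1)] d1(2) have "\<exists>I. \<exists>du. adapted_density \<nu> v du \<and> has_ito_integral \<nu> \<beta> du I" by blast
  then have "\<exists>du. adapted_density \<nu> v du \<and> has_ito_integral \<nu> \<beta> du (ito_delta \<nu> \<beta> v)"
    unfolding ito_delta_def by (rule someI_ex)
  then obtain d2 where d2: "adapted_density \<nu> v d2" "has_ito_integral \<nu> \<beta> d2 (ito_delta \<nu> \<beta> v)" by blast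
  from d2(1) have d2m: "case_prod d2 \<in> borel_measurable Q" and d2d: "AE w in N. has_density (v w) (d2 w)"
    unfolding adapted_density_iff by blast+
  have "AE w in N. AE s in unit_leb. d2 w s = dv w s"
    using d2d bdriftD(4)[OF v(2)]
  proof eventually_elim
    case (elim w) show ?case by (rule has_density_unique[OF elim])
  qed
  from sqdist_cong[OF this] lim have "(\<lambda>n. sqdist (\<psi> n) d2) \<longlonglongrightarrow> 0" by simp
  from ito_approx[OF d2(2) d2m e this]
  show "ito_delta \<nu> \<beta> v \<in> borel_measurable N"
    "(\<lambda>n. \<integral>\<^sup>+w. ennreal ((J n w - ito_delta \<nu> \<beta> v w)\<^sup>2) \<partial>N) \<longlonglongrightarrow> 0" by blast+
qed

lemma ito_delta_measurable:
  assumes v: "v \<in> bounded_drifts \<nu>"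
  shows "ito_delta \<nu> \<beta> v \<in> borel_measurable N"
proof -
  from v obtain dv C where d: "bdrift v dv C" by (rule bounded_driftsE)
  from drift_elem_seq[OF d] obtain \<psi> J where "\<forall>n :: nat. elem (\<psi> n) (J n)"
    and lim: "(\<lambda>n. sqdist (\<psi> n) dv) \<longlonglongrightarrow> 0" by blast
  then have e: "elem (\<psi> n) (J n)" for n by blast
  show ?thesis by (rule ito_delta_approx(1)[OF v d e lim])
qed

text \<open>Elementary integrals are centred, and the mean is continuous in L2: the square of a mean
  is at most the second moment because the variance is nonnegative.\<close>

lemma ito_delta_mean:
  assumes v: "v \<in> bounded_drifts \<nu>"
  shows "integrable N (ito_delta \<nu> \<beta> v)" "(\<integral>w. ito_delta \<nu> \<beta> v w \<partial>N) = 0"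
proof -
  let ?I = "ito_delta \<nu> \<beta> v"
  from v obtain dv C where d: "bdrift v dv C" by (rule bounded_driftsE)
  from drift_elem_seq[OF d] obtain \<psi> J where "\<forall>n :: nat. elem (\<psi> n) (J n)"
    and lim: "(\<lambda>n. sqdist (\<psi> n) dv) \<longlonglongrightarrow> 0" by blast
  then have e: "elem (\<psi> n) (J n)" for n by blast
  note [measurable] = ito_delta_measurable[OF v]
  note conv = ito_delta_approx(2)[OF v d e lim]
  have [measurable]: "J n \<in> borel_measurable N" for n by (rule elem_J_meas[OF e])
  have Ji: "integrable N (J n)" "(\<integral>w. J n w \<partial>N) = 0" for n
    using elem_adapted[OF e[of n]] N.square_integrable_imp_integrable[of "J n"] by blast+
  have small: "\<exists>n. integrable N (\<lambda>w. J n w - ?I w) \<and> (\<integral>w. J n w - ?I w \<partial>N)\<^sup>2 < r" if r: "0 < r" for r :: real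
  proof -
    have "\<forall>\<^sub>F n in sequentially. (\<integral>\<^sup>+w. ennreal ((J n w - ?I w)\<^sup>2) \<partial>N) < ennreal r"
      using r by (intro order_tendstoD(2)[OF conv]) auto
    then obtain n where n: "(\<integral>\<^sup>+w. ennreal ((J n w - ?I w)\<^sup>2) \<partial>N) < ennreal r"
      by (auto simp: eventually_sequentially)
    have sq: "integrable N (\<lambda>w. (J n w - ?I w)\<^sup>2)"
      using n by (intro integrableI_bounded) (auto intro: less_trans)
    have D: "integrable N (\<lambda>w. J n w - ?I w)"
      by (rule N.square_integrable_imp_integrable[OF _ sq]) measurable
    have "(\<integral>w. J n w - ?I w \<partial>N)\<^sup>2 \<le> (\<integral>w. (J n w - ?I w)\<^sup>2 \<partial>N)"
      using N.variance_positive[of "\<lambda>w. J n w - ?I w"] N.variance_eq[OF D sq] by simp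
    also have "\<dots> < r"
    proof -
      have "ennreal (\<integral>w. (J n w - ?I w)\<^sup>2 \<partial>N) = (\<integral>\<^sup>+w. ennreal ((J n w - ?I w)\<^sup>2) \<partial>N)"
        by (intro nn_integral_eq_integral[symmetric] sq) auto
      with n have "ennreal (\<integral>w. (J n w - ?I w)\<^sup>2 \<partial>N) < ennreal r" by simp
      then show ?thesis using r by (subst (asm) ennreal_less_iff) auto
    qed
    finally show ?thesis using D by blast
  qed
  from small[of 1] obtain n where "integrable N (\<lambda>w. J n w - ?I w)" by auto
  from Bochner_Integration.integrable_diff[OF Ji(1)[of n] this]
  show I: "integrable N ?I" by simp
  have less: "(\<integral>w. ?I w \<partial>N)\<^sup>2 < r" if "0 < r" for r
    using small[OF that] I Ji by auto
  show "(\<integral>w. ?I w \<partial>N) = 0"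
  proof (rule ccontr)
    assume "(\<integral>w. ?I w \<partial>N) \<noteq> 0"
    then have "0 < (\<integral>w. ?I w \<partial>N)\<^sup>2" by simp
    from less[OF this] show False by simp
  qed
qed

text \<open>Adding one fixed interval to every elementary approximant leaves its distance to the
  drift unchanged, so both integrals are limits along the same sequence.\<close>

lemma ito_delta_piece:
  assumes u: "u \<in> bounded_drifts \<nu>" "bdrift u du C"
    and v: "v \<in> bounded_drifts \<nu>" "bdrift v (\<lambda>w s. du w s + indicator {t<..T} s *\<^sub>R \<xi> w) C'"
    and tT: "0 \<le> t" "t \<le> T" "T \<le> 1" and xi: "\<xi> \<in> borel_measurable (F t)"
    and K: "\<And>w. w \<in> space \<nu> \<Longrightarrow> norm (\<xi> w) \<le> K"
  shows "AE w in N. ito_delta \<nu> \<beta> v w = ito_delta \<nu> \<beta> u w + \<xi> w \<bullet> (\<beta> w T - \<beta> w t)"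
proof -
  from drift_elem_seq[OF u(2)] obtain \<psi> J where "\<forall>n :: nat. elem (\<psi> n) (J n)"
    and lim: "(\<lambda>n. sqdist (\<psi> n) du) \<longlonglongrightarrow> 0" by blast
  then have e: "elem (\<psi> n) (J n)" for n by blast
  let ?p = "\<lambda>w. \<xi> w \<bullet> (\<beta> w T - \<beta> w t)"
  have e': "elem (\<lambda>w s. \<psi> n w s + indicator {t<..T} s *\<^sub>R \<xi> w) (\<lambda>w. J n w + ?p w)" for n
    by (rule elem_add[OF e tT xi K])
  have "sqdist (\<lambda>w s. \<psi> n w s + indicator {t<..T} s *\<^sub>R \<xi> w) (\<lambda>w s. du w s + indicator {t<..T} s *\<^sub>R \<xi> w) = sqdist (\<psi> n) du" for n
    by (simp add: sqdist_def)
  with lim have lim': "(\<lambda>n. sqdist (\<lambda>w s. \<psi> n w s + indicator {t<..T} s *\<^sub>R \<xi> w) (\<lambda>w s. du w s + indicator {t<..T} s *\<^sub>R \<xi> w)) \<longlonglongrightarrow> 0"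
    by simp
  note a = ito_delta_approx[OF u e lim] and b = ito_delta_approx[OF v e' lim']
  have pm: "?p \<in> borel_measurable N" by (rule canonical_imp_N[OF tT(3) incr_meas[OF tT xi]])
  show ?thesis
  proof (rule L2_limit_unique[OF b(1) _ _ b(2)])
    show "(\<lambda>w. ito_delta \<nu> \<beta> u w + ?p w) \<in> borel_measurable N" by (intro borel_measurable_add a(1) pm)
    show "(\<lambda>w. J n w + ?p w) \<in> borel_measurable N" for n by (rule elem_J_meas[OF e'])
    show "(\<lambda>n. \<integral>\<^sup>+w. ennreal ((J n w + ?p w - (ito_delta \<nu> \<beta> u w + ?p w))\<^sup>2) \<partial>N) \<longlonglongrightarrow> 0"
      using a(2) by simp
  qed
qed

end

section \<open>Perturbed drifts\<close>

lemma measure_unit_leb_Ioc: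
  assumes "0 \<le> a" "b \<le> 1"
  shows "measure unit_leb {a<..b} = max 0 (b - a)"
proof -
  have "measure unit_leb {a<..b} = measure lborel {a<..b}"
    using assms unfolding unit_leb_def by (subst measure_restrict_space) auto
  also have "\<dots> = max 0 (b - a)" by (cases "a \<le> b") auto
  finally show ?thesis .
qed

lemma integral_unit_leb_Ioc:
  assumes "0 \<le> a" "b \<le> 1"
  shows "(\<integral>s. indicator {a<..b} s *\<^sub>R (x :: 'b::{banach, second_countable_topology}) \<partial>unit_leb) = max 0 (b - a) *\<^sub>R x"
proof -
  have "integrable unit_leb (indicat_real {a<..b})"
    by (rule unit_leb_bounded_integrable[of _ 1]) (auto simp: indicator_def)
  moreover have "{a<..b} \<inter> {0..1} = {a<..b}" using assms by auto
  ultimately show ?thesis using measure_unit_leb_Ioc[OF assms] by simp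
qed

text \<open>The factor \<open>min T (max t s) - t\<close> is the length of (t, T] up to time
  \<open>s\<close>, that is, the primitive of its indicator. The cross term in the norm integrates
  the density over (t, T] and so becomes an increment of \<open>h\<close>.\<close>

lemma
  fixes h :: "real \<Rightarrow> real ^ 'n::finite"
  assumes h: "has_density h g" and tT: "0 \<le> t" "t \<le> T" "T \<le> 1"
  shows has_density_add_step:
      "has_density (\<lambda>s\<in>{0..1}. h s + (min T (max t s) - t) *\<^sub>R x) (\<lambda>s. g s + indicator {t<..T} s *\<^sub>R x)"
    and cm_norm_sq_add_step:
      "cm_norm_sq (\<lambda>s\<in>{0..1}. h s + (min T (max t s) - t) *\<^sub>R x) =
        cm_norm_sq h + 2 * ((h T - h t) \<bullet> x) + (T - t) * (norm x)\<^sup>2"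
proof -
  have gm[measurable]: "g \<in> borel_measurable unit_leb" and g2: "integrable unit_leb (\<lambda>s. (norm (g s))\<^sup>2)"
    using h unfolding has_density_unit_leb by blast+
  have hv: "h r = (\<integral>s. indicator {0..r} s *\<^sub>R g s \<partial>unit_leb)" if "r \<in> {0..1}" for r
    using h that by (simp add: has_density_unit_leb)
  note gi = has_density_integrable[OF h]
  have ci: "integrable unit_leb (\<lambda>r. indicator A r *\<^sub>R g r)" if "A \<in> sets borel" for A
    by (rule cell_integrable[OF gi that])
  have xi: "integrable unit_leb (\<lambda>r. indicator A r *\<^sub>R y)" if "A \<in> sets borel" for A and y :: "'c::{banach, second_countable_topology}"
    using that by (intro unit_leb_bounded_integrable[of _ "norm y"]) (auto simp: indicator_def)
  have sq: "(norm (g s + indicator {t<..T} s *\<^sub>R x))\<^sup>2 =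
      (norm (g s))\<^sup>2 + 2 * ((indicator {t<..T} s *\<^sub>R g s) \<bullet> x) + indicator {t<..T} s *\<^sub>R (norm x)\<^sup>2" for s
    by (auto simp: indicator_def power2_norm_eq_inner inner_add_left inner_add_right inner_commute)
  have gx: "integrable unit_leb (\<lambda>s. (indicator {t<..T} s *\<^sub>R g s) \<bullet> x)"
    by (intro integrable_inner_left ci) simp
  have sqi: "integrable unit_leb (\<lambda>s. (norm (g s + indicator {t<..T} s *\<^sub>R x))\<^sup>2)"
    unfolding sq
    by (intro Bochner_Integration.integrable_add g2 integrable_mult_right gx xi) simp
  show d: "has_density (\<lambda>s\<in>{0..1}. h s + (min T (max t s) - t) *\<^sub>R x) (\<lambda>s. g s + indicator {t<..T} s *\<^sub>R x)"
    unfolding has_density_unit_leb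
  proof (intro conjI sqi restrict_ext)
    show "(\<lambda>s. g s + indicator {t<..T} s *\<^sub>R x) \<in> borel_measurable unit_leb" by measurable
    fix r :: real assume r: "r \<in> {0..1}"
    have "indicator {0..r} s *\<^sub>R (g s + indicator {t<..T} s *\<^sub>R x) =
      indicator {0..r} s *\<^sub>R g s + indicator {t<..min r T} s *\<^sub>R x" for s
      using tT by (auto simp: indicator_def)
    then have "(\<integral>s. indicator {0..r} s *\<^sub>R (g s + indicator {t<..T} s *\<^sub>R x) \<partial>unit_leb) =
      h r + (\<integral>s. indicator {t<..min r T} s *\<^sub>R x \<partial>unit_leb)"
      by (simp only: hv[OF r]) (intro Bochner_Integration.integral_add ci xi; simp)
    also have "(\<integral>s. indicator {t<..min r T} s *\<^sub>R x \<partial>unit_leb) = max 0 (min r T - t) *\<^sub>R x"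
      using tT by (intro integral_unit_leb_Ioc) auto
    also have "max 0 (min r T - t) = min T (max t r) - t" using tT by (auto simp: min_def max_def)
    finally show "h r + (min T (max t r) - t) *\<^sub>R x =
      (\<integral>s. indicator {0..r} s *\<^sub>R (g s + indicator {t<..T} s *\<^sub>R x) \<partial>unit_leb)" by simp
  qed
  have inc: "h T - h t = (\<integral>s. indicator {t<..T} s *\<^sub>R g s \<partial>unit_leb)"
  proof -
    have "h T - h t = (\<integral>s. indicator {0..T} s *\<^sub>R g s - indicator {0..t} s *\<^sub>R g s \<partial>unit_leb)"
      using tT hv[of T] hv[of t] by (subst Bochner_Integration.integral_diff[OF ci ci]) auto
    also have "\<dots> = (\<integral>s. indicator {t<..T} s *\<^sub>R g s \<partial>unit_leb)"
      using tT by (intro Bochner_Integration.integral_cong refl) (auto simp: indicator_def)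
    finally show ?thesis .
  qed
  have "cm_norm_sq (\<lambda>s\<in>{0..1}. h s + (min T (max t s) - t) *\<^sub>R x) =
      (\<integral>s. (norm (g s))\<^sup>2 + 2 * ((indicator {t<..T} s *\<^sub>R g s) \<bullet> x) + indicator {t<..T} s *\<^sub>R (norm x)\<^sup>2 \<partial>unit_leb)"
    by (simp only: cm_norm_sq_eq[OF d] sq)
  also have "\<dots> = (\<integral>s. (norm (g s))\<^sup>2 \<partial>unit_leb) + 2 * (\<integral>s. (indicator {t<..T} s *\<^sub>R g s) \<bullet> x \<partial>unit_leb)
      + (\<integral>s. indicator {t<..T} s *\<^sub>R (norm x)\<^sup>2 \<partial>unit_leb)"
    using g2 gx xi[of "{t<..T}" "(norm x)\<^sup>2"]
    by (subst Bochner_Integration.integral_add, simp, simp, subst Bochner_Integration.integral_add, simp, simp, simp)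
  also have "(\<integral>s. (indicator {t<..T} s *\<^sub>R g s) \<bullet> x \<partial>unit_leb) = (h T - h t) \<bullet> x"
    unfolding inc by (intro integral_inner_left ci) simp
  also have "(\<integral>s. indicator {t<..T} s *\<^sub>R (norm x)\<^sup>2 \<partial>unit_leb) = max 0 (T - t) *\<^sub>R (norm x)\<^sup>2"
    using tT by (intro integral_unit_leb_Ioc)
  finally show "cm_norm_sq (\<lambda>s\<in>{0..1}. h s + (min T (max t s) - t) *\<^sub>R x) =
        cm_norm_sq h + 2 * ((h T - h t) \<bullet> x) + (T - t) * (norm x)\<^sup>2"
    using tT by (simp only: cm_norm_sq_eq[OF h] real_scaleR_def max_absorb2 diff_ge_0_iff_ge)
qed

lemma has_density_path: "has_density h g \<Longrightarrow> h \<in> cameron_martin"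
  by (auto simp: cameron_martin_def)

text \<open>This integral is the normalising constant that is cancelled in
  \<open>P_incr_indep\<close>, so it must be neither zero nor infinite.\<close>

lemma gauss_integral:
  fixes h :: real
  assumes "0 < h"
  shows "(\<integral>\<^sup>+x. ennreal (exp (- (norm x)\<^sup>2 / (2 * h))) \<partial>(lborel :: (real ^ 'n::finite) measure)) < \<infinity>" (is "?I < _")
    and "0 < (\<integral>\<^sup>+x. ennreal (exp (- (norm x)\<^sup>2 / (2 * h))) \<partial>(lborel :: (real ^ 'n::finite) measure))"
proof -
  have eq: "exp (- (norm x)\<^sup>2 / (2 * h)) = (\<Prod>i\<in>UNIV. exp (- (x $ i)\<^sup>2 / (2 * h)))" for x :: "real ^ 'n"
  proof -
    have "(norm x)\<^sup>2 = (\<Sum>i\<in>UNIV. (x $ i)\<^sup>2)"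
      unfolding power2_norm_eq_inner inner_vec_def by (simp add: power2_eq_square)
    then have "- (norm x)\<^sup>2 / (2 * h) = (\<Sum>i\<in>UNIV. - (x $ i)\<^sup>2 / (2 * h))"
      by (simp only: sum_negf[symmetric] sum_divide_distrib)
    then show ?thesis by (simp only: exp_sum[OF finite])
  qed
  have i1: "integrable lborel (\<lambda>y::real. exp (- y\<^sup>2 / (2 * h)))"
  proof -
    have "integrable lborel (\<lambda>y. sqrt (2 * pi * h) * normal_density 0 (sqrt h) y)"
      using assms by (intro integrable_mult_right integrable_normal_density) simp
    moreover have "sqrt (2 * pi * h) * normal_density 0 (sqrt h) y = exp (- y\<^sup>2 / (2 * h))" for y
      using assms by (simp add: normal_density_def)
    ultimately show ?thesis by simp
  qed
  have "integrable lborel (\<lambda>x :: real ^ 'n. exp (- (norm x)\<^sup>2 / (2 * h)))"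
    unfolding eq by (rule integral_lborel_vec_prod(1)[OF i1])
  then show "?I < \<infinity>" by (simp add: integrable_iff_bounded)
  show "0 < ?I"
  proof (rule ccontr)
    assume "\<not> 0 < ?I"
    then have "?I = 0" by simp
    then have "AE x in (lborel :: (real ^ 'n) measure). ennreal (exp (- (norm x)\<^sup>2 / (2 * h))) = 0"
      by (subst (asm) nn_integral_0_iff_AE) auto
    then have "AE x in (lborel :: (real ^ 'n) measure). False"
      by eventually_elim (simp add: ennreal_eq_0_iff not_le)
    then obtain M where "M \<in> null_sets (lborel :: (real ^ 'n) measure)" "UNIV \<subseteq> M"
      by (auto simp: eventually_ae_filter)
    then have "emeasure (lborel :: (real ^ 'n) measure) UNIV = 0"
      using null_setsD1[of M lborel] by (simp add: top_unique)
    then show False by (simp add: emeasure_lborel_UNIV)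
  qed
qed

section \<open>Change of measure along the family \<open>W\<close>\<close>

locale girsanov_space = bm_space \<nu> \<beta> for \<nu> :: "(real \<Rightarrow> real ^ 'n::finite) measure" and \<beta> +
  fixes W :: "((real \<Rightarrow> real ^ 'n) \<Rightarrow> (real \<Rightarrow> real ^ 'n)) \<Rightarrow> (real \<Rightarrow> real ^ 'n) \<Rightarrow> (real \<Rightarrow> real ^ 'n)"
  assumes W_meas: "\<And>v. v \<in> bounded_drifts \<nu> \<Longrightarrow> W v \<in> measurable (completion \<nu>) path_space"
    and W_law: "\<And>v. v \<in> bounded_drifts \<nu> \<Longrightarrow>
          image_law (density (completion \<nu>) (\<lambda>w. ennreal (girsanov_density \<nu> \<beta> v w))) (W v) =
          image_law (completion \<nu>) (\<lambda>w. w)"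
    and beta_W: "\<And>v. v \<in> bounded_drifts \<nu> \<Longrightarrow>
          (AE w in \<nu>. \<beta> (W v w) = path_add (\<beta> w) (v w))"
begin

abbreviation "\<rho> v \<equiv> girsanov_density \<nu> \<beta> v"

lemma N_cong:
  fixes f :: "_ \<Rightarrow> 'b::topological_space"
  shows "f \<in> borel_measurable N \<Longrightarrow> AE w in N. f w = g w \<Longrightarrow> g \<in> borel_measurable N"
  by (rule measurable_completed_cong[of N \<nu>]) (auto simp: AE_completion_iff)

lemma cm_norm_sq_drift:
  assumes v: "bdrift v dv C"
  shows "AE w in N. cm_norm_sq (v w) = (\<integral>s. (norm (dv w s))\<^sup>2 \<partial>unit_leb)"
  using bdriftD(4)[OF v] by eventually_elim (rule cm_norm_sq_eq)

lemma cm_norm_sq_meas: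
  assumes v: "v \<in> bounded_drifts \<nu>"
  shows "(\<lambda>w. cm_norm_sq (v w)) \<in> borel_measurable N" "integrable N (\<lambda>w. cm_norm_sq (v w))"
proof -
  from v obtain dv C where d: "bdrift v dv C" by (rule bounded_driftsE)
  note [measurable] = bdriftD(2)[OF d]
  have m: "(\<lambda>w. \<integral>s. (norm (dv w s))\<^sup>2 \<partial>unit_leb) \<in> borel_measurable N"
  proof (rule R.borel_measurable_lebesgue_integral)
    have "(\<lambda>p. (norm (dv (fst p) (snd p)))\<^sup>2) \<in> borel_measurable Q" by measurable
    then show "(\<lambda>(w, s). (norm (dv w s))\<^sup>2) \<in> borel_measurable Q" by (simp add: case_prod_beta')
  qed
  from cm_norm_sq_drift[OF d] have ae: "AE w in N. (\<integral>s. (norm (dv w s))\<^sup>2 \<partial>unit_leb) = cm_norm_sq (v w)"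
    by eventually_elim simp
  show M: "(\<lambda>w. cm_norm_sq (v w)) \<in> borel_measurable N" by (rule N_cong[OF m ae])
  have "AE w in N. norm (cm_norm_sq (v w)) \<le> C\<^sup>2"
    using cm_norm_sq_drift[OF d] bdriftD(4)[OF d] bdriftD(5)[OF d]
  proof eventually_elim
    case (elim w)
    have "(\<integral>s. (norm (dv w s))\<^sup>2 \<partial>unit_leb) \<le> (\<integral>s. C\<^sup>2 \<partial>unit_leb)"
    proof (rule integral_mono_AE)
      show "integrable unit_leb (\<lambda>s. (norm (dv w s))\<^sup>2)" using elim(2) unfolding has_density_unit_leb by blast
      show "AE s in unit_leb. (norm (dv w s))\<^sup>2 \<le> C\<^sup>2"
        using elim(3) by eventually_elim (intro power_mono, auto)
    qed simp
    moreover have "0 \<le> (\<integral>s. (norm (dv w s))\<^sup>2 \<partial>unit_leb)" by (intro integral_nonneg_AE) auto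
    ultimately show ?case using elim(1) by simp
  qed
  then show "integrable N (\<lambda>w. cm_norm_sq (v w))" by (rule N.integrable_const_bound[OF _ M])
qed

lemma rho_meas:
  assumes v: "v \<in> bounded_drifts \<nu>"
  shows "\<rho> v \<in> borel_measurable N"
proof -
  note [measurable] = ito_delta_measurable[OF v] cm_norm_sq_meas(1)[OF v]
  show ?thesis unfolding girsanov_density_def[abs_def] by measurable
qed

lemma rho_pos: "0 < \<rho> v w"
  by (simp add: girsanov_density_def)

lemma W_nn_integral:
  assumes v: "v \<in> bounded_drifts \<nu>" and h: "h \<in> borel_measurable \<nu>"
  shows "(\<integral>\<^sup>+w. ennreal (\<rho> v w) * h (W v w) \<partial>N) = (\<integral>\<^sup>+w. h w \<partial>N)"
proof -
  have hp: "h \<in> borel_measurable path_space" using h sets_nu by (simp cong: measurable_cong_sets)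
  have rm: "(\<lambda>w. ennreal (\<rho> v w)) \<in> borel_measurable N" using rho_meas[OF v] by measurable
  have hW: "(\<lambda>w. h (W v w)) \<in> borel_measurable N" by (rule measurable_compose[OF W_meas[OF v] hp])
  have "(\<integral>\<^sup>+w. h w \<partial>N) = (\<integral>\<^sup>+w. h w \<partial>image_law N (\<lambda>w. w))"
    unfolding image_law_def by (subst nn_integral_distr[OF id_N]) (simp_all add: hp)
  also have "\<dots> = (\<integral>\<^sup>+w. h w \<partial>image_law (density N (\<lambda>w. ennreal (\<rho> v w))) (W v))"
    by (simp only: W_law[OF v])
  also have "\<dots> = (\<integral>\<^sup>+w. h (W v w) \<partial>density N (\<lambda>w. ennreal (\<rho> v w)))"
    unfolding image_law_def using W_meas[OF v] hp
    by (subst nn_integral_distr) (simp_all cong: measurable_cong_sets)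
  also have "\<dots> = (\<integral>\<^sup>+w. ennreal (\<rho> v w) * h (W v w) \<partial>N)"
    by (rule nn_integral_density[OF rm hW])
  finally show ?thesis ..
qed

text \<open>The Girsanov density is strictly positive, so a set is null for the law of
  \<open>W v\<close> under \<nu> exactly when it is null for the law under the weighted measure,
  which is \<nu> itself.\<close>

lemma W_null:
  assumes v: "v \<in> bounded_drifts \<nu>" and A: "A \<in> sets \<nu>"
  shows "(AE w in N. W v w \<notin> A) \<longleftrightarrow> (AE w in N. w \<notin> A)"
proof -
  have Am: "A \<in> sets path_space" using A sets_nu by simp
  have iW: "(\<lambda>w. indicator A (W v w) :: ennreal) \<in> borel_measurable N"
    using measurable_compose[OF W_meas[OF v] borel_measurable_indicator[OF Am]] .
  have rm: "(\<lambda>w. ennreal (\<rho> v w)) \<in> borel_measurable N" using rho_meas[OF v] by measurable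
  have "(AE w in N. W v w \<notin> A) \<longleftrightarrow> (AE w in N. ennreal (\<rho> v w) * indicator A (W v w) = 0)"
  proof -
    have "\<not> \<rho> v w \<le> 0" for w using rho_pos[of v w] by linarith
    then show ?thesis by (intro AE_cong) (auto simp: indicator_def ennreal_eq_0_iff)
  qed
  also have "\<dots> \<longleftrightarrow> (\<integral>\<^sup>+w. ennreal (\<rho> v w) * indicator A (W v w) \<partial>N) = 0"
    using rm iW by (intro nn_integral_0_iff_AE[symmetric] borel_measurable_times_ennreal)
  also have "\<dots> \<longleftrightarrow> (\<integral>\<^sup>+w. indicator A w \<partial>N) = 0"
    by (subst W_nn_integral[OF v borel_measurable_indicator[OF A]]) (rule refl)
  also have "\<dots> \<longleftrightarrow> (AE w in N. (indicator A w :: ennreal) = 0)"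
    by (rule nn_integral_0_iff_AE[OF borel_measurable_indicator[OF sets_completionI_sets[OF A]]])
  also have "\<dots> \<longleftrightarrow> (AE w in N. w \<notin> A)" by (intro AE_cong) (auto simp: indicator_def)
  finally show ?thesis .
qed

lemma W_AE:
  assumes v: "v \<in> bounded_drifts \<nu>" and P: "AE w in \<nu>. P w"
  shows "AE w in N. P (W v w)"
proof -
  from P obtain E where E: "E \<in> null_sets \<nu>" "{w \<in> space \<nu>. \<not> P w} \<subseteq> E"
    by (auto simp: eventually_ae_filter)
  have "AE w in N. w \<notin> E" using AE_not_in[OF E(1)] by (simp add: AE_completion_iff)
  then have "AE w in N. W v w \<notin> E" using W_null[OF v null_setsD2[OF E(1)]] by blast
  with AE_space show ?thesis
  proof eventually_elim
    case (elim w)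
    then have "W v w \<in> space \<nu>" using measurable_space[OF W_meas[OF v], of w] by (simp add: space_nu)
    then show ?case using elim E(2) by auto
  qed
qed

text \<open>\<open>\<beta>\<close> is measurable only for the completion. The integrand is replaced
  by a version measurable for \<nu>, and \<open>W_AE\<close> shows that the exceptional set is
  harmless after composition with \<open>W v\<close>.\<close>

lemma W_nn_integral_N:
  assumes v: "v \<in> bounded_drifts \<nu>" and h: "h \<in> borel_measurable N"
  shows "(\<integral>\<^sup>+w. ennreal (\<rho> v w) * h (W v w) \<partial>N) = (\<integral>\<^sup>+w. h w \<partial>N)"
proof -
  from completion_ex_borel_measurable[OF h] obtain h' where h': "h' \<in> borel_measurable \<nu>" "AE w in \<nu>. h w = h' w" by blast
  have "(\<integral>\<^sup>+w. ennreal (\<rho> v w) * h (W v w) \<partial>N) = (\<integral>\<^sup>+w. ennreal (\<rho> v w) * h' (W v w) \<partial>N)"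
  proof (rule nn_integral_cong_AE)
    show "AE w in N. ennreal (\<rho> v w) * h (W v w) = ennreal (\<rho> v w) * h' (W v w)"
      using W_AE[OF v h'(2)] by eventually_elim simp
  qed
  also have "\<dots> = (\<integral>\<^sup>+w. h' w \<partial>N)" by (rule W_nn_integral[OF v h'(1)])
  also have "\<dots> = (\<integral>\<^sup>+w. h w \<partial>N)"
  proof (rule nn_integral_cong_AE)
    show "AE w in N. h' w = h w" using h'(2) unfolding AE_completion_iff by eventually_elim simp
  qed
  finally show ?thesis .
qed

text \<open>Girsanov's theorem for a single increment, read off from (iii) and (iv).\<close>

lemma W_incr_law:
  assumes v: "v \<in> bounded_drifts \<nu>" and tT: "t \<in> {0..1}" "T \<in> {0..1}" and f: "f \<in> borel_measurable borel"
  shows "(\<integral>\<^sup>+w. ennreal (\<rho> v w) * f (\<beta> w T - \<beta> w t + (v w T - v w t)) \<partial>N) = (\<integral>\<^sup>+w. f (\<beta> w T - \<beta> w t) \<partial>N)"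
proof -
  have m: "(\<lambda>w. f (\<beta> w T - \<beta> w t)) \<in> borel_measurable N"
    by (rule measurable_compose[OF borel_measurable_diff[OF beta_coord[OF tT(2)] beta_coord[OF tT(1)]] f])
  have "(\<integral>\<^sup>+w. ennreal (\<rho> v w) * f (\<beta> w T - \<beta> w t + (v w T - v w t)) \<partial>N) =
     (\<integral>\<^sup>+w. ennreal (\<rho> v w) * f (\<beta> (W v w) T - \<beta> (W v w) t) \<partial>N)"
  proof (rule nn_integral_cong_AE)
    show "AE w in N. ennreal (\<rho> v w) * f (\<beta> w T - \<beta> w t + (v w T - v w t)) =
        ennreal (\<rho> v w) * f (\<beta> (W v w) T - \<beta> (W v w) t)"
      using beta_W[OF v] unfolding AE_completion_iff
    proof eventually_elim
      case (elim w)
      have "\<beta> (W v w) T - \<beta> (W v w) t = \<beta> w T - \<beta> w t + (v w T - v w t)"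
        using tT by (simp add: elim path_add_def)
      then show ?case by simp
    qed
  qed
  also have "\<dots> = (\<integral>\<^sup>+w. f (\<beta> w T - \<beta> w t) \<partial>N)" by (rule W_nn_integral_N[OF v m])
  finally show ?thesis .
qed

text \<open>The step starts at \<open>t\<close> and depends on the path only through an event known
  at \<open>t\<close>, so the drift stays adapted and bounded. In the exponent, the stochastic
  integral gains an increment of \<open>\<beta>\<close> and half the squared norm gains the matching
  increment of \<open>u\<close>, which combine into the increment of
  \<open>\<beta> + u\<close>.\<close>

lemma perturbed_drift:
  fixes u :: "(real \<Rightarrow> real ^ 'n) \<Rightarrow> real \<Rightarrow> real ^ 'n" and x :: "real ^ 'n"
  assumes u: "u \<in> bounded_drifts \<nu>" and tT: "0 \<le> t" "t \<le> T" "T \<le> 1" and A: "A \<in> sets (F t)"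
  defines "v \<equiv> (\<lambda>w. \<lambda>s\<in>{0..1}. u w s + (min T (max t s) - t) *\<^sub>R (indicator A w *\<^sub>R x))"
  shows "v \<in> bounded_drifts \<nu>"
    and "AE w in N. \<rho> v w = \<rho> u w * exp (- (indicator A w * (x \<bullet> (\<beta> w T - \<beta> w t + (u w T - u w t))
       + (T - t) * (norm x)\<^sup>2 / 2)))"
proof -
  from u obtain du C where d: "bdrift u du C" by (rule bounded_driftsE)
  let ?xi = "\<lambda>w. indicator A w *\<^sub>R x"
  let ?dv = "\<lambda>w s. du w s + indicator {t<..T} s *\<^sub>R ?xi w"
  have AN: "A \<in> sets N" using A canonical_subalgebra[of t] tT by (auto simp: subalgebra_def)
  have xiF: "?xi \<in> borel_measurable (F r)" if "t \<le> r" for r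
  proof -
    have "A \<in> sets (F r)" using filtration_mono[OF that] A by blast
    then show ?thesis by measurable
  qed
  have um: "u \<in> measurable N path_space" by (rule bdriftD(1)[OF d])
  have val: "v w s = u w s + (min T (max t s) - t) *\<^sub>R ?xi w" if "s \<in> {0..1}" for w s
    using that by (simp add: v_def)
  have vm: "v \<in> measurable N path_space"
    unfolding measurable_path_space_iff
  proof (intro conjI ballI funcsetI)
    fix w assume "w \<in> space N"
    then have "continuous_on {0..1} (u w)" using measurable_space[OF um] by (auto simp: space_path_space)
    then have "continuous_on {0..1} (\<lambda>s. u w s + (min T (max t s) - t) *\<^sub>R ?xi w)" by (intro continuous_intros)
    then have "continuous_on {0..1} (v w)" by (rule continuous_on_eq) (simp add: v_def)
    then show "v w \<in> space path_space" by (simp add: space_path_space v_def)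
  next
    fix s :: real assume s: "s \<in> {0..1}"
    have [measurable]: "(\<lambda>w. u w s) \<in> borel_measurable N" by (rule measurable_path_coord[OF um s])
    show "(\<lambda>w. v w s) \<in> borel_measurable N" unfolding val[OF s] using AN by measurable
  qed
  have bd: "bdrift v ?dv (C + norm x)"
    unfolding bdrift_def
  proof (intro conjI ballI vm)
    have [measurable]: "case_prod du \<in> borel_measurable Q" by (rule bdriftD(2)[OF d])
    have [measurable]: "{t<..T} \<in> sets borel" by simp
    note AN[measurable]
    have "(\<lambda>p. du (fst p) (snd p) + indicator {t<..T} (snd p) *\<^sub>R (indicator A (fst p) *\<^sub>R x)) \<in> borel_measurable Q"
      by measurable
    then show "case_prod ?dv \<in> borel_measurable Q" by (simp add: case_prod_beta')
    show "(\<lambda>w. ?dv w s) \<in> borel_measurable (F s)" if s: "s \<in> {0..1}" for s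
    proof (cases "t \<le> s")
      case True
      show ?thesis by (intro borel_measurable_add bdriftD(3)[OF d s] borel_measurable_scaleR borel_measurable_const xiF[OF True])
    next
      case False
      then have "?dv w s = du w s" for w by simp
      then show ?thesis using bdriftD(3)[OF d s] by (simp only:)
    qed
    show "AE w in N. has_density (v w) (?dv w)"
      using bdriftD(4)[OF d] unfolding v_def by eventually_elim (rule has_density_add_step[OF _ tT])
    show "AE w in N. AE s in unit_leb. norm (?dv w s) \<le> C + norm x"
      using bdriftD(5)[OF d]
    proof eventually_elim
      case (elim w)
      then show ?case
      proof eventually_elim
        case (elim s)
        have "norm (indicator {t<..T} s *\<^sub>R ?xi w) \<le> norm x" by (simp add: indicator_def)
        with elim show ?case by (intro norm_triangle_mono)
      qed
    qed
    show "0 \<le> C + norm x" using bdriftD(6)[OF d] by simp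
  qed
  have cm: "v w \<in> cameron_martin" if w: "w \<in> space \<nu>" for w
  proof -
    have "u w \<in> cameron_martin" using u w unfolding bounded_drifts_def adapted_L0_def by blast
    then obtain g where "has_density (u w) g" by (auto simp: cameron_martin_def)
    from has_density_add_step[OF this tT] show ?thesis unfolding v_def by (rule has_density_path)
  qed
  show v: "v \<in> bounded_drifts \<nu>" by (rule bdrift_bounded_drifts[OF bd cm])
  have ito: "AE w in N. ito_delta \<nu> \<beta> v w = ito_delta \<nu> \<beta> u w + ?xi w \<bullet> (\<beta> w T - \<beta> w t)"
    by (rule ito_delta_piece[OF u d v bd tT xiF[OF order_refl], of "norm x"]) (simp add: indicator_def)
  show "AE w in N. \<rho> v w = \<rho> u w * exp (- (indicator A w * (x \<bullet> (\<beta> w T - \<beta> w t + (u w T - u w t))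
       + (T - t) * (norm x)\<^sup>2 / 2)))"
    using ito bdriftD(4)[OF d]
  proof eventually_elim
    case (elim w)
    have "cm_norm_sq (v w) = cm_norm_sq (u w) + 2 * ((u w T - u w t) \<bullet> ?xi w) + (T - t) * (norm (?xi w))\<^sup>2"
      unfolding v_def by (rule cm_norm_sq_add_step[OF elim(2) tT])
    then have cm: "cm_norm_sq (v w) = cm_norm_sq (u w) + indicator A w * (2 * (x \<bullet> (u w T - u w t)) + (T - t) * (norm x)\<^sup>2)"
      by (cases "w \<in> A") (simp_all add: inner_commute)
    \<comment> \<open>Here \<open>i\<close> stands for the indicator of \<open>A\<close>,
      \<open>b\<close> and \<open>d\<close> for the products of \<open>x\<close> with the increments
      of \<open>\<beta>\<close> and \<open>u\<close>, and \<open>e\<close> for the squared norm of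
      the step.\<close>
    have "- (a + i * b) - (c + i * (2 * d + e)) / 2 = (- a - c / 2) + - (i * (b + d + e / 2))" for a b c d e i :: real
      by (simp add: field_simps)
    then show ?case
      unfolding girsanov_density_def elim(1) cm exp_add[symmetric] inner_add_right inner_scaleR_left by simp
  qed
qed

end

section \<open>Independence of the perturbed increments\<close>

lemma nn_integral_lborel_shift:
  fixes f :: "'a::euclidean_space \<Rightarrow> ennreal"
  assumes [measurable]: "f \<in> borel_measurable borel"
  shows "(\<integral>\<^sup>+z. f (c + z) \<partial>lborel) = (\<integral>\<^sup>+z. f z \<partial>lborel)"
proof -
  have "(\<integral>\<^sup>+z. f z \<partial>lborel) = (\<integral>\<^sup>+z. f z \<partial>distr lborel borel ((+) c))"
    by (simp only: lborel_distr_plus)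
  also have "\<dots> = (\<integral>\<^sup>+z. f (c + z) \<partial>lborel)" by (rule nn_integral_distr) auto
  finally show ?thesis ..
qed

text \<open>A Dynkin argument. Including \<open>space M\<close> in the generator gives
  \<open>Y\<close> mean zero, on which the case of complements rests.\<close>

lemma (in prob_space) orthogonal_sigma_sets:
  fixes Y :: "'a \<Rightarrow> real"
  assumes E: "Int_stable E" "E \<subseteq> events" "space M \<in> E" and Y: "integrable M Y"
    and orth: "\<And>D. D \<in> E \<Longrightarrow> (\<integral>x. Y x * indicator D x \<partial>M) = 0"
    and D: "D \<in> sigma_sets (space M) E"
  shows "(\<integral>x. Y x * indicator D x \<partial>M) = 0"
proof -
  have sub: "E \<subseteq> Pow (space M)" using E(2) sets.space_closed by blast
  have ev: "D \<in> events" if "D \<in> sigma_sets (space M) E" for D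
    using that E(2) sets.sigma_sets_subset by blast
  have int: "integrable M (\<lambda>x. Y x * indicator D x)" if "D \<in> events" for D
    using integrable_mult_indicator[OF that Y] by (simp add: mult.commute)
  have Y0: "(\<integral>x. Y x \<partial>M) = 0"
  proof -
    have "(\<integral>x. Y x \<partial>M) = (\<integral>x. Y x * indicator (space M) x \<partial>M)"
      by (intro Bochner_Integration.integral_cong) auto
    then show ?thesis using orth[OF E(3)] by simp
  qed
  from E(1) sub D show ?thesis
  proof (induction rule: sigma_sets_induct_disjoint)
    case (basic A) then show ?case by (rule orth)
  next
    case empty show ?case by simp
  next
    case (compl A)
    have "(\<integral>x. Y x * indicator (space M - A) x \<partial>M) = (\<integral>x. Y x - Y x * indicator A x \<partial>M)"
      by (intro Bochner_Integration.integral_cong) (auto simp: indicator_def)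
    also have "\<dots> = 0" using compl Y0 by (subst Bochner_Integration.integral_diff[OF Y int[OF ev]]) auto
    finally show ?case .
  next
    case (union A)
    have Ae: "A i \<in> events" for i using union(2) ev by blast
    have "(\<lambda>i. \<integral>x. Y x * indicator (A i) x \<partial>M) sums (\<integral>x\<in>(\<Union>i. A i). Y x \<partial>M)"
    proof -
      have "set_integrable M (\<Union>i. A i) Y"
        unfolding set_integrable_def using Ae by (intro integrable_mult_indicator Y) auto
      then have "(\<integral>x\<in>(\<Union>i. A i). Y x \<partial>M) = (\<Sum>i. \<integral>x\<in>A i. Y x \<partial>M)"
        "summable (\<lambda>i. \<integral>x\<in>A i. Y x \<partial>M)"
        using lebesgue_integral_countable_add[of A M Y] Ae union(1) union(3)
        by (auto simp: disjoint_family_on_def set_lebesgue_integral_def mult.commute)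
      then show ?thesis by (simp add: sums_iff set_lebesgue_integral_def mult.commute)
    qed
    then have "(\<lambda>i. 0 :: real) sums (\<integral>x\<in>(\<Union>i. A i). Y x \<partial>M)" by (simp add: union(3))
    then have "(\<integral>x\<in>(\<Union>i. A i). Y x \<partial>M) = 0" by (simp add: sums_iff)
    then show ?case by (simp add: set_lebesgue_integral_def mult.commute)
  qed
qed

locale drift_space = girsanov_space \<nu> \<beta> W for \<nu> :: "(real \<Rightarrow> real ^ 'n::finite) measure" and \<beta> W +
  fixes u :: "(real \<Rightarrow> real ^ 'n) \<Rightarrow> real \<Rightarrow> real ^ 'n"
  assumes u: "u \<in> bounded_drifts \<nu>"
begin

text \<open>Defined as a sum so that its values are explicit at every path; the identity with
  \<open>\<beta>\<close> composed with \<open>W u\<close> holds almost surely and is recorded later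
  as \<open>beta_U\<close>.\<close>

definition X where "X w = path_add (\<beta> w) (u w)"

definition P where "P = density N (\<lambda>w. ennreal (\<rho> u w))"

abbreviation "G \<equiv> completed_filtration \<nu> X"

lemma rho_u [measurable]: "\<rho> u \<in> borel_measurable N"
  by (rule rho_meas[OF u])

lemma sets_P [simp, measurable_cong]: "sets P = sets N"
  by (simp add: P_def)

lemma space_P [simp]: "space P = space \<nu>"
  by (simp add: P_def)

lemma measurable_P [simp]: "measurable P K = measurable N K"
  by (rule measurable_cong_sets) auto

lemma nn_integral_P: "f \<in> borel_measurable N \<Longrightarrow> (\<integral>\<^sup>+w. f w \<partial>P) = (\<integral>\<^sup>+w. ennreal (\<rho> u w) * f w \<partial>N)"
  unfolding P_def by (intro nn_integral_density) auto

lemma integral_P: 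
  fixes f :: "_ \<Rightarrow> real"
  shows "f \<in> borel_measurable N \<Longrightarrow> (\<integral>w. f w \<partial>P) = (\<integral>w. \<rho> u w * f w \<partial>N)"
  unfolding P_def using rho_pos[of u] by (subst integral_density) (auto intro: less_imp_le)

lemma integrable_P:
  fixes f :: "_ \<Rightarrow> real"
  shows "f \<in> borel_measurable N \<Longrightarrow> integrable P f \<longleftrightarrow> integrable N (\<lambda>w. \<rho> u w * f w)"
  unfolding P_def using rho_pos[of u] by (subst integrable_density) (auto intro: less_imp_le)

lemma prob_space_P: "prob_space P"
proof (rule prob_spaceI)
  have "emeasure P (space P) = (\<integral>\<^sup>+w. 1 \<partial>P)" by simp
  also have "\<dots> = (\<integral>\<^sup>+w. ennreal (\<rho> u w) * 1 \<partial>N)" by (rule nn_integral_P) simp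
  also have "\<dots> = (\<integral>\<^sup>+w. 1 \<partial>N)" by (rule W_nn_integral_N[OF u]) simp
  also have "\<dots> = 1" by (simp add: emeasure_space_1)
  finally show "emeasure P (space P) = 1" .
qed

sublocale P: prob_space P by (rule prob_space_P)

lemma u_path: "u \<in> measurable N path_space"
  using u unfolding bounded_drifts_def adapted_L0_def by blast

lemma X_meas: "X \<in> measurable N path_space"
  unfolding X_def[abs_def] by (intro path_add_measurable beta_meas u_path)

lemma X_val: "s \<in> {0..1} \<Longrightarrow> X w s = \<beta> w s + u w s"
  by (simp add: X_def path_add_def)

lemma u_adapted: "s \<in> {0..1} \<Longrightarrow> (\<lambda>w. u w s) \<in> borel_measurable (F s)"
  by (rule bounded_driftsE[OF u]) (rule bdrift_adapted)

lemma X_adapted: "0 \<le> s \<Longrightarrow> s \<le> t \<Longrightarrow> t \<le> 1 \<Longrightarrow> (\<lambda>w. X w s) \<in> borel_measurable (F t)"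
  using beta_adapted[of s t] filtration_measurable_mono[OF u_adapted[of s], of t]
  by (simp add: X_val)

lemma X_coord: "s \<in> {0..1} \<Longrightarrow> (\<lambda>w. X w s) \<in> borel_measurable N"
  by (rule measurable_path_coord[OF X_meas])

lemma G_subalgebra: "t \<le> 1 \<Longrightarrow> subalgebra N (G t)"
  by (rule filtration_subalgebra[OF X_meas])

lemma G_subset_F: "t \<le> 1 \<Longrightarrow> sets (G t) \<subseteq> sets (F t)"
  by (intro filtration_least filtration_null X_adapted) auto

text \<open>\<open>W_incr_law\<close> for \<open>u\<close> and for \<open>u\<close> perturbed on
  \<open>A\<close> have the same right-hand side. Off \<open>A\<close> the two left-hand integrands
  coincide; cancelling that common part, which is finite because \<open>f\<close> is at most 1,
  leaves the identity on \<open>A\<close>.\<close>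

lemma P_shift:
  fixes f :: "real ^ 'n \<Rightarrow> ennreal" and x :: "real ^ 'n"
  assumes tT: "0 \<le> t" "t < T" "T \<le> 1" and A: "A \<in> sets (F t)" and f: "f \<in> borel_measurable borel"
    and fb: "\<And>y. f y \<le> 1"
  shows "(\<integral>\<^sup>+w. ennreal (\<rho> u w) * (indicator A w *
        (ennreal (exp (- (x \<bullet> (X w T - X w t) + (T - t) * (norm x)\<^sup>2 / 2))) * f (X w T - X w t + (T - t) *\<^sub>R x))) \<partial>N) =
      (\<integral>\<^sup>+w. ennreal (\<rho> u w) * (indicator A w * f (X w T - X w t)) \<partial>N)"
proof -
  have I: "t \<in> {0..1}" "T \<in> {0..1}" using tT by auto
  have tT': "0 \<le> t" "t \<le> T" "T \<le> 1" using tT by auto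
  have AN[measurable]: "A \<in> sets N" using A canonical_subalgebra[of t] tT by (auto simp: subalgebra_def)
  have [measurable]: "space \<nu> - A \<in> sets N" using sets.compl_sets[OF AN] by simp
  note [measurable] = f X_coord[OF I(1)] X_coord[OF I(2)]
  let ?D = "\<lambda>w. X w T - X w t"
  let ?e = "\<lambda>w. exp (- (x \<bullet> ?D w + (T - t) * (norm x)\<^sup>2 / 2))"
  define v where "v w = (\<lambda>s\<in>{0..1}. u w s + (min T (max t s) - t) *\<^sub>R (indicator A w *\<^sub>R x))" for w
  have v: "v \<in> bounded_drifts \<nu>" and rv: "AE w in N. \<rho> v w = \<rho> u w * exp (- (indicator A w * (x \<bullet> (\<beta> w T - \<beta> w t + (u w T - u w t))
       + (T - t) * (norm x)\<^sup>2 / 2)))"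
    using perturbed_drift[OF u tT' A, of x] unfolding v_def[abs_def] by blast+
  have D: "?D w = \<beta> w T - \<beta> w t + (u w T - u w t)" for w using I by (simp add: X_val)
  have vD: "\<beta> w T - \<beta> w t + (v w T - v w t) = ?D w + (T - t) *\<^sub>R (indicator A w *\<^sub>R x)" for w
    using I tT by (simp add: v_def D)
  let ?a = "\<integral>\<^sup>+w. ennreal (\<rho> u w) * (indicator (space \<nu> - A) w * f (?D w)) \<partial>N"
  let ?b = "\<integral>\<^sup>+w. ennreal (\<rho> u w) * (indicator A w * f (?D w)) \<partial>N"
  let ?c = "\<integral>\<^sup>+w. ennreal (\<rho> u w) * (indicator A w * (ennreal (?e w) * f (?D w + (T - t) *\<^sub>R x))) \<partial>N"
  have "(\<integral>\<^sup>+w. ennreal (\<rho> v w) * f (\<beta> w T - \<beta> w t + (v w T - v w t)) \<partial>N) =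
    (\<integral>\<^sup>+w. ennreal (\<rho> u w) * (indicator (space \<nu> - A) w * f (?D w)) +
      ennreal (\<rho> u w) * (indicator A w * (ennreal (?e w) * f (?D w + (T - t) *\<^sub>R x))) \<partial>N)"
  proof (rule nn_integral_cong_AE)
    show "AE w in N. ennreal (\<rho> v w) * f (\<beta> w T - \<beta> w t + (v w T - v w t)) =
      ennreal (\<rho> u w) * (indicator (space \<nu> - A) w * f (?D w)) +
      ennreal (\<rho> u w) * (indicator A w * (ennreal (?e w) * f (?D w + (T - t) *\<^sub>R x)))"
      using rv AE_space
    proof eventually_elim
      case (elim w)
      show ?case
      proof (cases "w \<in> A")
        case True
        then have "\<rho> v w = \<rho> u w * ?e w" using elim(1) by (simp add: D)
        then have "ennreal (\<rho> v w) = ennreal (\<rho> u w) * ennreal (?e w)"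
          using rho_pos[of u w] by (simp add: ennreal_mult less_imp_le)
        then show ?thesis unfolding vD using True by (simp add: mult.assoc)
      next
        case False
        then have "\<rho> v w = \<rho> u w" using elim(1) by simp
        then show ?thesis unfolding vD using False elim(2) by simp
      qed
    qed
  qed
  also have "\<dots> = ?a + ?c" by (rule nn_integral_add) measurable
  finally have 1: "?a + ?c = (\<integral>\<^sup>+w. f (\<beta> w T - \<beta> w t) \<partial>N)" using W_incr_law[OF v I f] by simp
  have "(\<integral>\<^sup>+w. f (\<beta> w T - \<beta> w t) \<partial>N) = (\<integral>\<^sup>+w. ennreal (\<rho> u w) * f (?D w) \<partial>N)"
    unfolding D by (rule W_incr_law[OF u I f, symmetric])
  also have "\<dots> = (\<integral>\<^sup>+w. ennreal (\<rho> u w) * (indicator (space \<nu> - A) w * f (?D w)) +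
      ennreal (\<rho> u w) * (indicator A w * f (?D w)) \<partial>N)"
    by (intro nn_integral_cong) (auto simp: indicator_def)
  also have "\<dots> = ?a + ?b" by (rule nn_integral_add) measurable
  finally have 2: "?a + ?c = ?a + ?b" using 1 by simp
  have "?a \<le> (\<integral>\<^sup>+w. ennreal (\<rho> u w) * 1 \<partial>N)"
    using fb by (intro nn_integral_mono mult_left_mono) (auto simp: indicator_def)
  also have "\<dots> = (\<integral>\<^sup>+w. 1 \<partial>N)" by (rule W_nn_integral_N[OF u]) simp
  also have "\<dots> < \<infinity>" by (simp add: emeasure_space_1)
  finally have "?a \<noteq> top" by (simp add: less_top)
  moreover have "?a = top \<or> ?c = ?b" using 2 unfolding ennreal_add_left_cancel infinity_ennreal_def .
  ultimately show ?thesis by blast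
qed

text \<open>By \<open>P_shift\<close>, the law of the increment on \<open>A\<close>, divided by the Gaussian density, is invariant
  under translations, hence a multiple of Lebesgue measure. The proof integrates the
  identity over all shifts \<open>z\<close>.\<close>

lemma P_incr_indep:
  assumes tT: "0 \<le> t" "t < T" "T \<le> 1" and A: "A \<in> sets (F t)" and B: "B \<in> sets borel"
  shows "P.prob (A \<inter> ((\<lambda>w. X w T - X w t) -` B \<inter> space P)) =
    P.prob A * P.prob ((\<lambda>w. X w T - X w t) -` B \<inter> space P)"
proof -
  define h where "h = T - t"
  have h: "0 < h" using tT by (simp add: h_def)
  have I: "t \<in> {0..1}" "T \<in> {0..1}" using tT by auto
  note [measurable] = X_coord[OF I(1)] X_coord[OF I(2)] B
  let ?D = "\<lambda>w. X w T - X w t"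
  define q :: "real ^ 'n \<Rightarrow> ennreal" where "q x = ennreal (exp (- (norm x)\<^sup>2 / (2 * h)))" for x
  have [measurable]: "q \<in> borel_measurable borel" unfolding q_def by measurable
  have q1: "q x \<le> 1" for x
    unfolding q_def ennreal_le_1 using h by (simp add: divide_nonpos_pos)
  have sym: "q (d - z) = q (- d + z)" for d z
    by (simp add: q_def norm_minus_commute[of d z])
  define c where "c = (\<integral>\<^sup>+x. q x \<partial>lborel)"
  define K where "K = (\<integral>\<^sup>+x. indicator B x * q x \<partial>lborel)"
  have c: "c < \<infinity>" "0 < c" unfolding c_def q_def by (rule gauss_integral[OF h])+
  have main: "emeasure P (A \<inter> (?D -` B \<inter> space P)) * c = emeasure P A * K" if A: "A \<in> sets (F t)" for A
  proof -
    have AN[measurable]: "A \<in> sets N" using A canonical_subalgebra[of t] tT by (auto simp: subalgebra_def)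
    \<comment> \<open>\<open>P_shift\<close> is used with \<open>x = (1 / h) *\<^sub>R z\<close>,
      which translates by exactly \<open>z\<close>, and with
      \<open>f y = indicator B y * q (y - z)\<close>. Completing the square, the exponential weight
      times \<open>q d\<close> is \<open>q (d + z)\<close>.\<close>
    have shift: "(\<integral>\<^sup>+w. ennreal (\<rho> u w) * (indicator A w * (indicator B (?D w + z) * q (?D w + z))) \<partial>N) =
      (\<integral>\<^sup>+w. ennreal (\<rho> u w) * (indicator A w * (indicator B (?D w) * q (?D w - z))) \<partial>N)" for z
    proof -
      have hz: "(T - t) *\<^sub>R ((1 / h) *\<^sub>R z) = z" using h by (simp add: h_def)
      have e: "ennreal (exp (- (((1 / h) *\<^sub>R z) \<bullet> d + (T - t) * (norm ((1 / h) *\<^sub>R z))\<^sup>2 / 2))) * q d = q (d + z)" for d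
      proof -
        have n: "(norm (d + z))\<^sup>2 = (norm d)\<^sup>2 + 2 * (z \<bullet> d) + (norm z)\<^sup>2"
          by (simp add: power2_norm_eq_inner inner_add_left inner_add_right inner_commute)
        have "(T - t) * (norm ((1 / h) *\<^sub>R z))\<^sup>2 / 2 = (norm z)\<^sup>2 / (2 * h)"
          using h by (simp add: h_def[symmetric] power_mult_distrib power_divide power2_eq_square)
        then have "- (((1 / h) *\<^sub>R z) \<bullet> d + (T - t) * (norm ((1 / h) *\<^sub>R z))\<^sup>2 / 2) + - (norm d)\<^sup>2 / (2 * h) = - (norm (d + z))\<^sup>2 / (2 * h)"
          unfolding n using h by (simp add: field_simps)
        then show ?thesis unfolding q_def by (simp add: ennreal_mult[symmetric] exp_add[symmetric])
      qed
      have "(\<integral>\<^sup>+w. ennreal (\<rho> u w) * (indicator A w * (indicator B (?D w) * q (?D w - z))) \<partial>N) =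
        (\<integral>\<^sup>+w. ennreal (\<rho> u w) * (indicator A w * (ennreal (exp (- (((1 / h) *\<^sub>R z) \<bullet> ?D w + (T - t) * (norm ((1 / h) *\<^sub>R z))\<^sup>2 / 2)))
          * (indicator B (?D w + (T - t) *\<^sub>R ((1 / h) *\<^sub>R z)) * q (?D w + (T - t) *\<^sub>R ((1 / h) *\<^sub>R z) - z)))) \<partial>N)"
        by (rule P_shift[OF tT A, where f = "\<lambda>y. indicator B y * q (y - z)", symmetric])
           (auto simp: indicator_def q1)
      also have "\<dots> = (\<integral>\<^sup>+w. ennreal (\<rho> u w) * (indicator A w * (indicator B (?D w + z) * q (?D w + z))) \<partial>N)"
        unfolding hz
        by (intro nn_integral_cong) (simp only: add_diff_cancel_right' e[symmetric] mult.assoc mult.left_commute mult.commute)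
      finally show ?thesis ..
    qed
    interpret L: pair_sigma_finite N "lborel :: (real ^ 'n) measure" ..
    \<comment> \<open>On this side the inner integral over \<open>z\<close> is \<open>K\<close>
      whatever the increment is, so the event and \<open>B\<close> separate; on the other side it is
      \<open>c\<close>, and the joint probability remains.\<close>
    have "(\<integral>\<^sup>+z. (\<integral>\<^sup>+w. ennreal (\<rho> u w) * (indicator A w * (indicator B (?D w + z) * q (?D w + z))) \<partial>N) \<partial>lborel) =
        (\<integral>\<^sup>+w. (\<integral>\<^sup>+z. ennreal (\<rho> u w) * (indicator A w * (indicator B (?D w + z) * q (?D w + z))) \<partial>lborel) \<partial>N)"
      by (rule L.Fubini') measurable
    also have "\<dots> = (\<integral>\<^sup>+w. (ennreal (\<rho> u w) * indicator A w) * K \<partial>N)"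
    proof (rule nn_integral_cong)
      fix w
      have "(\<integral>\<^sup>+z. ennreal (\<rho> u w) * (indicator A w * (indicator B (?D w + z) * q (?D w + z))) \<partial>lborel)
        = (\<integral>\<^sup>+z. (ennreal (\<rho> u w) * indicator A w) * (indicator B (?D w + z) * q (?D w + z)) \<partial>lborel)"
        by (simp only: mult.assoc)
      also have "\<dots> = (ennreal (\<rho> u w) * indicator A w) * (\<integral>\<^sup>+z. indicator B (?D w + z) * q (?D w + z) \<partial>lborel)"
        by (rule nn_integral_cmult) measurable
      also have "(\<integral>\<^sup>+z. indicator B (?D w + z) * q (?D w + z) \<partial>lborel) = K"
        unfolding K_def by (rule nn_integral_lborel_shift[where f = "\<lambda>x. indicator B x * q x"]) measurable
      finally show "(\<integral>\<^sup>+z. ennreal (\<rho> u w) * (indicator A w * (indicator B (?D w + z) * q (?D w + z))) \<partial>lborel)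
        = (ennreal (\<rho> u w) * indicator A w) * K" .
    qed
    also have "\<dots> = (\<integral>\<^sup>+w. ennreal (\<rho> u w) * indicator A w \<partial>N) * K"
      by (rule nn_integral_multc) measurable
    also have "(\<integral>\<^sup>+w. ennreal (\<rho> u w) * indicator A w \<partial>N) = emeasure P A"
      by (simp add: P_def emeasure_density)
    finally have 1: "(\<integral>\<^sup>+z. (\<integral>\<^sup>+w. ennreal (\<rho> u w) * (indicator A w * (indicator B (?D w + z) * q (?D w + z))) \<partial>N) \<partial>lborel) =
       emeasure P A * K" .
    have "(\<integral>\<^sup>+z. (\<integral>\<^sup>+w. ennreal (\<rho> u w) * (indicator A w * (indicator B (?D w) * q (?D w - z))) \<partial>N) \<partial>lborel) =
        (\<integral>\<^sup>+w. (\<integral>\<^sup>+z. ennreal (\<rho> u w) * (indicator A w * (indicator B (?D w) * q (?D w - z))) \<partial>lborel) \<partial>N)"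
      by (rule L.Fubini') measurable
    also have "\<dots> = (\<integral>\<^sup>+w. (ennreal (\<rho> u w) * (indicator A w * indicator B (?D w))) * c \<partial>N)"
    proof (rule nn_integral_cong)
      fix w
      have "(\<integral>\<^sup>+z. ennreal (\<rho> u w) * (indicator A w * (indicator B (?D w) * q (?D w - z))) \<partial>lborel)
        = (\<integral>\<^sup>+z. (ennreal (\<rho> u w) * (indicator A w * indicator B (?D w))) * q (- ?D w + z) \<partial>lborel)"
        by (simp only: mult.assoc sym)
      also have "\<dots> = (ennreal (\<rho> u w) * (indicator A w * indicator B (?D w))) * (\<integral>\<^sup>+z. q (- ?D w + z) \<partial>lborel)"
        by (rule nn_integral_cmult) measurable
      also have "(\<integral>\<^sup>+z. q (- ?D w + z) \<partial>lborel) = c"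
        unfolding c_def by (rule nn_integral_lborel_shift) measurable
      finally show "(\<integral>\<^sup>+z. ennreal (\<rho> u w) * (indicator A w * (indicator B (?D w) * q (?D w - z))) \<partial>lborel)
        = (ennreal (\<rho> u w) * (indicator A w * indicator B (?D w))) * c" .
    qed
    also have "\<dots> = (\<integral>\<^sup>+w. ennreal (\<rho> u w) * (indicator A w * indicator B (?D w)) \<partial>N) * c"
      by (rule nn_integral_multc) measurable
    also have "(\<integral>\<^sup>+w. ennreal (\<rho> u w) * (indicator A w * indicator B (?D w)) \<partial>N) = emeasure P (A \<inter> (?D -` B \<inter> space P))"
    proof -
      have "A \<inter> (?D -` B \<inter> space N) \<in> sets N" by measurable
      then have "emeasure P (A \<inter> (?D -` B \<inter> space P)) = (\<integral>\<^sup>+w. ennreal (\<rho> u w) * indicator (A \<inter> (?D -` B \<inter> space P)) w \<partial>N)"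
        by (simp add: P_def emeasure_density)
      also have "\<dots> = (\<integral>\<^sup>+w. ennreal (\<rho> u w) * (indicator A w * indicator B (?D w)) \<partial>N)"
        by (intro nn_integral_cong) (auto simp: indicator_def)
      finally show ?thesis ..
    qed
    finally have 2: "(\<integral>\<^sup>+z. (\<integral>\<^sup>+w. ennreal (\<rho> u w) * (indicator A w * (indicator B (?D w) * q (?D w - z))) \<partial>N) \<partial>lborel) =
       emeasure P (A \<inter> (?D -` B \<inter> space P)) * c" .
    show ?thesis using 1 2 by (simp only: shift)
  qed
  have AN: "A \<in> sets N" using A canonical_subalgebra[of t] tT by (auto simp: subalgebra_def)
  have DN: "?D -` B \<inter> space N \<in> sets N" by measurable
  have top: "space P \<in> sets (F t)" using sets.top[of "F t"] by simp
  have "space P \<inter> (?D -` B \<inter> space P) = ?D -` B \<inter> space P" by auto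
  \<comment> \<open>The identity for the whole space evaluates \<open>K\<close> as \<open>c\<close>
    times the probability of \<open>B\<close>; dividing by \<open>c\<close> gives the product
    formula.\<close>
  then have K: "emeasure P (?D -` B \<inter> space P) * c = K"
    using main[OF top] P.emeasure_space_1 by simp
  have "emeasure P (A \<inter> (?D -` B \<inter> space P)) * c = emeasure P A * emeasure P (?D -` B \<inter> space P) * c"
    using main[OF A] K by (simp add: mult.assoc)
  then have "emeasure P (A \<inter> (?D -` B \<inter> space P)) = emeasure P A * emeasure P (?D -` B \<inter> space P)"
    using c unfolding mult.commute[of _ c] ennreal_mult_cancel_left by auto
  then show ?thesis
    unfolding P.emeasure_eq_measure by (simp add: ennreal_mult[symmetric] measure_nonneg)
qed

end

section \<open>Immersion of the filtration of the perturbed process\<close>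

context drift_space
begin

text \<open>Interpolates between \<open>G t\<close> and \<open>G 1\<close>: the past of
  \<open>X\<close> at \<open>t\<close> together with its values at the times in \<open>S\<close>,
  which are added one by one.\<close>

definition H where
  "H t S = sigma (space \<nu>) (sets (G t) \<union> (\<Union>s\<in>S. {(\<lambda>w. X w s) -` B \<inter> space \<nu> |B. B \<in> sets borel}))"

lemma sets_H: "sets (H t S) = sigma_sets (space \<nu>) (sets (G t) \<union> (\<Union>s\<in>S. {(\<lambda>w. X w s) -` B \<inter> space \<nu> |B. B \<in> sets borel}))"
proof -
  have "A \<subseteq> space \<nu>" if "A \<in> sets (G t)" for A using sets.sets_into_space[OF that] by simp
  then show ?thesis unfolding H_def by (intro sets_measure_of) blast
qed

lemma space_H [simp]: "space (H t S) = space \<nu>"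
  unfolding H_def by (rule space_measure_of_conv)

lemma H_least:
  assumes "space M = space \<nu>" "sets (G t) \<subseteq> sets M" "\<And>s. s \<in> S \<Longrightarrow> (\<lambda>w. X w s) \<in> borel_measurable M"
  shows "sets (H t S) \<subseteq> sets M"
proof -
  have "(\<lambda>w. X w s) -` B \<inter> space \<nu> \<in> sets M" if "s \<in> S" "B \<in> sets borel" for s B
    using measurable_sets[OF assms(3)[OF that(1)] that(2)] assms(1) by simp
  then show ?thesis
    unfolding sets_H assms(1)[symmetric]
    using assms(1,2) by (intro sets.sigma_sets_subset) auto
qed

lemma G_subset_H: "sets (G t) \<subseteq> sets (H t S)"
  unfolding sets_H by auto

lemma H_coord: "s \<in> S \<Longrightarrow> (\<lambda>w. X w s) \<in> borel_measurable (H t S)"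
proof (rule measurableI)
  fix B :: "(real ^ 'n) set" assume "s \<in> S" "B \<in> sets borel"
  then show "(\<lambda>w. X w s) -` B \<inter> space (H t S) \<in> sets (H t S)"
    unfolding space_H sets_H by (intro sigma_sets.Basic) blast
qed simp

lemma H_empty: "sets (H t {}) = sets (G t)"
  using sets.sigma_sets_eq[of "G t"] by (simp add: sets_H)

lemma H_mono: "S \<subseteq> S' \<Longrightarrow> sets (H t S) \<subseteq> sets (H t S')"
  by (intro H_least G_subset_H H_coord) auto

lemma H_subset_F:
  assumes "0 \<le> t" "t \<le> p" "p \<le> 1" "\<And>s. s \<in> S \<Longrightarrow> t \<le> s \<and> s \<le> p"
  shows "sets (H t S) \<subseteq> sets (F p)"
proof (rule H_least)
  show "sets (G t) \<subseteq> sets (F p)"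
    using G_subset_F[of t] filtration_mono[OF assms(2), of "\<lambda>w. w"] assms by auto
  show "(\<lambda>w. X w s) \<in> borel_measurable (F p)" if "s \<in> S" for s
    using assms(4)[OF that] assms by (intro X_adapted) auto
qed simp

lemma F_subalgebra_P: "t \<le> 1 \<Longrightarrow> subalgebra P (F t)"
  using canonical_subalgebra[of t] by (simp add: subalgebra_def)

lemma G_subalgebra_P: "t \<le> 1 \<Longrightarrow> subalgebra P (G t)"
  using G_subalgebra[of t] by (simp add: subalgebra_def)

lemma bounded_integrable_P:
  fixes f :: "_ \<Rightarrow> real"
  assumes "f \<in> borel_measurable N" "\<And>w. w \<in> space \<nu> \<Longrightarrow> \<bar>f w\<bar> \<le> K"
  shows "integrable P f"
  using assms by (intro P.integrable_const_bound[of _ K]) (auto intro!: AE_I2)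

text \<open>Orthogonality to the past of \<open>X\<close> at \<open>t\<close> is extended to all of
  \<open>X\<close> by adding later times in increasing order. Each new increment is independent
  under \<open>P\<close> of everything known before, including \<open>Y\<close>, so it factors out
  of the integral.\<close>

lemma orthogonal_G1:
  fixes Y :: "_ \<Rightarrow> real"
  assumes t: "0 \<le> t" "t \<le> 1" and Y: "Y \<in> borel_measurable (F t)" and K: "\<And>w. w \<in> space \<nu> \<Longrightarrow> \<bar>Y w\<bar> \<le> K"
    and orth: "\<And>D. D \<in> sets (G t) \<Longrightarrow> (\<integral>w. Y w * indicator D w \<partial>P) = 0"
    and D: "D \<in> sets (G 1)"
  shows "(\<integral>w. Y w * indicator D w \<partial>P) = 0"
proof -
  have YN: "Y \<in> borel_measurable N" by (rule canonical_imp_N[OF t(2) Y])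
  have YP: "integrable P Y" by (rule bounded_integrable_P[OF YN K])
  have step: "\<forall>D\<in>sets (H t S). (\<integral>w. Y w * indicator D w \<partial>P) = 0" if "finite S" "S \<subseteq> {t<..1}" for S
    using that
  proof (induction S rule: finite_linorder_max_induct)
    case empty then show ?case using orth by (simp add: H_empty)
  next
    case (insert m S)
    then have m: "t < m" "m \<le> 1" and S: "S \<subseteq> {t<..1}" "finite S" "\<forall>a\<in>S. a < m" by auto
    \<comment> \<open>The last time already treated, which is \<open>t\<close> itself when there is
      none.\<close>
    define p where "p = Max (Set.insert t S)"
    have pin: "p \<in> Set.insert t S" unfolding p_def using S by (intro Max_in) auto
    have pge: "s \<le> p" if "s \<in> Set.insert t S" for s unfolding p_def using S that by (intro Max_ge) auto
    have tp: "t \<le> p" using pge by auto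
    have pm: "p < m" using pin m S by auto
    have p01: "0 \<le> p" "p \<le> 1" using tp t pm m by auto
    let ?D = "\<lambda>w. X w m - X w p"
    \<comment> \<open>An earlier event intersected with an event of the new increment. These sets
      are closed under intersection, and on each of them the integral factors.\<close>
    let ?E = "{D' \<inter> (?D -` B \<inter> space P) |D' B. D' \<in> sets (H t S) \<and> B \<in> sets borel}"
    have HF: "sets (H t S) \<subseteq> sets (F p)"
      using t tp p01 pge S(1) by (intro H_subset_F) (auto intro: less_imp_le)
    have HN: "sets (H t S) \<subseteq> sets N" using HF canonical_subalgebra[of p] p01 by (auto simp: subalgebra_def)
    have DN: "?D \<in> borel_measurable N" using X_coord[of m] X_coord[of p] p01 m t by auto
    have DP: "?D \<in> measurable P borel" using DN by simp
    have EP: "D' \<inter> (?D -` B \<inter> space P) \<in> sets P" if "D' \<in> sets (H t S)" "B \<in> sets borel" for D' B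
      using HN measurable_sets[OF DP that(2)] that(1) by auto
    have UNIV_borel: "UNIV \<in> sets (borel :: (real ^ 'n) measure)" by simp
    have E_in: "D' \<inter> (?D -` B \<inter> space P) \<in> ?E" if "D' \<in> sets (H t S)" "B \<in> sets borel" for D' B
      using that by blast
    have stable: "Int_stable ?E"
    proof (rule Int_stableI)
      fix a b assume "a \<in> ?E" "b \<in> ?E"
      then obtain D1 B1 D2 B2 where *: "D1 \<in> sets (H t S)" "B1 \<in> sets borel" "D2 \<in> sets (H t S)" "B2 \<in> sets borel"
        "a = D1 \<inter> (?D -` B1 \<inter> space P)" "b = D2 \<inter> (?D -` B2 \<inter> space P)" by auto
      show "a \<inter> b \<in> ?E"
        by (rule CollectI, rule exI[of _ "D1 \<inter> D2"], rule exI[of _ "B1 \<inter> B2"]) (use * in auto)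
    qed
    have sp: "space P \<in> ?E"
      by (rule CollectI, rule exI[of _ "space P"], rule exI[of _ UNIV]) (use sets.top[of "H t S"] in auto)
    have orthE: "(\<integral>w. Y w * indicator D w \<partial>P) = 0" if "D \<in> ?E" for D
    proof -
      from that obtain D' B where DB: "D' \<in> sets (H t S)" "B \<in> sets borel" "D = D' \<inter> (?D -` B \<inter> space P)" by auto
      have D'F: "D' \<in> sets (F p)" using DB(1) HF by auto
      have D'N: "D' \<in> sets N" using DB(1) HN by auto
      have "Y \<in> borel_measurable (F p)" by (rule filtration_measurable_mono[OF Y tp])
      then have Y'F: "(\<lambda>w. Y w * indicator D' w) \<in> borel_measurable (F p)"
        using D'F by (intro borel_measurable_times borel_measurable_indicator)
      have Y'P: "integrable P (\<lambda>w. Y w * indicator D' w)"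
        using integrable_mult_indicator[OF _ YP, of D'] D'N by (simp add: mult.commute)
      have gP: "integrable P (\<lambda>w. indicat_real B (?D w))"
        using DB(2) DN by (intro bounded_integrable_P[of _ 1]) (auto simp: indicator_def)
      have "(\<integral>w. Y w * indicator D w \<partial>P) = (\<integral>w. (Y w * indicator D' w) * indicat_real B (?D w) \<partial>P)"
        unfolding DB(3) by (intro Bochner_Integration.integral_cong refl) (auto simp: indicator_def)
      also have "\<dots> = (\<integral>w. Y w * indicator D' w \<partial>P) * (\<integral>w. indicat_real B (?D w) \<partial>P)"
        by (rule P.indep_factor(2)[OF F_subalgebra_P[OF p01(2)] DP P_incr_indep[OF p01(1) pm m(2)] Y'F Y'P _ gP])
           (use DB(2) in auto)
      also have "(\<integral>w. Y w * indicator D' w \<partial>P) = 0" using insert.IH[OF S(1)] DB(1) by blast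
      finally show ?thesis by simp
    qed
    have Esub: "?E \<subseteq> P.events" using EP by blast
    \<comment> \<open>The new value is recovered as \<open>X w p\<close> plus the increment;
      \<open>X w p\<close> is available either from \<open>S\<close> or, when \<open>p = t\<close>,
      from \<open>G t\<close>.\<close>
    have gen: "sets (H t (Set.insert m S)) \<subseteq> sigma_sets (space P) ?E"
    proof -
      let ?M = "sigma (space \<nu>) ?E"
      have "?E \<subseteq> Pow (space \<nu>)" using EP sets.sets_into_space by fastforce
      then have sM: "sets ?M = sigma_sets (space P) ?E" by simp
      have spM: "space ?M = space \<nu>" by (rule space_measure_of_conv)
      have HM: "sets (H t S) \<subseteq> sets ?M"
      proof
        fix D' assume D': "D' \<in> sets (H t S)"
        then have "D' \<subseteq> space \<nu>" using sets.sets_into_space by fastforce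
        then have eq: "D' \<inter> (?D -` UNIV \<inter> space P) = D'" by auto
        have "D' \<in> ?E" by (rule E_in[OF D' UNIV_borel, unfolded eq])
        then show "D' \<in> sets ?M" unfolding sM by (rule sigma_sets.Basic)
      qed
      have Dm: "?D \<in> borel_measurable ?M"
      proof (rule measurableI)
        fix B :: "(real ^ 'n) set" assume B: "B \<in> sets borel"
        have eq: "space P \<inter> (?D -` B \<inter> space P) = ?D -` B \<inter> space ?M" unfolding spM by auto
        have "space P \<in> sets (H t S)" using sets.top[of "H t S"] by simp
        from E_in[OF this B] have "?D -` B \<inter> space ?M \<in> ?E" unfolding eq .
        then show "?D -` B \<inter> space ?M \<in> sets ?M" unfolding sM by (rule sigma_sets.Basic)
      qed simp
      have mono: "f \<in> borel_measurable ?M" if "f \<in> borel_measurable (H t S)" for f :: "_ \<Rightarrow> real ^ 'n"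
        using that HM spM by (auto simp: measurable_def)
      have coord: "(\<lambda>w. X w s) \<in> borel_measurable ?M" if "s \<in> S" for s by (rule mono[OF H_coord[OF that]])
      have Xp: "(\<lambda>w. X w p) \<in> borel_measurable ?M"
      proof (cases "p \<in> S")
        case False
        then have "p = t" using pin by simp
        have "(\<lambda>w. X w t) \<in> borel_measurable (G t)" by (rule filtration_coord) (use t in auto)
        then have "(\<lambda>w. X w t) \<in> borel_measurable (H t S)" using G_subset_H[of t S] by (auto simp: measurable_def)
        then have "(\<lambda>w. X w p) \<in> borel_measurable (H t S)" using \<open>p = t\<close> by (simp only:)
        then show ?thesis by (rule mono)
      qed (rule coord)
      have Xm: "(\<lambda>w. X w m) \<in> borel_measurable ?M"
        using borel_measurable_add[OF Dm Xp] by simp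
      have "sets (H t (Set.insert m S)) \<subseteq> sets ?M"
      proof (rule H_least)
        show "space ?M = space \<nu>" by (rule spM)
        show "sets (G t) \<subseteq> sets ?M" using G_subset_H[of t S] HM by blast
        show "(\<lambda>w. X w s) \<in> borel_measurable ?M" if "s \<in> Set.insert m S" for s
          using that coord Xm by blast
      qed
      then show ?thesis unfolding sM .
    qed
    show ?case
    proof
      fix D assume "D \<in> sets (H t (Set.insert m S))"
      then have "D \<in> sigma_sets (space P) ?E" using gen by blast
      then show "(\<integral>w. Y w * indicator D w \<partial>P) = 0"
        by - (rule P.orthogonal_sigma_sets[OF stable Esub sp YP orthE])
    qed
  qed
  \<comment> \<open>The union over finite sets of times is closed under intersection because two
    such sets have a common finite superset; it contains the generators of
    \<open>G 1\<close>.\<close>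
  let ?U = "\<Union>S\<in>{S. finite S \<and> S \<subseteq> {t<..1}}. sets (H t S)"
  have HN: "sets (H t S) \<subseteq> sets N" if "S \<subseteq> {t<..1}" for S
    using H_subset_F[of t 1 S] t that canonical_subalgebra[of 1] by (force simp: subalgebra_def)
  have "Int_stable ?U"
  proof (rule Int_stableI)
    fix a b assume "a \<in> ?U" "b \<in> ?U"
    then obtain S1 S2 where *: "finite S1" "S1 \<subseteq> {t<..1}" "a \<in> sets (H t S1)" "finite S2" "S2 \<subseteq> {t<..1}" "b \<in> sets (H t S2)" by blast
    then have "a \<in> sets (H t (S1 \<union> S2))" "b \<in> sets (H t (S1 \<union> S2))"
      using H_mono[of S1 "S1 \<union> S2" t] H_mono[of S2 "S1 \<union> S2" t] by blast+
    then have "a \<inter> b \<in> sets (H t (S1 \<union> S2))" by blast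
    with * show "a \<inter> b \<in> ?U" by blast
  qed
  moreover have "?U \<subseteq> P.events" using HN by auto
  moreover have "space P \<in> ?U" using sets.top[of "H t {}"] by (intro UN_I[of "{}"]) auto
  moreover have "(\<integral>w. Y w * indicator D w \<partial>P) = 0" if "D \<in> ?U" for D using step that by blast
  moreover have "D \<in> sigma_sets (space P) ?U"
  proof -
    let ?M = "sigma (space \<nu>) ?U"
    have "?U \<subseteq> Pow (space \<nu>)" using HN sets.sets_into_space by fastforce
    then have sM: "sets ?M = sigma_sets (space P) ?U" by simp
    have spM: "space ?M = space \<nu>" by (rule space_measure_of_conv)
    have HM: "sets (H t S) \<subseteq> sets ?M" if "finite S" "S \<subseteq> {t<..1}" for S
      unfolding sM using that by (intro subsetI sigma_sets.Basic) blast
    have GM: "sets (G t) \<subseteq> sets ?M" using HM[of "{}"] by (simp add: H_empty)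
    have "sets (G 1) \<subseteq> sets ?M"
    proof (rule filtration_least)
      show "null_sets N \<subseteq> sets ?M" using GM filtration_null[of X t] by blast
      fix s :: real assume s: "s \<in> {0..1}"
      show "(\<lambda>w. X w s) \<in> borel_measurable ?M"
      proof (cases "s \<le> t")
        case True
        then have "(\<lambda>w. X w s) \<in> borel_measurable (G t)" using s by (intro filtration_coord) auto
        then show ?thesis using GM spM by (auto simp: measurable_def)
      next
        case False
        have "(\<lambda>w. X w s) \<in> borel_measurable (H t {s})" by (rule H_coord) simp
        then show ?thesis using HM[of "{s}"] False s spM by (auto simp: measurable_def)
      qed
    qed (rule spM)
    then show ?thesis using D unfolding sM by blast
  qed
  ultimately show ?thesis by (rule P.orthogonal_sigma_sets[OF _ _ _ YP])
qed

section \<open>Transfer of orthogonality from \<open>P\<close> back to \<nu>\<close>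

context
  assumes rho_G: "\<rho> u \<in> borel_measurable (G 1)"
begin

text \<open>Integrating \<open>Y * Z\<close> under \<nu> is integrating
  \<open>Y * (Z / \<rho> u)\<close> under \<open>P\<close>. By \<open>rho_G\<close> the quotient is
  still a function of \<open>X\<close>, and \<open>Y\<close> has conditional expectation zero given
  \<open>X\<close> under \<open>P\<close>.\<close>

lemma orthogonal_transfer:
  fixes Y Z :: "_ \<Rightarrow> real"
  assumes t: "0 \<le> t" "t \<le> 1" and Y: "Y \<in> borel_measurable (F t)" and K: "\<And>w. w \<in> space \<nu> \<Longrightarrow> \<bar>Y w\<bar> \<le> K"
    and orth: "\<And>D. D \<in> sets (G t) \<Longrightarrow> (\<integral>w. Y w * indicator D w \<partial>P) = 0"
    and Z: "Z \<in> borel_measurable (G 1)" "integrable N Z"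
  shows "(\<integral>w. Y w * Z w \<partial>N) = 0"
proof -
  have YN[measurable]: "Y \<in> borel_measurable N" by (rule canonical_imp_N[OF t(2) Y])
  have YP: "integrable P Y" by (rule bounded_integrable_P[OF YN K])
  have ZN[measurable]: "Z \<in> borel_measurable N" using Z(2) by auto
  interpret G1: sigma_finite_subalgebra P "G 1"
    by (intro finite_measure_subalgebra_is_sigma_finite finite_measure_subalgebra.intro
      finite_measure_subalgebra_axioms.intro G_subalgebra_P P.finite_measure_axioms order_refl)
  have ce: "AE w in P. real_cond_exp P (G 1) Y w = 0"
  proof (rule G1.real_cond_exp_charact)
    fix D assume "D \<in> sets (G 1)"
    then have "(\<integral>w. Y w * indicator D w \<partial>P) = 0" by - (rule orthogonal_G1[OF t Y K orth])
    then show "(\<integral>w\<in>D. Y w \<partial>P) = (\<integral>w\<in>D. 0 \<partial>P)" by (simp add: set_lebesgue_integral_def mult.commute)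
  qed (use YP in auto)
  let ?Z = "\<lambda>w. Z w / \<rho> u w"
  have ZG: "?Z \<in> borel_measurable (G 1)" by (intro borel_measurable_divide Z rho_G)
  have r0: "\<rho> u w \<noteq> 0" for w using rho_pos[of u w] by simp
  have YZ: "integrable N (\<lambda>w. Z w * Y w)" by (rule bound_mult_integrable[OF Z(2) YN K])
  have int: "integrable P (\<lambda>w. ?Z w * Y w)"
    by (subst integrable_P) (use YZ r0 in \<open>simp_all add: field_simps\<close>)
  have "(\<integral>w. Y w * Z w \<partial>N) = (\<integral>w. ?Z w * Y w \<partial>P)"
    by (subst integral_P) (use r0 in \<open>simp_all add: field_simps\<close>)
  also have "\<dots> = (\<integral>w. ?Z w * real_cond_exp P (G 1) Y w \<partial>P)"
    by (rule G1.real_cond_exp_intg(2)[symmetric, OF int ZG]) simp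
  also have "\<dots> = (\<integral>w. 0 \<partial>P)"
  proof (rule integral_cong_AE)
    show "AE w in P. ?Z w * real_cond_exp P (G 1) Y w = 0" using ce by eventually_elim simp
    have "?Z \<in> borel_measurable P" by simp
    then show "(\<lambda>w. ?Z w * real_cond_exp P (G 1) Y w) \<in> borel_measurable P"
      by (intro borel_measurable_times) auto
  qed simp
  finally show ?thesis by simp
qed

end

end

section \<open>Adaptedness of the drift to the perturbed process\<close>

text \<open>Tested with the sign of \<open>f - g\<close>, the assumption says that the absolute
  difference has integral zero.\<close>

lemma AE_eqI_integral:
  fixes f g :: "'a \<Rightarrow> real"
  assumes f: "integrable M f" and g: "integrable M g" and m: "subalgebra M G"
    and fG: "f \<in> borel_measurable G" and gG: "g \<in> borel_measurable G"
    and eq: "\<And>Y. Y \<in> borel_measurable G \<Longrightarrow> (\<And>x. \<bar>Y x\<bar> \<le> 1) \<Longrightarrow> (\<integral>x. Y x * f x \<partial>M) = (\<integral>x. Y x * g x \<partial>M)"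
  shows "AE x in M. f x = g x"
proof -
  let ?Y = "\<lambda>x. sgn (f x - g x)"
  have Ym: "?Y \<in> borel_measurable G" using fG gG by measurable
  have Yb: "\<bar>?Y x\<bar> \<le> 1" for x by (simp add: sgn_real_def)
  have YM: "?Y \<in> borel_measurable M" by (rule measurable_from_subalg[OF m Ym])
  have i: "integrable M (\<lambda>x. ?Y x * h x)" if h: "integrable M h" for h
  proof (rule Bochner_Integration.integrable_bound[OF h])
    show "(\<lambda>x. ?Y x * h x) \<in> borel_measurable M" using YM h by (intro borel_measurable_times) auto
    show "AE x in M. norm (?Y x * h x) \<le> norm (h x)"
      using Yb by (intro AE_I2) (simp add: abs_mult mult_left_le_one_le)
  qed
  have "\<bar>f x - g x\<bar> = ?Y x * f x - ?Y x * g x" for x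
    by (simp add: sgn_real_def abs_if)
  then have "(\<integral>x. \<bar>f x - g x\<bar> \<partial>M) = (\<integral>x. ?Y x * f x \<partial>M) - (\<integral>x. ?Y x * g x \<partial>M)"
    by (simp only: Bochner_Integration.integral_diff[OF i[OF f] i[OF g]])
  also have "\<dots> = 0" using eq[OF Ym Yb] by simp
  finally have "AE x in M. \<bar>f x - g x\<bar> = 0"
    using f g by (subst (asm) integral_nonneg_eq_0_iff_AE) auto
  then show ?thesis by eventually_elim simp
qed

context drift_space
begin

context
  assumes rho_G: "\<rho> u \<in> borel_measurable (G 1)"
begin

text \<open>\<open>D\<close> is an everywhere bounded copy of the increment of \<open>u\<close> and
  \<open>b\<close> its conditional expectation given \<open>F t\<close>. As the increment of
  \<open>\<beta>\<close> is centred, \<open>b\<close> is also that of the increment of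
  \<open>X\<close>, for which immersion allows \<open>F t\<close> to be replaced by
  \<open>G t\<close>.\<close>

lemma bounded_increment:
  assumes d: "bdrift u du C" and tT: "0 \<le> t" "t < T" "T \<le> 1"
  obtains D b where "D \<in> borel_measurable (F T)" "\<And>w. \<bar>D w\<bar> \<le> C * (T - t)"
    "AE w in N. D w = (u w T - u w t) $ j"
    "b \<in> borel_measurable (F t)" "b \<in> borel_measurable (G 1)" "\<And>w. \<bar>b w\<bar> \<le> C * (T - t)"
    "\<And>Y. Y \<in> borel_measurable (F t) \<Longrightarrow> integrable N Y \<Longrightarrow> (\<integral>w. Y w * D w \<partial>N) = (\<integral>w. Y w * b w \<partial>N)"
proof -
  let ?K = "C * (T - t)"
  have K: "0 \<le> ?K" using bdriftD(6)[OF d] tT by simp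
  have I: "t \<in> {0..1}" "T \<in> {0..1}" and t1: "t \<le> 1" using tT by auto
  define D where "D w = (if \<bar>(u w T - u w t) $ j\<bar> \<le> ?K then (u w T - u w t) $ j else 0)" for w
  have uT: "(\<lambda>w. u w T - u w t) \<in> borel_measurable (F T)"
    using u_adapted[OF I(2)] filtration_measurable_mono[OF u_adapted[OF I(1)] less_imp_le[OF tT(2)]]
    by (rule borel_measurable_diff)
  note [measurable] = borel_measurable_component[OF uT]
  have DF: "D \<in> borel_measurable (F T)" unfolding D_def by measurable
  have DN: "D \<in> borel_measurable N" by (rule canonical_imp_N[OF tT(3) DF])
  have Db: "\<bar>D w\<bar> \<le> ?K" for w using K by (simp add: D_def)
  have Dae: "AE w in N. D w = (u w T - u w t) $ j"
    using bdrift_incr_bound[OF d tT(1) less_imp_le[OF tT(2)] tT(3)]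
  proof eventually_elim
    case (elim w)
    then show ?case using component_le_norm_cart[of "u w T - u w t" j] by (simp add: D_def)
  qed
  have Di: "integrable N D" by (rule bounded_integrable[OF DN, of ?K]) (simp add: Db)
  obtain b where b: "b \<in> borel_measurable (F t)" "\<And>w. \<bar>b w\<bar> \<le> ?K"
    "\<And>Y. Y \<in> borel_measurable (F t) \<Longrightarrow> integrable N Y \<Longrightarrow> (\<integral>w. Y w * D w \<partial>N) = (\<integral>w. Y w * b w \<partial>N)"
    using N.bounded_cond_exp[OF canonical_subalgebra[OF t1] DN Db K] by blast
  have bi: "integrable N b"
    by (rule bounded_integrable[OF canonical_imp_N[OF t1 b(1)], of ?K]) (simp add: b(2))
  let ?Z = "\<lambda>w. (X w T - X w t) $ j"
  have ZG: "?Z \<in> borel_measurable (G 1)"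
    using filtration_coord[of T 1 X] filtration_coord[of t 1 X] I
    by (intro borel_measurable_component borel_measurable_diff) auto
  have ZN: "?Z \<in> borel_measurable N" by (rule measurable_from_subalg[OF G_subalgebra[OF order_refl] ZG])
  have bmean: "integrable N (\<lambda>w. (\<beta> w T - \<beta> w t) $ j)"
    using beta_incr_mean(1)[OF tT(1) less_imp_le[OF tT(2)] tT(3)] .
  have Zae: "AE w in N. ?Z w = (\<beta> w T - \<beta> w t) $ j + D w"
    using Dae by eventually_elim (use I in \<open>simp add: X_val\<close>)
  have Zi: "integrable N ?Z"
  proof (rule integrable_cong_AE_imp[OF Bochner_Integration.integrable_add[OF bmean Di] ZN])
    show "AE w in N. (\<beta> w T - \<beta> w t) $ j + D w = ?Z w" using Zae by eventually_elim simp
  qed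
  \<comment> \<open>The increments of \<open>X\<close> and \<open>u\<close> differ by a martingale
    increment, which is invisible to test variables known at \<open>t\<close>.\<close>
  have YZ: "(\<integral>w. Y w * ?Z w \<partial>N) = (\<integral>w. Y w * D w \<partial>N)"
    if Y: "Y \<in> borel_measurable (F t)" "\<And>w. \<bar>Y w\<bar> \<le> 1" for Y
  proof -
    have YN: "Y \<in> borel_measurable N" by (rule canonical_imp_N[OF t1 Y(1)])
    have Yi: "integrable N Y" by (rule bounded_integrable[OF YN, of 1]) (simp add: Y(2))
    have i2: "integrable N (\<lambda>w. D w * Y w)" by (rule bound_mult_integrable[OF Di YN, of 1]) (simp add: Y(2))
    note m = beta_incr_mart[OF tT(1) less_imp_le[OF tT(2)] tT(3) Y(1) Yi, of j]
    have "(\<integral>w. Y w * ?Z w \<partial>N) = (\<integral>w. Y w * (\<beta> w T - \<beta> w t) $ j + D w * Y w \<partial>N)"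
    proof (rule integral_cong_AE)
      show "AE w in N. Y w * ?Z w = Y w * (\<beta> w T - \<beta> w t) $ j + D w * Y w"
        using Zae by eventually_elim (simp only: distrib_left mult.commute[of "D _"])
    qed (use YN ZN m(1) i2 in auto)
    also have "\<dots> = (\<integral>w. Y w * D w \<partial>N)"
      using m i2 by (simp add: mult.commute[of "D _"])
    finally show ?thesis .
  qed
  interpret Gt: sigma_finite_subalgebra N "G t"
    by (rule filtration_sigma_finite[OF X_meas t1])
  let ?CZ = "real_cond_exp N (G t) ?Z"
  have Z0G: "?CZ \<in> borel_measurable (G t)" by simp
  have Z0i: "integrable N ?CZ" by (rule Gt.real_cond_exp_int(1)[OF Zi])
  have Z0G1: "?CZ \<in> borel_measurable (G 1)" by (rule filtration_measurable_mono[OF Z0G t1])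
  have Z0F: "?CZ \<in> borel_measurable (F t)"
    using Z0G G_subset_F[OF t1] by (auto simp: measurable_def)
  have key: "(\<integral>w. Y w * ?Z w \<partial>N) = (\<integral>w. Y w * ?CZ w \<partial>N)"
    if Y: "Y \<in> borel_measurable (F t)" "\<And>w. \<bar>Y w\<bar> \<le> 1" for Y
  proof -
    have YN: "Y \<in> borel_measurable N" by (rule canonical_imp_N[OF t1 Y(1)])
    then have YPm: "Y \<in> borel_measurable P" by simp
    \<comment> \<open>\<open>Y\<close> is projected onto \<open>G t\<close> under \<open>P\<close>,
      whereas \<open>?CZ\<close> is a projection under \<nu>. Replacing \<open>Y\<close> by
      \<open>a\<close> is legitimate under \<nu> against any integrable function of
      \<open>X\<close>; both \<open>?Z\<close> and \<open>?CZ\<close> are such functions, and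
      against \<open>a\<close> they agree.\<close>
    obtain a where a: "a \<in> borel_measurable (G t)" "\<And>w. \<bar>a w\<bar> \<le> 1"
      "\<And>g. g \<in> borel_measurable (G t) \<Longrightarrow> integrable P g \<Longrightarrow> (\<integral>w. g w * Y w \<partial>P) = (\<integral>w. g w * a w \<partial>P)"
      using P.bounded_cond_exp[OF G_subalgebra_P[OF t1] YPm Y(2) zero_le_one] by blast
    have aN: "a \<in> borel_measurable N" by (rule measurable_from_subalg[OF G_subalgebra[OF t1] a(1)])
    have aF: "a \<in> borel_measurable (F t)" using a(1) G_subset_F[OF t1] by (auto simp: measurable_def)
    let ?Y = "\<lambda>w. Y w - a w"
    have YF: "?Y \<in> borel_measurable (F t)" by (rule borel_measurable_diff[OF Y(1) aF])
    have Yb: "\<bar>?Y w\<bar> \<le> 2" for w using Y(2)[of w] a(2)[of w] by linarith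
    have orth: "(\<integral>w. ?Y w * indicator D w \<partial>P) = 0" if D: "D \<in> sets (G t)" for D
    proof -
      have DN: "D \<in> sets N" using D G_subalgebra[OF t1] by (auto simp: subalgebra_def)
      have iP: "integrable P (indicat_real D)"
        by (rule bounded_integrable_P[of _ 1]) (use DN in \<open>auto simp: indicator_def\<close>)
      have i1: "integrable P (\<lambda>w. indicator D w * Y w)"
        using YN DN Y(2) by (intro bounded_integrable_P[of _ 1]) (auto simp: indicator_def)
      have i2: "integrable P (\<lambda>w. indicator D w * a w)"
        using aN DN a(2) by (intro bounded_integrable_P[of _ 1]) (auto simp: indicator_def)
      have "(\<integral>w. ?Y w * indicator D w \<partial>P) = (\<integral>w. indicator D w * Y w - indicator D w * a w \<partial>P)"
        by (intro Bochner_Integration.integral_cong refl) (simp add: algebra_simps)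
      also have "\<dots> = 0"
        using a(3)[OF borel_measurable_indicator[OF D] iP] by (simp only: Bochner_Integration.integral_diff[OF i1 i2])
      finally show ?thesis .
    qed
    have tr: "(\<integral>w. ?Y w * Z w \<partial>N) = 0" if "Z \<in> borel_measurable (G 1)" "integrable N Z" for Z
      by (rule orthogonal_transfer[OF rho_G tT(1) t1 YF Yb orth that])
    have split: "(\<integral>w. Y w * Z w \<partial>N) = (\<integral>w. a w * Z w \<partial>N)"
      if Z: "Z \<in> borel_measurable (G 1)" "integrable N Z" for Z
    proof -
      have j1: "integrable N (\<lambda>w. Y w * Z w)"
        using bound_mult_integrable[OF Z(2) YN Y(2)] by (simp add: mult.commute)
      have j2: "integrable N (\<lambda>w. a w * Z w)"
        using bound_mult_integrable[OF Z(2) aN a(2)] by (simp add: mult.commute)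
      have "(\<integral>w. Y w * Z w \<partial>N) - (\<integral>w. a w * Z w \<partial>N) = (\<integral>w. ?Y w * Z w \<partial>N)"
        unfolding left_diff_distrib by (rule Bochner_Integration.integral_diff[OF j1 j2, symmetric])
      then show ?thesis using tr[OF Z] by simp
    qed
    have aZ: "integrable N (\<lambda>w. a w * ?Z w)"
      using bound_mult_integrable[OF Zi aN a(2)] by (simp add: mult.commute)
    have "(\<integral>w. Y w * ?Z w \<partial>N) = (\<integral>w. a w * ?Z w \<partial>N)" by (rule split[OF ZG Zi])
    also have "\<dots> = (\<integral>w. a w * ?CZ w \<partial>N)"
      by (rule Gt.real_cond_exp_intg(2)[symmetric, OF aZ a(1) ZN])
    also have "\<dots> = (\<integral>w. Y w * ?CZ w \<partial>N)" by (rule split[OF Z0G1 Z0i, symmetric])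
    finally show ?thesis .
  qed
  \<comment> \<open>Both sides are \<open>F t\<close>-measurable with the same integrals against
    bounded test variables, so \<open>b\<close> inherits the measurability of \<open>?CZ\<close>
    with respect to \<open>X\<close>.\<close>
  have "AE w in N. ?CZ w = b w"
  proof (rule AE_eqI_integral[OF Z0i bi canonical_subalgebra[OF t1] Z0F b(1)])
    fix Y assume Y: "Y \<in> borel_measurable (F t)" "\<And>w. \<bar>Y w\<bar> \<le> (1::real)"
    have Yi: "integrable N Y" by (rule bounded_integrable[OF canonical_imp_N[OF t1 Y(1)], of 1]) (simp add: Y(2))
    show "(\<integral>w. Y w * ?CZ w \<partial>N) = (\<integral>w. Y w * b w \<partial>N)"
      using key[OF Y] YZ[OF Y] b(3)[OF Y(1) Yi] by simp
  qed
  then have bG: "b \<in> borel_measurable (G 1)"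
    by (intro filtration_cong[OF Z0G1]) (simp add: AE_completion_iff)
  show ?thesis by (rule that[OF DF Db Dae b(1) bG b(2,3)])
qed

lemma bounded_prod_integrable:
  fixes f g :: "_ \<Rightarrow> real"
  assumes "f \<in> borel_measurable N" "g \<in> borel_measurable N" "\<And>w. \<bar>f w\<bar> \<le> K" "\<And>w. \<bar>g w\<bar> \<le> L"
  shows "integrable N (\<lambda>w. f w * g w)"
proof (rule bound_mult_integrable[OF _ assms(2)])
  show "integrable N f" by (rule bounded_integrable[OF assms(1), of K]) (simp add: assms(3))
  show "\<bar>g w\<bar> \<le> L" for w by (rule assms(4))
qed

text \<open>\<open>B\<close> is the sum of the conditional expectations of the increments of \<open>u\<close>.\<close>

lemma drift_approx:
  assumes d: "bdrift u du C" and t: "0 < t" "t \<le> 1" and n: "0 < n"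
  shows "\<exists>B K. B \<in> borel_measurable (G 1) \<and> (\<forall>w. \<bar>B w\<bar> \<le> K) \<and>
    (\<exists>S. S \<in> borel_measurable N \<and> (\<forall>w. \<bar>S w\<bar> \<le> 2 * K) \<and> (AE w in N. S w = (u w t - u w 0) $ j - B w) \<and>
      (\<integral>w. (S w)\<^sup>2 \<partial>N) \<le> 4 * C\<^sup>2 / real n)"
proof -
  note C = bdriftD(6)[OF d]
  define h where "h = t / real n"
  have h: "0 < h" using t n by (simp add: h_def)
  have hn: "real n * h = t" using n by (simp add: h_def)
  \<comment> \<open>\<open>S\<close> is a bounded copy of the error after \<open>k\<close> steps.
    The new term \<open>D - b\<close> has size at most \<open>2 * (C * h)\<close> and is orthogonal
    to \<open>S\<close>, which is known when the step begins, so the second moment grows by at most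
    \<open>4 * (C * h)\<^sup>2\<close>; with \<open>h = t / n\<close> the \<open>n\<close> steps
    cost only order \<open>1 / n\<close>.\<close>
  have claim: "\<exists>S B. S \<in> borel_measurable (F (real k * h)) \<and> B \<in> borel_measurable (G 1) \<and>
      (\<forall>w. \<bar>B w\<bar> \<le> C * (real k * h)) \<and> (\<forall>w. \<bar>S w\<bar> \<le> 2 * (C * (real k * h))) \<and>
      (AE w in N. S w = (u w (real k * h) - u w 0) $ j - B w) \<and>
      (\<integral>w. (S w)\<^sup>2 \<partial>N) \<le> real k * (4 * (C * h)\<^sup>2)" if "k \<le> n" for k
    using that
  proof (induction k)
    case 0
    show ?case by (rule exI[of _ "\<lambda>_. 0"], rule exI[of _ "\<lambda>_. 0"]) simp
  next
    case (Suc k)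
    let ?t = "real k * h" and ?T = "real (Suc k) * h"
    from Suc obtain S B where S: "S \<in> borel_measurable (F ?t)" and B: "B \<in> borel_measurable (G 1)"
      and Bb: "\<And>w. \<bar>B w\<bar> \<le> C * ?t" and Sb: "\<And>w. \<bar>S w\<bar> \<le> 2 * (C * ?t)"
      and Sae: "AE w in N. S w = (u w ?t - u w 0) $ j - B w"
      and S2: "(\<integral>w. (S w)\<^sup>2 \<partial>N) \<le> real k * (4 * (C * h)\<^sup>2)" by auto
    have Th: "?T - ?t = h" by (simp add: algebra_simps)
    have T1: "?T \<le> 1"
    proof -
      have "?T \<le> real n * h" using Suc.prems h by (intro mult_right_mono) auto
      then show ?thesis using hn t by simp
    qed
    have t0: "0 \<le> ?t" and tT: "?t < ?T" and t1: "?t \<le> 1" using h T1 by (auto simp: algebra_simps)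
    from bounded_increment[OF d t0 tT T1, of j] obtain D b where
      D: "D \<in> borel_measurable (F ?T)" and Db: "\<And>w. \<bar>D w\<bar> \<le> C * (?T - ?t)"
      and Dae: "AE w in N. D w = (u w ?T - u w ?t) $ j"
      and b: "b \<in> borel_measurable (F ?t)" and bG: "b \<in> borel_measurable (G 1)" and bb: "\<And>w. \<bar>b w\<bar> \<le> C * (?T - ?t)"
      and orth: "\<And>Y. Y \<in> borel_measurable (F ?t) \<Longrightarrow> integrable N Y \<Longrightarrow> (\<integral>w. Y w * D w \<partial>N) = (\<integral>w. Y w * b w \<partial>N)"
      by blast
    let ?E = "\<lambda>w. D w - b w"
    have SN: "S \<in> borel_measurable N" by (rule canonical_imp_N[OF t1 S])
    have DN: "D \<in> borel_measurable N" by (rule canonical_imp_N[OF T1 D])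
    have bN: "b \<in> borel_measurable N" by (rule canonical_imp_N[OF t1 b])
    have EN: "?E \<in> borel_measurable N" by (rule borel_measurable_diff[OF DN bN])
    have Eb: "\<bar>?E w\<bar> \<le> 2 * (C * h)" for w using Db[of w] bb[of w] unfolding Th by linarith
    have Si: "integrable N S" by (rule bounded_integrable[OF SN, of "2 * (C * ?t)"]) (simp only: real_norm_def Sb)
    have SD: "integrable N (\<lambda>w. S w * D w)" by (rule bounded_prod_integrable[OF SN DN Sb Db])
    have Sb': "integrable N (\<lambda>w. S w * b w)" by (rule bounded_prod_integrable[OF SN bN Sb bb])
    have SS: "integrable N (\<lambda>w. S w * S w)" by (rule bounded_prod_integrable[OF SN SN Sb Sb])
    have EE: "integrable N (\<lambda>w. ?E w * ?E w)" by (rule bounded_prod_integrable[OF EN EN Eb Eb])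
    have SE: "integrable N (\<lambda>w. S w * ?E w)" by (rule bounded_prod_integrable[OF SN EN Sb Eb])
    have SE0: "(\<integral>w. S w * ?E w \<partial>N) = 0"
      unfolding right_diff_distrib Bochner_Integration.integral_diff[OF SD Sb'] using orth[OF S Si] by simp
    have E2: "(\<integral>w. ?E w * ?E w \<partial>N) \<le> 4 * (C * h)\<^sup>2"
    proof -
      have "?E w * ?E w \<le> 4 * (C * h)\<^sup>2" for w
      proof -
        have "\<bar>?E w\<bar> * \<bar>?E w\<bar> \<le> (2 * (C * h)) * (2 * (C * h))" using Eb[of w] by (intro mult_mono) auto
        then show ?thesis by (simp add: power2_eq_square)
      qed
      then have "(\<integral>w. ?E w * ?E w \<partial>N) \<le> (\<integral>w. 4 * (C * h)\<^sup>2 \<partial>N)" by (intro integral_mono EE) auto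
      then show ?thesis by (simp add: prob_space)
    qed
    have "(\<integral>w. (S w + ?E w)\<^sup>2 \<partial>N) = (\<integral>w. S w * S w + 2 * (S w * ?E w) + ?E w * ?E w \<partial>N)"
      by (intro Bochner_Integration.integral_cong refl) (simp add: power2_eq_square algebra_simps)
    also have "\<dots> = (\<integral>w. S w * S w \<partial>N) + (\<integral>w. ?E w * ?E w \<partial>N)"
    proof -
      have i: "integrable N (\<lambda>w. 2 * (S w * ?E w))" by (rule integrable_mult_right[OF SE])
      show ?thesis
        unfolding Bochner_Integration.integral_add[OF Bochner_Integration.integrable_add[OF SS i] EE]
          Bochner_Integration.integral_add[OF SS i] integral_mult_right_zero SE0 by simp
    qed
    also have "\<dots> \<le> real (Suc k) * (4 * (C * h)\<^sup>2)"
      using S2 E2 by (simp add: power2_eq_square[of "S _"] algebra_simps)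
    finally have fin: "(\<integral>w. (S w + ?E w)\<^sup>2 \<partial>N) \<le> real (Suc k) * (4 * (C * h)\<^sup>2)" .
    have CT: "C * ?T = C * ?t + C * h" by (simp add: algebra_simps)
    show ?case
    proof (rule exI[of _ "\<lambda>w. S w + ?E w"], rule exI[of _ "\<lambda>w. B w + b w"], intro conjI allI fin)
      have 1: "S \<in> borel_measurable (F ?T)" "b \<in> borel_measurable (F ?T)"
        by (rule filtration_measurable_mono[OF S less_imp_le[OF tT]], rule filtration_measurable_mono[OF b less_imp_le[OF tT]])
      show "(\<lambda>w. S w + ?E w) \<in> borel_measurable (F ?T)" by (intro borel_measurable_add borel_measurable_diff 1 D)
      show "(\<lambda>w. B w + b w) \<in> borel_measurable (G 1)" by (rule borel_measurable_add[OF B bG])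
      show "\<bar>B w + b w\<bar> \<le> C * ?T" for w using Bb[of w] bb[of w] unfolding CT Th by linarith
      show "\<bar>S w + ?E w\<bar> \<le> 2 * (C * ?T)" for w
        using abs_triangle_ineq[of "S w" "?E w"] Sb[of w] Eb[of w] unfolding CT distrib_left by linarith
      show "AE w in N. S w + ?E w = (u w ?T - u w 0) $ j - (B w + b w)"
        using Sae Dae by eventually_elim simp
    qed
  qed
  from claim[of n] obtain S B where S: "S \<in> borel_measurable (F t)" and B: "B \<in> borel_measurable (G 1)"
    and *: "\<forall>w. \<bar>B w\<bar> \<le> C * t" "\<forall>w. \<bar>S w\<bar> \<le> 2 * (C * t)"
      "AE w in N. S w = (u w t - u w 0) $ j - B w" and S2: "(\<integral>w. (S w)\<^sup>2 \<partial>N) \<le> real n * (4 * (C * h)\<^sup>2)"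
    unfolding hn by auto
  have "real n * (4 * (C * h)\<^sup>2) = 4 * C\<^sup>2 * t\<^sup>2 / real n"
    using n by (simp add: h_def power2_eq_square field_simps)
  also have "\<dots> \<le> 4 * C\<^sup>2 / real n"
  proof (intro divide_right_mono)
    have "t\<^sup>2 \<le> 1" using t by (intro power_le_one) auto
    then show "4 * C\<^sup>2 * t\<^sup>2 \<le> 4 * C\<^sup>2" by (intro mult_left_le) auto
  qed simp
  finally have "(\<integral>w. (S w)\<^sup>2 \<partial>N) \<le> 4 * C\<^sup>2 / real n" using S2 by simp
  moreover have "S \<in> borel_measurable N" by (rule canonical_imp_N[OF t(2) S])
  ultimately show ?thesis using B * by blast
qed

text \<open>Let \<open>g\<close> be the projection of a bounded copy \<open>f\<close> of the
  component onto \<open>G 1\<close>. For every approximation \<open>B\<close> the difference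
  \<open>g - B\<close> is orthogonal to \<open>f - g\<close>, so by Pythagoras \<open>f - g\<close>
  is no larger in mean square than the error in \<open>drift_approx\<close>, which tends to
  zero.\<close>

lemma drift_G1:
  assumes t: "t \<in> {0..1}"
  shows "(\<lambda>w. u w t) \<in> borel_measurable (G 1)"
proof (rule borel_measurable_vecI)
  fix j
  obtain du C where d: "bdrift u du C" using u by (rule bounded_driftsE)
  note C = bdriftD(6)[OF d]
  have u0: "AE w in N. u w 0 = 0"
  proof -
    have "AE s in unit_leb. s \<noteq> 0"
    proof -
      have "AE s in lborel. s \<noteq> (0::real)" by (rule AE_lborel_singleton)
      then show ?thesis unfolding unit_leb_def by (subst AE_restrict_space_iff) (auto elim: eventually_mono)
    qed
    then have "AE s in unit_leb. indicator {0..0} s *\<^sub>R du w s = 0" for w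
      by eventually_elim simp
    then have z: "(\<integral>s. indicator {0..0} s *\<^sub>R du w s \<partial>unit_leb) = 0" for w
      by (rule integral_eq_zero_AE)
    have "AE w in N. u w 0 = (\<integral>s. indicator {0..0} s *\<^sub>R du w s \<partial>unit_leb)"
      by (rule bdrift_value[OF d]) simp
    then show ?thesis unfolding z .
  qed
  show "(\<lambda>w. u w t $ j) \<in> borel_measurable (G 1)"
  proof (cases "t = 0")
    case True
    have "AE w in \<nu>. 0 = u w t $ j" using u0 unfolding AE_completion_iff by eventually_elim (simp add: True)
    from filtration_cong[OF _ this, of X 1] show ?thesis by simp
  next
    case False
    then have t0: "0 < t" and t1: "t \<le> 1" using t by auto
    \<comment> \<open>The constant \<open>C\<close> is a valid bound because \<open>u w\<close>
      starts at 0 almost surely, is Lipschitz with constant \<open>C\<close>, and \<open>t\<close>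
      is at most 1.\<close>
    define f where "f w = (if \<bar>u w t $ j\<bar> \<le> C then u w t $ j else 0)" for w
    note [measurable] = borel_measurable_component[OF measurable_path_coord[OF u_path t]]
    have fN: "f \<in> borel_measurable N" unfolding f_def by measurable
    have fb: "\<bar>f w\<bar> \<le> C" for w using C by (simp add: f_def)
    have fae: "AE w in N. f w = u w t $ j"
      using bdrift_incr_bound[OF d order_refl less_imp_le[OF t0] t1] u0
    proof eventually_elim
      case (elim w)
      have "C * (t - 0) \<le> C" using C t1 t0 by (simp add: mult_left_le)
      then have "\<bar>u w t $ j\<bar> \<le> C"
        using elim component_le_norm_cart[of "u w t" j] by simp
      then show ?case by (simp add: f_def)
    qed
    obtain g where g: "g \<in> borel_measurable (G 1)" "\<And>w. \<bar>g w\<bar> \<le> C"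
      "\<And>Y. Y \<in> borel_measurable (G 1) \<Longrightarrow> integrable N Y \<Longrightarrow> (\<integral>w. Y w * f w \<partial>N) = (\<integral>w. Y w * g w \<partial>N)"
      using N.bounded_cond_exp[OF G_subalgebra[OF order_refl] fN fb C] by blast
    have gN: "g \<in> borel_measurable N" by (rule measurable_from_subalg[OF G_subalgebra[OF order_refl] g(1)])
    let ?e = "\<lambda>w. f w - g w"
    have eN: "?e \<in> borel_measurable N" by (rule borel_measurable_diff[OF fN gN])
    have eb: "\<bar>?e w\<bar> \<le> 2 * C" for w using fb[of w] g(2)[of w] by linarith
    have ee: "integrable N (\<lambda>w. ?e w * ?e w)" by (rule bounded_prod_integrable[OF eN eN eb eb])
    have le: "(\<integral>w. ?e w * ?e w \<partial>N) \<le> 4 * C\<^sup>2 / real n" if n: "0 < n" for n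
    proof -
      from drift_approx[OF d t0 t1 n, of j] obtain B K S where B: "B \<in> borel_measurable (G 1)" and Bb: "\<And>w. \<bar>B w\<bar> \<le> K"
        and S: "S \<in> borel_measurable N" "\<And>w. \<bar>S w\<bar> \<le> 2 * K" "AE w in N. S w = (u w t - u w 0) $ j - B w"
        and S2: "(\<integral>w. (S w)\<^sup>2 \<partial>N) \<le> 4 * C\<^sup>2 / real n" by blast
      have BN: "B \<in> borel_measurable N" by (rule measurable_from_subalg[OF G_subalgebra[OF order_refl] B])
      let ?k = "\<lambda>w. g w - B w"
      have kG: "?k \<in> borel_measurable (G 1)" by (rule borel_measurable_diff[OF g(1) B])
      have kN: "?k \<in> borel_measurable N" by (rule borel_measurable_diff[OF gN BN])
      have kb: "\<bar>?k w\<bar> \<le> C + K" for w using g(2)[of w] Bb[of w] by linarith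
      have kk: "integrable N (\<lambda>w. ?k w * ?k w)" by (rule bounded_prod_integrable[OF kN kN kb kb])
      have kf: "integrable N (\<lambda>w. ?k w * f w)" by (rule bounded_prod_integrable[OF kN fN kb fb])
      have kg: "integrable N (\<lambda>w. ?k w * g w)" by (rule bounded_prod_integrable[OF kN gN kb g(2)])
      have ke: "integrable N (\<lambda>w. ?k w * ?e w)" by (rule bounded_prod_integrable[OF kN eN kb eb])
      have ki: "integrable N ?k" by (rule bounded_integrable[OF kN, of "C + K"]) (simp only: real_norm_def kb)
      have ke0: "(\<integral>w. ?k w * ?e w \<partial>N) = 0"
        unfolding right_diff_distrib[of "?k _"] Bochner_Integration.integral_diff[OF kf kg] using g(3)[OF kG ki] by simp
      have "(\<integral>w. (S w)\<^sup>2 \<partial>N) = (\<integral>w. ?e w * ?e w + 2 * (?k w * ?e w) + ?k w * ?k w \<partial>N)"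
      proof (rule integral_cong_AE)
        show "AE w in N. (S w)\<^sup>2 = ?e w * ?e w + 2 * (?k w * ?e w) + ?k w * ?k w"
          using S(3) fae u0
        proof eventually_elim
          case (elim w)
          then have "S w = ?e w + ?k w" by simp
          then show ?case by (simp only: power2_eq_square) (simp add: algebra_simps)
        qed
        show "(\<lambda>w. (S w)\<^sup>2) \<in> borel_measurable N" using S(1) by measurable
        show "(\<lambda>w. ?e w * ?e w + 2 * (?k w * ?e w) + ?k w * ?k w) \<in> borel_measurable N"
          using fN gN BN by measurable
      qed
      also have "\<dots> = (\<integral>w. ?e w * ?e w \<partial>N) + (\<integral>w. ?k w * ?k w \<partial>N)"
      proof -
        have i: "integrable N (\<lambda>w. 2 * (?k w * ?e w))" by (rule integrable_mult_right[OF ke])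
        show ?thesis
          unfolding Bochner_Integration.integral_add[OF Bochner_Integration.integrable_add[OF ee i] kk]
            Bochner_Integration.integral_add[OF ee i] integral_mult_right_zero ke0 by simp
      qed
      finally have "(\<integral>w. ?e w * ?e w \<partial>N) \<le> (\<integral>w. (S w)\<^sup>2 \<partial>N)"
        using integral_nonneg_AE[of "\<lambda>w. ?k w * ?k w" N] by simp
      then show ?thesis using S2 by simp
    qed
    have "(\<integral>w. ?e w * ?e w \<partial>N) \<le> 0"
    proof (rule LIMSEQ_le_const)
      show "(\<lambda>n. 4 * C\<^sup>2 * inverse (real (Suc n))) \<longlonglongrightarrow> 0"
        using tendsto_mult[OF tendsto_const LIMSEQ_inverse_real_of_nat] by (metis mult_zero_right)
      show "\<exists>n0. \<forall>n\<ge>n0. (\<integral>w. ?e w * ?e w \<partial>N) \<le> 4 * C\<^sup>2 * inverse (real (Suc n))"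
        using le[of "Suc _"] by (simp add: divide_inverse)
    qed
    then have "(\<integral>w. ?e w * ?e w \<partial>N) = 0" by (intro antisym integral_nonneg_AE) auto
    then have "AE w in N. ?e w * ?e w = 0" by (subst (asm) integral_nonneg_eq_0_iff_AE[OF ee]) auto
    then have "AE w in \<nu>. g w = u w t $ j" using fae unfolding AE_completion_iff by eventually_elim simp
    from filtration_cong[OF g(1) this] show ?thesis .
  qed
qed

text \<open>With \<open>u\<close> a function of \<open>X\<close>, so is
  \<open>\<beta> = X - u\<close>, and at time 1 the completed filtration of \<open>\<beta>\<close>
  is that of the path.\<close>

lemma F1_subset_G1: "sets (F 1) \<subseteq> sets (G 1)"
proof -
  have "sets (completed_filtration \<nu> \<beta> 1) \<subseteq> sets (G 1)"
  proof (rule filtration_least)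
    fix s :: real assume s: "s \<in> {0..1}"
    have "(\<lambda>w. X w s) \<in> borel_measurable (G 1)" by (rule filtration_coord) (use s in auto)
    from borel_measurable_diff[OF this drift_G1[OF s]]
    show "(\<lambda>w. \<beta> w s) \<in> borel_measurable (G 1)" using s by (simp add: X_val)
  qed (simp_all add: filtration_null)
  then show ?thesis using filtration_eq[of 1] by simp
qed

end

end

section \<open>Entropy\<close>

lemma completion_set_AE:
  assumes "A \<in> sets (completion M)"
  shows "\<exists>B\<in>sets M. AE x in M. x \<in> A \<longleftrightarrow> x \<in> B"
proof -
  from assms obtain S N N' where *: "A = S \<union> N" "N \<subseteq> N'" "N' \<in> null_sets M" "S \<in> sets M"
    by (rule sets_completionE)
  from AE_not_in[OF *(3)] have "AE x in M. x \<in> A \<longleftrightarrow> x \<in> S"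
    by eventually_elim (use * in auto)
  with *(4) show ?thesis by blast
qed

lemma exp_eq_one_plus:
  assumes "exp x = 1 + (x :: real)"
  shows "x = 0"
proof -
  have "ln (exp x) = exp x - 1" using ln_exp[of x] assms by linarith
  from ln_eq_minus_one[OF exp_gt_zero this] show ?thesis by simp
qed

section \<open>The entropy identity and its equality case\<close>

context drift_space
begin

abbreviation "U \<equiv> W u"
abbreviation "\<theta> \<equiv> image_law N U"

lemma U_path: "U \<in> measurable N path_space"
  by (rule W_meas[OF u])

lemma U_nu: "U \<in> measurable N \<nu>"
  using U_path sets_nu by (simp cong: measurable_cong_sets)

lemma U_space: "w \<in> space \<nu> \<Longrightarrow> U w \<in> space \<nu>"
  using measurable_space[OF U_path, of w] by (simp add: space_nu)

lemma sets_theta: "sets \<theta> = sets \<nu>"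
  by (simp add: image_law_def sets_nu)

lemma nn_integral_theta:
  assumes "k \<in> borel_measurable \<nu>"
  shows "(\<integral>\<^sup>+x. k x \<partial>\<theta>) = (\<integral>\<^sup>+w. k (U w) \<partial>N)"
proof -
  have "k \<in> borel_measurable path_space" using assms sets_nu by (simp cong: measurable_cong_sets)
  then show ?thesis unfolding image_law_def by (subst nn_integral_distr[OF U_path]) simp_all
qed

lemma null_theta_iff:
  assumes E: "E \<in> sets \<nu>"
  shows "E \<in> null_sets \<theta> \<longleftrightarrow> E \<in> null_sets \<nu>"
proof -
  have Em: "E \<in> sets \<theta>" using E by (simp add: sets_theta)
  have "E \<in> null_sets \<theta> \<longleftrightarrow> (AE x in \<theta>. x \<notin> E)"
    using Em by (simp add: AE_iff_null_sets)
  also have "\<dots> \<longleftrightarrow> (AE w in N. U w \<notin> E)"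
    unfolding image_law_def using E sets_nu by (intro AE_distr_iff[OF U_path]) auto
  also have "\<dots> \<longleftrightarrow> (AE w in N. w \<notin> E)" by (rule W_null[OF u E])
  also have "\<dots> \<longleftrightarrow> E \<in> null_sets \<nu>" using E by (simp add: AE_completion_iff AE_iff_null_sets)
  finally show ?thesis .
qed

lemma ac_theta: "absolutely_continuous \<nu> \<theta>" "absolutely_continuous \<theta> \<nu>"
proof -
  show "absolutely_continuous \<nu> \<theta>" unfolding absolutely_continuous_def
    using null_theta_iff by blast
  show "absolutely_continuous \<theta> \<nu>" unfolding absolutely_continuous_def
  proof
    fix E assume E: "E \<in> null_sets \<theta>"
    then have "E \<in> sets \<nu>" using sets_theta by auto
    with E show "E \<in> null_sets \<nu>" using null_theta_iff by blast
  qed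
qed

lemma prob_space_theta: "prob_space \<theta>"
  unfolding image_law_def by (rule N.prob_space_distr[OF U_path])

text \<open>The conversion to a real loses nothing almost everywhere: the derivative is finite
  there, as recorded in \<open>RN_L\<close>.\<close>

definition "L x = enn2real (RN_deriv \<nu> \<theta> x)"

lemma L_meas [measurable]: "L \<in> borel_measurable \<nu>"
  unfolding L_def[abs_def] by measurable

lemma RN_theta: "density \<nu> (RN_deriv \<nu> \<theta>) = \<theta>"
  by (rule density_RN_deriv[OF ac_theta(1) sets_theta])

lemma RN_L: "AE x in \<nu>. RN_deriv \<nu> \<theta> x = ennreal (L x)"
proof -
  interpret T: prob_space \<theta> by (rule prob_space_theta)
  have "AE x in \<nu>. RN_deriv \<nu> \<theta> x \<noteq> \<infinity>"
    by (rule RN_deriv_finite[OF T.sigma_finite_measure_axioms ac_theta(1) sets_theta])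
  then show ?thesis by eventually_elim (simp add: L_def less_top)
qed

lemma theta_L:
  assumes k: "k \<in> borel_measurable \<nu>"
  shows "(\<integral>\<^sup>+w. k (U w) \<partial>N) = (\<integral>\<^sup>+x. ennreal (L x) * k x \<partial>\<nu>)"
proof -
  have "(\<integral>\<^sup>+w. k (U w) \<partial>N) = (\<integral>\<^sup>+x. k x \<partial>density \<nu> (RN_deriv \<nu> \<theta>))"
    unfolding RN_theta by (rule nn_integral_theta[OF k, symmetric])
  also have "\<dots> = (\<integral>\<^sup>+x. RN_deriv \<nu> \<theta> x * k x \<partial>\<nu>)" by (rule nn_integral_density[OF _ k]) simp
  also have "\<dots> = (\<integral>\<^sup>+x. ennreal (L x) * k x \<partial>\<nu>)"
    by (rule nn_integral_cong_AE) (use RN_L in eventually_elim, simp)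
  finally show ?thesis .
qed

lemma L_nonneg: "0 \<le> L x" by (simp add: L_def)

text \<open>The law of \<open>U\<close> has density \<open>L\<close>, so it does not charge the
  zeros of \<open>L\<close>. The logarithm along \<open>U\<close> is thus taken of positive
  numbers.\<close>

lemma L_U_pos: "AE w in N. 0 < L (U w)"
proof -
  let ?E = "{x \<in> space \<nu>. L x = 0}"
  have E: "?E \<in> sets \<nu>" by measurable
  have "(\<integral>\<^sup>+w. indicator ?E (U w) \<partial>N) = (\<integral>\<^sup>+x. ennreal (L x) * indicator ?E x \<partial>\<nu>)"
    by (rule theta_L[OF borel_measurable_indicator[OF E]])
  also have "\<dots> = (\<integral>\<^sup>+x. 0 \<partial>\<nu>)" by (intro nn_integral_cong) (auto simp: indicator_def)
  finally have "(\<integral>\<^sup>+w. indicator ?E (U w) \<partial>N) = 0" by simp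
  then have "AE w in N. (indicator ?E (U w) :: ennreal) = 0"
    by (subst (asm) nn_integral_0_iff_AE[OF measurable_compose[OF U_nu borel_measurable_indicator[OF E]]])
  then show ?thesis using AE_space
  proof eventually_elim
    case (elim w)
    then have "L (U w) \<noteq> 0" using U_space[of w] by (auto simp: indicator_def)
    then show ?case using L_nonneg[of "U w"] by simp
  qed
qed

text \<open>\<open>log_L\<close> and \<open>neg_log_rho\<close> are the variables \<open>K\<close>
  and \<open>R\<close> of the overview.\<close>

definition "log_L w = ln (L (U w))"
definition "neg_log_rho w = ito_delta \<nu> \<beta> u w + cm_norm_sq (u w) / 2"

lemma LU_meas [measurable]: "(\<lambda>w. L (U w)) \<in> borel_measurable N"
  by (rule measurable_compose[OF U_nu L_meas])

lemma log_L_meas [measurable]: "log_L \<in> borel_measurable N"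
  unfolding log_L_def[abs_def] by measurable

lemma neg_log_rho_int: "integrable N neg_log_rho" "(\<integral>w. neg_log_rho w \<partial>N) = 1 / 2 * (\<integral>w. cm_norm_sq (u w) \<partial>N)"
proof -
  have i: "integrable N (\<lambda>w. cm_norm_sq (u w) / 2)" using cm_norm_sq_meas(2)[OF u] by simp
  note a = ito_delta_mean[OF u]
  show "integrable N neg_log_rho" unfolding neg_log_rho_def[abs_def] by (rule Bochner_Integration.integrable_add[OF a(1) i])
  show "(\<integral>w. neg_log_rho w \<partial>N) = 1 / 2 * (\<integral>w. cm_norm_sq (u w) \<partial>N)"
    unfolding neg_log_rho_def Bochner_Integration.integral_add[OF a(1) i] a(2) by simp
qed

lemma rho_eq_exp: "\<rho> u w = exp (- neg_log_rho w)"
  by (simp add: girsanov_density_def neg_log_rho_def)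

lemma exp_log_L: "AE w in N. exp (log_L w - neg_log_rho w) = \<rho> u w * L (U w)"
  using L_U_pos by eventually_elim (simp add: rho_eq_exp log_L_def exp_diff exp_minus field_simps)

text \<open>The factor \<open>L\<close> in \<open>L * ln L\<close> turns integration under \<nu>
  into integration along \<open>U\<close>. Positive and negative parts are moved separately, since
  integrability is unknown at this point.\<close>

lemma rel_entropy_log_L:
  "rel_entropy \<theta> \<nu> = enn2ereal (\<integral>\<^sup>+w. ennreal (log_L w) \<partial>N) - enn2ereal (\<integral>\<^sup>+w. ennreal (- log_L w) \<partial>N)"
proof -
  have "(\<integral>\<^sup>+x. ennreal (L x * ln (L x)) \<partial>\<nu>) = (\<integral>\<^sup>+x. ennreal (L x) * ennreal (ln (L x)) \<partial>\<nu>)"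
    by (simp only: ennreal_mult'[OF L_nonneg])
  also have "\<dots> = (\<integral>\<^sup>+w. ennreal (log_L w) \<partial>N)"
    unfolding log_L_def by (rule theta_L[symmetric]) measurable
  finally have 1: "(\<integral>\<^sup>+x. ennreal (L x * ln (L x)) \<partial>\<nu>) = (\<integral>\<^sup>+w. ennreal (log_L w) \<partial>N)" .
  have "- (L x * ln (L x)) = L x * (- ln (L x))" for x by simp
  then have "(\<integral>\<^sup>+x. ennreal (- (L x * ln (L x))) \<partial>\<nu>) = (\<integral>\<^sup>+x. ennreal (L x) * ennreal (- ln (L x)) \<partial>\<nu>)"
    by (simp only: ennreal_mult'[OF L_nonneg])
  also have "\<dots> = (\<integral>\<^sup>+w. ennreal (- log_L w) \<partial>N)"
    unfolding log_L_def by (rule theta_L[symmetric]) measurable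
  finally have 2: "(\<integral>\<^sup>+x. ennreal (- (L x * ln (L x))) \<partial>\<nu>) = (\<integral>\<^sup>+w. ennreal (- log_L w) \<partial>N)" .
  show ?thesis unfolding rel_entropy_def Let_def L_def[symmetric] 1 2 ..
qed

text \<open>By (iii), weighting with \<open>\<rho> u\<close> turns the law of \<open>U\<close> into
  \<nu>, under which \<open>L\<close> has integral 1.\<close>

lemma rho_LU_mass: "(\<integral>\<^sup>+w. ennreal (\<rho> u w * L (U w)) \<partial>N) = 1"
proof -
  have "(\<integral>\<^sup>+w. ennreal (\<rho> u w * L (U w)) \<partial>N) = (\<integral>\<^sup>+w. ennreal (\<rho> u w) * ennreal (L (U w)) \<partial>N)"
    using rho_pos[of u] by (simp only: ennreal_mult'[OF less_imp_le])
  also have "\<dots> = (\<integral>\<^sup>+x. ennreal (L x) \<partial>N)" by (rule W_nn_integral[OF u]) measurable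
  also have "\<dots> = (\<integral>\<^sup>+x. ennreal (L x) * 1 \<partial>\<nu>)" by (simp add: nn_integral_completion)
  also have "\<dots> = (\<integral>\<^sup>+w. 1 \<partial>N)" by (rule theta_L[symmetric]) simp
  finally show ?thesis by (simp add: emeasure_space_1)
qed

lemma integral_eq_ereal_parts:
  fixes f :: "'a \<Rightarrow> real"
  assumes "integrable M f"
  shows "enn2ereal (\<integral>\<^sup>+x. ennreal (f x) \<partial>M) - enn2ereal (\<integral>\<^sup>+x. ennreal (- f x) \<partial>M) = ereal (\<integral>x. f x \<partial>M)"
proof -
  have fin: "(\<integral>\<^sup>+x. ennreal (f x) \<partial>M) \<noteq> \<infinity>" "(\<integral>\<^sup>+x. ennreal (- f x) \<partial>M) \<noteq> \<infinity>"
    using assms by (auto simp: real_integrable_def)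
  obtain a b where ab: "0 \<le> a" "(\<integral>\<^sup>+x. ennreal (f x) \<partial>M) = ennreal a"
    "0 \<le> b" "(\<integral>\<^sup>+x. ennreal (- f x) \<partial>M) = ennreal b"
    using fin by (metis ennreal_cases infinity_ennreal_def)
  then show ?thesis
    using real_lebesgue_integral_def[OF assms] by (simp add: enn2ereal_ennreal)
qed

lemma entropy_iff:
  "rel_entropy \<theta> \<nu> = ereal (1 / 2 * (\<integral>w. cm_norm_sq (u w) \<partial>N)) \<longleftrightarrow> (AE w in N. log_L w = neg_log_rho w)"
proof
  assume ae: "AE w in N. log_L w = neg_log_rho w"
  have "(\<integral>\<^sup>+w. ennreal (log_L w) \<partial>N) = (\<integral>\<^sup>+w. ennreal (neg_log_rho w) \<partial>N)"
    "(\<integral>\<^sup>+w. ennreal (- log_L w) \<partial>N) = (\<integral>\<^sup>+w. ennreal (- neg_log_rho w) \<partial>N)"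
    by (rule nn_integral_cong_AE, use ae in eventually_elim, simp)+
  then show "rel_entropy \<theta> \<nu> = ereal (1 / 2 * (\<integral>w. cm_norm_sq (u w) \<partial>N))"
    unfolding rel_entropy_log_L using integral_eq_ereal_parts[OF neg_log_rho_int(1)] by (simp add: neg_log_rho_int(2))
next
  assume eq: "rel_entropy \<theta> \<nu> = ereal (1 / 2 * (\<integral>w. cm_norm_sq (u w) \<partial>N))"
  let ?p = "\<integral>\<^sup>+w. ennreal (log_L w) \<partial>N" and ?n = "\<integral>\<^sup>+w. ennreal (- log_L w) \<partial>N"
  have diff: "enn2ereal ?p - enn2ereal ?n = ereal (1 / 2 * (\<integral>w. cm_norm_sq (u w) \<partial>N))"
    using eq unfolding rel_entropy_log_L .
  \<comment> \<open>In \<open>ereal\<close> a difference with an infinite member is never a real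
    number, so the assumed value forces \<open>log_L\<close> to be integrable.\<close>
  have pn: "?p \<noteq> \<infinity>" "?n \<noteq> \<infinity>"
    using diff by (cases ?p; cases ?n; auto simp: enn2ereal_ennreal)+
  then have Ki: "integrable N log_L" by (auto simp: real_integrable_def)
  have EK: "(\<integral>w. log_L w \<partial>N) = (\<integral>w. neg_log_rho w \<partial>N)"
    using integral_eq_ereal_parts[OF Ki] diff neg_log_rho_int(2) by simp
  let ?x = "\<lambda>w. log_L w - neg_log_rho w"
  have xi: "integrable N ?x" by (rule Bochner_Integration.integrable_diff[OF Ki neg_log_rho_int(1)])
  have x0: "(\<integral>w. ?x w \<partial>N) = 0" by (simp add: Bochner_Integration.integral_diff[OF Ki neg_log_rho_int(1)] EK)
  have nnexp: "(\<integral>\<^sup>+w. ennreal (exp (?x w)) \<partial>N) = 1"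
  proof -
    have "(\<integral>\<^sup>+w. ennreal (exp (?x w)) \<partial>N) = (\<integral>\<^sup>+w. ennreal (\<rho> u w * L (U w)) \<partial>N)"
      by (rule nn_integral_cong_AE) (use exp_log_L in eventually_elim, simp)
    then show ?thesis by (simp add: rho_LU_mass)
  qed
  have xm: "?x \<in> borel_measurable N" using xi by auto
  have ei: "integrable N (\<lambda>w. exp (?x w))"
    using xm nnexp by (intro integrableI_nonneg) auto
  have e1: "(\<integral>w. exp (?x w) \<partial>N) = 1"
    using nnexp xm by (subst integral_eq_nn_integral) auto
  \<comment> \<open>Its mean is 1 - 1 - 0. Being nonnegative it vanishes almost surely, and
    \<open>exp x - 1 - x\<close> vanishes only at 0.\<close>
  let ?g = "\<lambda>w. exp (?x w) - 1 - ?x w"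
  have ei1: "integrable N (\<lambda>w. exp (?x w) - 1)"
    by (rule Bochner_Integration.integrable_diff[OF ei N.integrable_const])
  have gi: "integrable N ?g" by (rule Bochner_Integration.integrable_diff[OF ei1 xi])
  have "(\<integral>w. ?g w \<partial>N) = 0"
    unfolding Bochner_Integration.integral_diff[OF ei1 xi] x0
      Bochner_Integration.integral_diff[OF ei N.integrable_const] e1 by (simp add: prob_space)
  moreover have gnn: "0 \<le> ?g w" for w using exp_ge_add_one_self[of "?x w"] by linarith
  ultimately have "AE w in N. ?g w = 0"
    using integral_nonneg_eq_0_iff_AE[OF gi] by auto
  then show "AE w in N. log_L w = neg_log_rho w"
  proof eventually_elim
    case (elim w)
    then have "?x w = 0" by (intro exp_eq_one_plus) simp
    then show ?case by simp
  qed
qed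

lemma invertible_imp_log_L:
  assumes inv: "as_invertible \<nu> U"
  shows "AE w in N. log_L w = neg_log_rho w"
proof -
  from inv obtain V where V: "V \<in> measurable N path_space" "AE w in \<nu>. V (U w) = w"
    unfolding as_invertible_def by blast
  let ?Z = "\<lambda>w. ennreal (\<rho> u w * L (U w))"
  have Zm: "?Z \<in> borel_measurable N" by measurable
  have main: "(\<integral>\<^sup>+w. ?Z w * indicator A w \<partial>N) = (\<integral>\<^sup>+w. indicator A w \<partial>N)" if A: "A \<in> sets N" for A
  proof -
    from completion_set_AE[OF A] obtain A' where A': "A' \<in> sets \<nu>" "AE w in \<nu>. w \<in> A \<longleftrightarrow> w \<in> A'" by blast
    \<comment> \<open>The inverse pulls \<open>A'\<close> back to an event whose preimage under
      \<open>U\<close> is \<open>A\<close> up to a null set. As \<open>V\<close> is measurable only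
      for the completion, a version \<open>B\<close> in \<open>sets \<nu>\<close> is taken, and
      \<open>W_AE\<close> carries the exceptional set through \<open>U\<close>.\<close>
    have "V -` A' \<inter> space N \<in> sets N" using A' sets_nu by (intro measurable_sets[OF V(1)]) auto
    from completion_set_AE[OF this] obtain B where B: "B \<in> sets \<nu>" "AE w in \<nu>. w \<in> V -` A' \<inter> space N \<longleftrightarrow> w \<in> B" by blast
    have ae: "AE w in N. (indicator A w :: ennreal) = indicator B (U w)"
      using W_AE[OF u B(2)] A'(2) V(2) AE_space unfolding AE_completion_iff
    proof eventually_elim
      case (elim w)
      have "U w \<in> space N" using elim(4) U_space by simp
      with elim have "w \<in> A \<longleftrightarrow> U w \<in> B" by simp
      then show ?case by (simp add: indicator_def)
    qed
    have Bm: "(indicator B :: _ \<Rightarrow> ennreal) \<in> borel_measurable \<nu>" by (rule borel_measurable_indicator[OF B(1)])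
    have "(\<integral>\<^sup>+w. ?Z w * indicator A w \<partial>N) = (\<integral>\<^sup>+w. ennreal (\<rho> u w) * (ennreal (L (U w)) * indicator B (U w)) \<partial>N)"
    proof (rule nn_integral_cong_AE)
      show "AE w in N. ?Z w * indicator A w = ennreal (\<rho> u w) * (ennreal (L (U w)) * indicator B (U w))"
        using ae by eventually_elim (simp only: ennreal_mult'[OF less_imp_le[OF rho_pos]] mult.assoc)
    qed
    also have "\<dots> = (\<integral>\<^sup>+x. ennreal (L x) * indicator B x \<partial>N)"
      by (rule W_nn_integral[OF u, where h = "\<lambda>x. ennreal (L x) * indicator B x"]) (use Bm in measurable)
    also have "\<dots> = (\<integral>\<^sup>+w. indicator B (U w) \<partial>N)"
      unfolding nn_integral_completion theta_L[OF Bm, unfolded nn_integral_completion] ..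
    also have "\<dots> = (\<integral>\<^sup>+w. indicator A w \<partial>N)"
      by (rule nn_integral_cong_AE) (use ae in eventually_elim, simp)
    finally show ?thesis .
  qed
  \<comment> \<open>Equal integrals over all events identify the densities, so \<open>?Z\<close> is
    1 almost surely.\<close>
  have "density N ?Z = density N (\<lambda>_. 1)"
  proof (rule measure_eqI)
    fix A assume "A \<in> sets (density N ?Z)"
    then have A: "A \<in> sets N" by simp
    show "emeasure (density N ?Z) A = emeasure (density N (\<lambda>_. 1)) A"
      using main[OF A] A Zm by (simp add: emeasure_density)
  qed simp
  then have "AE w in N. ?Z w = 1"
    by (intro N.density_unique[OF Zm]) auto
  then show ?thesis using exp_log_L
  proof eventually_elim
    case (elim w)
    then have "exp (log_L w - neg_log_rho w) = 1" by simp
    then show ?case by simp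
  qed
qed

section \<open>Construction of the inverse\<close>

lemma preimage_null:
  assumes E: "E \<in> null_sets N"
  shows "U -` E \<inter> space \<nu> \<in> null_sets N"
proof -
  have "AE w in \<nu>. w \<notin> E" using AE_not_in[OF E] by (simp add: AE_completion_iff)
  from W_AE[OF u this] have "AE w in \<nu>. U w \<notin> E" by (simp add: AE_completion_iff)
  then obtain M where "M \<in> null_sets \<nu>" "{w \<in> space \<nu>. \<not> U w \<notin> E} \<subseteq> M" by (auto simp: eventually_ae_filter)
  then show ?thesis unfolding null_sets_completion_iff2 by blast
qed

lemma beta_U: "AE w in \<nu>. \<beta> (U w) = X w"
  using beta_W[OF u] by eventually_elim (simp add: X_def)

text \<open>It is enough to treat generators: coordinates of \<open>\<beta>\<close> pull back under
  \<open>U\<close> to coordinates of \<open>X\<close> almost surely, and null sets pull back to null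
  sets because the law of \<open>U\<close> is equivalent to \<nu>.\<close>

lemma preimage_G1:
  assumes A: "A \<in> sets (F 1)"
  shows "U -` A \<inter> space \<nu> \<in> sets (G 1)"
proof -
  have "A \<in> sigma_sets (space \<nu>) (past_events \<nu> \<beta> 1 \<union> null_sets N)"
    using A filtration_eq[of 1] by (simp add: sets_filtration)
  then show ?thesis
  proof induction
    case (Basic a)
    show ?case
    proof (cases "a \<in> null_sets N")
      case True
      then show ?thesis using preimage_null filtration_null by blast
    next
      case False
      with Basic obtain s C where s: "s \<in> {0..1}" and C: "C \<in> sets borel" and a: "a = (\<lambda>w. \<beta> w s) -` C \<inter> space \<nu>"
        by (auto simp: past_events_def)
      have "(\<lambda>w. X w s) \<in> borel_measurable (G 1)" by (rule filtration_coord) (use s in auto)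
      moreover have "AE w in \<nu>. X w s = \<beta> (U w) s" using beta_U by eventually_elim simp
      ultimately have "(\<lambda>w. \<beta> (U w) s) \<in> borel_measurable (G 1)" by (rule filtration_cong)
      from measurable_sets[OF this C] have "(\<lambda>w. \<beta> (U w) s) -` C \<inter> space \<nu> \<in> sets (G 1)" by simp
      moreover have "U -` a \<inter> space \<nu> = (\<lambda>w. \<beta> (U w) s) -` C \<inter> space \<nu>"
        using U_space by (auto simp: a)
      ultimately show ?thesis by simp
    qed
  next
    case Empty show ?case by simp
  next
    case (Compl a)
    have "U -` (space \<nu> - a) \<inter> space \<nu> = space (G 1) - (U -` a \<inter> space \<nu>)" using U_space by auto
    then show ?case using sets.compl_sets[OF Compl.IH] by simp
  next
    case (Union a)
    have eq: "U -` (\<Union>i. a i) \<inter> space \<nu> = (\<Union>i. U -` a i \<inter> space \<nu>)" by auto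
    show ?case unfolding eq by (intro sets.countable_UN) (use Union.IH in auto)
  qed
qed

lemma sets_nu_F1: "sets \<nu> \<subseteq> sets (F 1)"
proof
  fix A assume A: "A \<in> sets \<nu>"
  have "(\<lambda>w. w) \<in> measurable (F 1) path_space"
    unfolding measurable_path_space_iff
    by (intro conjI ballI filtration_coord) (auto simp: space_nu)
  from measurable_sets[OF this, of A] A sets.sets_into_space[OF A] show "A \<in> sets (F 1)"
    by (simp add: sets_nu Int_absorb2)
qed

text \<open>Equality of the logarithms says that \<open>\<rho> u\<close> is the reciprocal of
  \<open>L (U w)\<close>, a function of \<open>U\<close>, hence of \<open>X\<close> up to null
  sets.\<close>

lemma log_L_imp_rho_G1:
  assumes "AE w in N. log_L w = neg_log_rho w"
  shows "\<rho> u \<in> borel_measurable (G 1)"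
proof -
  have "U \<in> measurable (G 1) \<nu>"
  proof (rule measurableI)
    fix A assume "A \<in> sets \<nu>"
    then show "U -` A \<inter> space (G 1) \<in> sets (G 1)" using preimage_G1 sets_nu_F1 by auto
  qed (use U_space in auto)
  from measurable_compose[OF this L_meas] have m: "(\<lambda>w. 1 / L (U w)) \<in> borel_measurable (G 1)" by simp
  have "AE w in N. 1 / L (U w) = \<rho> u w"
    using assms exp_log_L L_U_pos
  proof eventually_elim
    case (elim w)
    then have "\<rho> u w * L (U w) = 1" by simp
    then show ?case using elim(3) by (simp add: field_simps)
  qed
  then have "AE w in \<nu>. 1 / L (U w) = \<rho> u w" by (simp only: AE_completion_iff)
  from filtration_cong[OF m this] show ?thesis .
qed

text \<open>The counterpart of \<open>preimage_G1\<close>: a coordinate of \<open>X\<close> is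
  almost surely a coordinate of \<open>\<beta>\<close> evaluated at \<open>U\<close>, so generating
  events are preimages under \<open>U\<close>, and such events are stable under complements and
  countable unions.\<close>

lemma G1_factor:
  assumes A: "A \<in> sets (G 1)"
  shows "\<exists>B\<in>sets \<nu>. AE w in N. w \<in> A \<longleftrightarrow> U w \<in> B"
proof -
  have "A \<in> sigma_sets (space \<nu>) (past_events \<nu> X 1 \<union> null_sets N)"
    using A by (simp add: sets_filtration)
  then show ?thesis
  proof induction
    case (Basic a)
    show ?case
    proof (cases "a \<in> null_sets N")
      case True
      from AE_not_in[OF True] show ?thesis by (intro bexI[of _ "{}"]) auto
    next
      case False
      with Basic obtain s C where s: "s \<in> {0..1}" and C: "C \<in> sets borel" and a: "a = (\<lambda>w. X w s) -` C \<inter> space \<nu>"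
        by (auto simp: past_events_def)
      have "(\<lambda>w. \<beta> w s) -` C \<inter> space N \<in> sets N" by (rule measurable_sets[OF beta_coord[OF s] C])
      from completion_set_AE[OF this] obtain B where B: "B \<in> sets \<nu>" "AE w in \<nu>. w \<in> (\<lambda>w. \<beta> w s) -` C \<inter> space N \<longleftrightarrow> w \<in> B" by blast
      have "AE w in N. w \<in> a \<longleftrightarrow> U w \<in> B"
        using W_AE[OF u B(2)] beta_U AE_space unfolding AE_completion_iff
      proof eventually_elim
        case (elim w)
        then show ?case using U_space[of w] by (simp add: a)
      qed
      with B(1) show ?thesis by blast
    qed
  next
    case Empty show ?case by (intro bexI[of _ "{}"]) auto
  next
    case (Compl a)
    then obtain B where B: "B \<in> sets \<nu>" "AE w in N. w \<in> a \<longleftrightarrow> U w \<in> B" by blast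
    have "AE w in N. w \<in> space \<nu> - a \<longleftrightarrow> U w \<in> space \<nu> - B"
      using B(2) AE_space
    proof eventually_elim
      case (elim w) then show ?case using U_space[of w] by simp
    qed
    with B(1) show ?case by blast
  next
    case (Union a)
    then have "\<forall>i. \<exists>B. B \<in> sets \<nu> \<and> (AE w in N. w \<in> a i \<longleftrightarrow> U w \<in> B)" by blast
    from choice[OF this] obtain B where B: "\<forall>i. B i \<in> sets \<nu> \<and> (AE w in N. w \<in> a i \<longleftrightarrow> U w \<in> B i)" by blast
    then have "AE w in N. \<forall>i. w \<in> a i \<longleftrightarrow> U w \<in> B i" by (simp add: AE_all_countable)
    then have "AE w in N. w \<in> (\<Union>i. a i) \<longleftrightarrow> U w \<in> (\<Union>i. B i)" by eventually_elim blast
    moreover have "(\<Union>i. B i) \<in> sets \<nu>" using B by blast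
    ultimately show ?case by blast
  qed
qed

text \<open>A factorisation of Doob-Dynkin type up to null sets: the sublevel sets of
  \<open>h\<close> at rational levels are factored one by one, and the function is rebuilt from
  countably many of them.\<close>

lemma factor_real:
  assumes F1G1: "sets (F 1) \<subseteq> sets (G 1)" and h: "h \<in> borel_measurable \<nu>"
  shows "\<exists>\<psi>\<in>borel_measurable \<nu>. AE w in N. h w = (\<psi> (U w) :: real)"
proof -
  have "\<forall>q. \<exists>B. B \<in> sets \<nu> \<and> (AE w in N. w \<in> {w \<in> space \<nu>. h w < real_of_rat q} \<longleftrightarrow> U w \<in> B)"
  proof
    fix q
    have "{w \<in> space \<nu>. h w < real_of_rat q} \<in> sets \<nu>" using h by measurable
    then have "{w \<in> space \<nu>. h w < real_of_rat q} \<in> sets (G 1)" using sets_nu_F1 F1G1 by blast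
    from G1_factor[OF this] show "\<exists>B. B \<in> sets \<nu> \<and> (AE w in N. w \<in> {w \<in> space \<nu>. h w < real_of_rat q} \<longleftrightarrow> U w \<in> B)"
      by blast
  qed
  from choice[OF this] obtain B where B: "\<forall>q. B q \<in> sets \<nu> \<and> (AE w in N. w \<in> {w \<in> space \<nu>. h w < real_of_rat q} \<longleftrightarrow> U w \<in> B q)"
    by blast
  then have Bm[measurable]: "B q \<in> sets \<nu>" for q by blast
  from B have ae: "AE w in N. \<forall>q. w \<in> {w \<in> space \<nu>. h w < real_of_rat q} \<longleftrightarrow> U w \<in> B q"
    by (simp add: AE_all_countable)
  \<comment> \<open>The smallest rational level whose event contains the point. The infimum is taken
    in \<open>ereal\<close> because at points irrelevant to \<open>U\<close> the sets
    \<open>B q\<close> are unconstrained and it may be infinite.\<close>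
  define \<phi> :: "_ \<Rightarrow> ereal" where "\<phi> x = (INF q. if x \<in> B q then ereal (real_of_rat q) else \<infinity>)" for x
  have \<phi>m: "\<phi> \<in> borel_measurable \<nu>"
    unfolding \<phi>_def[abs_def] by (intro borel_measurable_INF) measurable
  have "AE w in N. h w = real_of_ereal (\<phi> (U w))"
    using ae AE_space
  proof eventually_elim
    case (elim w)
    then have mem: "U w \<in> B q \<longleftrightarrow> h w < real_of_rat q" for q by simp
    have "\<phi> (U w) = ereal (h w)"
    proof (rule antisym)
      show "\<phi> (U w) \<le> ereal (h w)"
      proof (rule dense_ge)
        fix y assume "ereal (h w) < y"
        from ereal_dense3[OF this] obtain q where q: "ereal (h w) < ereal (real_of_rat q)" "ereal (real_of_rat q) < y" by blast
        have "\<phi> (U w) \<le> (if U w \<in> B q then ereal (real_of_rat q) else \<infinity>)" unfolding \<phi>_def by (rule INF_lower) simp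
        also have "\<dots> = ereal (real_of_rat q)" using q(1) mem by simp
        finally show "\<phi> (U w) \<le> y" using q(2) by simp
      qed
      show "ereal (h w) \<le> \<phi> (U w)"
        unfolding \<phi>_def using mem by (intro INF_greatest) (auto intro: less_imp_le)
    qed
    then show ?case by simp
  qed
  moreover have "(\<lambda>x. real_of_ereal (\<phi> x)) \<in> borel_measurable \<nu>" using \<phi>m by measurable
  ultimately show ?thesis by (intro bexI[of _ "\<lambda>x. real_of_ereal (\<phi> x)"])
qed

end

section \<open>Gluing a path from its values at rational times\<close>

definition dyadic :: "nat \<Rightarrow> real \<Rightarrow> rat" where
  "dyadic n t = of_int \<lfloor>2 ^ n * t\<rfloor> / 2 ^ n"

lemma of_rat_dyadic: "real_of_rat (dyadic n t) = of_int \<lfloor>2 ^ n * t\<rfloor> / 2 ^ n"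
  by (simp add: dyadic_def of_rat_divide of_rat_power)

lemma dyadic_bounds: "t - 1 / 2 ^ n \<le> real_of_rat (dyadic n t)" "real_of_rat (dyadic n t) \<le> t"
proof -
  have "2 ^ n * t - 1 \<le> of_int \<lfloor>2 ^ n * t\<rfloor>" "of_int \<lfloor>2 ^ n * t\<rfloor> \<le> 2 ^ n * t" by linarith+
  then have "(2 ^ n * t - 1) / 2 ^ n \<le> real_of_rat (dyadic n t)" "real_of_rat (dyadic n t) \<le> (2 ^ n * t) / 2 ^ n"
    unfolding of_rat_dyadic by (intro divide_right_mono; simp)+
  then show "t - 1 / 2 ^ n \<le> real_of_rat (dyadic n t)" "real_of_rat (dyadic n t) \<le> t"
    by (simp_all add: diff_divide_distrib)
qed

lemma dyadic_unit:
  assumes t: "t \<in> {0..1}"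
  shows "real_of_rat (dyadic n t) \<in> {0..1}"
proof -
  have "0 \<le> real_of_rat (dyadic n t)" unfolding of_rat_dyadic using t by simp
  then show ?thesis
    using dyadic_bounds(2)[of n t] t unfolding atLeastAtMost_iff by linarith
qed

lemma dyadic_tendsto: "(\<lambda>n. real_of_rat (dyadic n t)) \<longlonglongrightarrow> t"
proof (rule tendsto_sandwich)
  have "(\<lambda>n. t - (1 / 2) ^ n) \<longlonglongrightarrow> t - 0"
    by (intro tendsto_diff tendsto_const LIMSEQ_power_zero) simp
  then show "(\<lambda>n. t - 1 / 2 ^ n) \<longlonglongrightarrow> t" by (simp add: power_one_over)
qed (auto intro!: always_eventually dyadic_bounds)

context drift_space
begin

text \<open>Each coordinate at a fixed time is a function of \<open>U w\<close> outside a null set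
  depending on that time. Restricting to rational times leaves a single null set, and continuity of
  the paths determines the remaining times.\<close>

lemma inverse_exists:
  assumes F1G1: "sets (F 1) \<subseteq> sets (G 1)"
  shows "\<exists>V\<in>measurable N path_space. absolutely_continuous \<nu> (image_law N V) \<and> (AE w in \<nu>. V (U w) = w)"
proof -
  have id_nu: "(\<lambda>w. w) \<in> measurable \<nu> path_space" using sets_nu by (simp cong: measurable_cong_sets)
  \<comment> \<open>Stated for all pairs of a real time and a component, with the constant 0 as a
    default outside \<open>[0, 1]\<close>, so that one application of choice covers
    everything.\<close>
  have "\<forall>p. \<exists>\<psi>. \<psi> \<in> borel_measurable \<nu> \<and> (fst p \<in> {0..1} \<longrightarrow> (AE w in N. w (fst p) $ snd p = \<psi> (U w)))"
  proof
    fix p :: "real \<times> 'n"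
    show "\<exists>\<psi>. \<psi> \<in> borel_measurable \<nu> \<and> (fst p \<in> {0..1} \<longrightarrow> (AE w in N. w (fst p) $ snd p = \<psi> (U w)))"
    proof (cases "fst p \<in> {0..1}")
      case True
      have "(\<lambda>w. w (fst p) $ snd p) \<in> borel_measurable \<nu>"
        by (rule borel_measurable_component[OF measurable_path_coord[OF id_nu True]])
      from factor_real[OF F1G1 this] show ?thesis by blast
    next
      case False
      then show ?thesis by (intro exI[of _ "\<lambda>_. 0"] conjI impI borel_measurable_const) blast
    qed
  qed
  from choice[OF this] obtain \<psi> where
    "\<forall>p. \<psi> p \<in> borel_measurable \<nu> \<and> (fst p \<in> {0..1} \<longrightarrow> (AE w in N. w (fst p) $ snd p = \<psi> p (U w)))" by blast
  then have \<psi>: "\<psi> (t, j) \<in> borel_measurable \<nu>"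
    and \<psi>_ae: "t \<in> {0..1} \<Longrightarrow> AE w in N. w t $ j = \<psi> (t, j) (U w)" for t j by fastforce+
  define Y where "Y q x = (\<chi> j. \<psi> (real_of_rat q, j) x)" for q x
  have Ym[measurable]: "Y q \<in> borel_measurable \<nu>" for q
    by (rule borel_measurable_vecI) (simp add: Y_def \<psi>)
  have "AE w in N. \<forall>q. real_of_rat q \<in> {0..1} \<longrightarrow> w (real_of_rat q) = Y q (U w)"
    unfolding AE_all_countable
  proof
    fix q
    show "AE w in N. real_of_rat q \<in> {0..1} \<longrightarrow> w (real_of_rat q) = Y q (U w)"
    proof (cases "real_of_rat q \<in> {0..1}")
      case True
      have "AE w in N. \<forall>j. w (real_of_rat q) $ j = \<psi> (real_of_rat q, j) (U w)"
        unfolding AE_all_countable using \<psi>_ae[OF True] by blast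
      then show ?thesis by eventually_elim (simp add: Y_def vec_eq_iff)
    next
      case False
      then show ?thesis by (intro AE_I2) blast
    qed
  qed
  then have Yae: "AE w in \<nu>. \<forall>q. real_of_rat q \<in> {0..1} \<longrightarrow> w (real_of_rat q) = Y q (U w)"
    by (simp only: AE_completion_iff)
  \<comment> \<open>Uniform continuity of \<open>Y\<close> in the rational times of
    \<open>[0, 1]\<close>, with both tolerances of the form \<open>inverse (real (Suc n))\<close>:
    all quantifiers are countable, so the set is measurable.\<close>
  define good where "good x \<longleftrightarrow> (\<forall>n :: nat. \<exists>m :: nat. \<forall>p q. real_of_rat p \<in> {0..1} \<longrightarrow> real_of_rat q \<in> {0..1} \<longrightarrow>
      \<bar>real_of_rat p - real_of_rat q\<bar> < inverse (real (Suc m)) \<longrightarrow> norm (Y p x - Y q x) \<le> inverse (real (Suc n)))" for x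
  have goodm[measurable]: "Measurable.pred \<nu> good"
    unfolding good_def[abs_def] by measurable
  \<comment> \<open>The zero path is the default off \<open>good\<close>, so that \<open>V\<close>
    takes values in \<open>path_space\<close> at every point. The limit runs along a fixed dyadic
    sequence, which keeps each coordinate measurable.\<close>
  define V where "V x = (\<lambda>t\<in>{0..1}. if good x then lim (\<lambda>n. Y (dyadic n t) x) else 0)" for x
  \<comment> \<open>A uniformly continuous function on the rational times extends continuously to
    their closure, and the dyadic limits compute this extension.\<close>
  have lim_path: "\<exists>g. continuous_on {0..1} g \<and> (\<forall>t\<in>{0..1}. V x t = g t)" if g: "good x" for x
  proof -
    let ?S = "{t \<in> {0..1}. t \<in> range real_of_rat}"
    let ?f = "\<lambda>t. Y (inv real_of_rat t) x"
    have inv: "inv real_of_rat (real_of_rat q) = q" for q by (intro inv_f_f injI) simp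
    have "uniformly_continuous_on ?S ?f"
      unfolding uniformly_continuous_on_def
    proof (intro allI impI)
      fix e :: real assume "0 < e"
      then obtain n where n: "inverse (real (Suc n)) < e" using reals_Archimedean by blast
      from g obtain m where m: "\<forall>p q. real_of_rat p \<in> {0..1} \<longrightarrow> real_of_rat q \<in> {0..1} \<longrightarrow>
        \<bar>real_of_rat p - real_of_rat q\<bar> < inverse (real (Suc m)) \<longrightarrow> norm (Y p x - Y q x) \<le> inverse (real (Suc n))"
        unfolding good_def by blast
      show "\<exists>d>0. \<forall>t\<in>?S. \<forall>s\<in>?S. dist s t < d \<longrightarrow> dist (?f s) (?f t) < e"
      proof (intro exI[of _ "inverse (real (Suc m))"] conjI ballI impI)
        fix t s assume "t \<in> ?S" "s \<in> ?S" and d: "dist s t < inverse (real (Suc m))"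
        then obtain p q where pq: "t = real_of_rat p" "s = real_of_rat q" "real_of_rat p \<in> {0..1}" "real_of_rat q \<in> {0..1}" by auto
        have "norm (Y q x - Y p x) \<le> inverse (real (Suc n))"
          using m pq(3,4) d unfolding pq dist_real_def by blast
        then show "dist (?f s) (?f t) < e" using n unfolding pq inv dist_norm by linarith
      qed simp
    qed
    then obtain h where h: "uniformly_continuous_on (closure ?S) h" "\<And>t. t \<in> ?S \<Longrightarrow> ?f t = h t"
      by (rule uniformly_continuous_on_extension_on_closure) blast
    have hc: "continuous_on (closure ?S) h" by (rule uniformly_continuous_imp_continuous[OF h(1)])
    have S: "real_of_rat (dyadic n t) \<in> ?S" if "t \<in> {0..1}" for n t using dyadic_unit[OF that] by blast
    have cl: "t \<in> closure ?S" if "t \<in> {0..1}" for t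
      unfolding closure_sequential by (intro exI[of _ "\<lambda>n. real_of_rat (dyadic n t)"] conjI allI S[OF that] dyadic_tendsto)
    have "V x t = h t" if t: "t \<in> {0..1}" for t
    proof -
      have "(\<lambda>n. h (real_of_rat (dyadic n t))) \<longlonglongrightarrow> h t"
        by (rule continuous_on_tendsto_compose[OF hc dyadic_tendsto cl[OF t]])
           (intro always_eventually allI subsetD[OF closure_subset] S[OF t])
      moreover have "h (real_of_rat (dyadic n t)) = Y (dyadic n t) x" for n
        using h(2)[OF S[OF t], of n] by (simp add: inv)
      ultimately have "(\<lambda>n. Y (dyadic n t) x) \<longlonglongrightarrow> h t" by simp
      then show ?thesis using t g by (simp add: V_def limI)
    qed
    moreover have "continuous_on {0..1} h" by (rule continuous_on_subset[OF hc]) (use cl in blast)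
    ultimately show ?thesis by blast
  qed
  have V_space: "V x \<in> space path_space" for x
  proof -
    have "continuous_on {0..1} (V x)"
    proof (cases "good x")
      case True
      from lim_path[OF this] obtain g where g: "continuous_on {0..1} g" "\<forall>t\<in>{0..1}. V x t = g t" by blast
      show ?thesis by (rule continuous_on_eq[OF g(1)]) (simp add: g(2))
    next
      case False
      show ?thesis by (rule continuous_on_eq[OF continuous_on_const[of _ 0]]) (simp add: V_def False)
    qed
    then show ?thesis by (simp add: space_path_space V_def)
  qed
  have V_meas: "V \<in> measurable \<nu> path_space"
    unfolding measurable_path_space_iff
  proof (intro conjI ballI)
    fix t :: real assume t: "t \<in> {0..1}"
    have "(\<lambda>x. if good x then lim (\<lambda>n. Y (dyadic n t) x) else 0) \<in> borel_measurable \<nu>" by measurable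
    then show "(\<lambda>x. V x t) \<in> borel_measurable \<nu>" using t by (simp add: V_def)
  qed (use V_space in auto)
  have VU: "AE w in \<nu>. V (U w) = w"
    using Yae AE_space
  proof eventually_elim
    case (elim w)
    have w: "continuous_on {0..1} w" "w \<in> extensional {0..1}"
      using elim(2) by (auto simp: space_nu space_path_space)
    have Yw: "Y q (U w) = w (real_of_rat q)" if "real_of_rat q \<in> {0..1}" for q using elim(1) that by simp
    have good: "good (U w)"
      unfolding good_def
    proof
      fix n :: nat
      have "uniformly_continuous_on {0..1} w" by (rule compact_uniformly_continuous[OF w(1) compact_Icc])
      then obtain d where d: "0 < d" "\<And>s t. s \<in> {0..1} \<Longrightarrow> t \<in> {0..1} \<Longrightarrow> dist t s < d \<Longrightarrow> dist (w t) (w s) < inverse (real (Suc n))"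
        unfolding uniformly_continuous_on_def
        by (metis inverse_positive_iff_positive of_nat_0_less_iff zero_less_Suc)
      obtain m where m: "inverse (real (Suc m)) < d" using reals_Archimedean[OF d(1)] by blast
      show "\<exists>m :: nat. \<forall>p q. real_of_rat p \<in> {0..1} \<longrightarrow> real_of_rat q \<in> {0..1} \<longrightarrow>
        \<bar>real_of_rat p - real_of_rat q\<bar> < inverse (real (Suc m)) \<longrightarrow> norm (Y p (U w) - Y q (U w)) \<le> inverse (real (Suc n))"
      proof (intro exI[of _ m] allI impI)
        fix p q assume p: "real_of_rat p \<in> {0..1}" and q: "real_of_rat q \<in> {0..1}"
          and "\<bar>real_of_rat p - real_of_rat q\<bar> < inverse (real (Suc m))"
        then have "dist (real_of_rat p) (real_of_rat q) < d" using m by (simp add: dist_real_def)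
        from d(2)[OF q p this] show "norm (Y p (U w) - Y q (U w)) \<le> inverse (real (Suc n))"
          unfolding Yw[OF p] Yw[OF q] dist_norm by simp
      qed
    qed
    show ?case
    proof
      fix t
      show "V (U w) t = w t"
      proof (cases "t \<in> {0..1}")
        case True
        have "(\<lambda>n. w (real_of_rat (dyadic n t))) \<longlonglongrightarrow> w t"
          by (rule continuous_on_tendsto_compose[OF w(1) dyadic_tendsto True]) (use dyadic_unit[OF True] in simp)
        then have "(\<lambda>n. Y (dyadic n t) (U w)) \<longlonglongrightarrow> w t"
          by (simp only: Yw[OF dyadic_unit[OF True]])
        then show ?thesis using True good by (simp add: V_def limI)
      next
        case False
        then show ?thesis using w(2) by (auto simp: V_def extensional_def)
      qed
    qed
  qed
  have V_N: "V \<in> measurable N path_space" by (rule measurable_completion[OF V_meas])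
  \<comment> \<open>As \<open>V (U w) = w\<close> almost surely, the preimage under \<open>U\<close>
    of the preimage of \<open>E\<close> under \<open>V\<close> is \<open>E\<close> up to a null set,
    hence null; by \<open>W_null\<close> the preimage under \<open>V\<close> is then null as
    well.\<close>
  have "absolutely_continuous \<nu> (image_law N V)"
    unfolding absolutely_continuous_def
  proof
    fix E assume E: "E \<in> null_sets \<nu>"
    then have Ep: "E \<in> sets path_space" using sets_nu by auto
    let ?A = "V -` E \<inter> space \<nu>"
    have A: "?A \<in> sets \<nu>" by (rule measurable_sets[OF V_meas Ep])
    have "AE w in N. U w \<notin> ?A"
      using VU AE_not_in[OF E] unfolding AE_completion_iff by eventually_elim simp
    then have "AE w in N. w \<notin> ?A" unfolding W_null[OF u A] .
    then have AE: "AE w in N. V w \<notin> E" using AE_space by eventually_elim simp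
    have "AE x in image_law N V. x \<notin> E"
      unfolding image_law_def by (subst AE_distr_iff[OF V_N]) (use AE Ep in auto)
    moreover have "E \<in> sets (image_law N V)" using Ep by (simp add: image_law_def)
    ultimately show "E \<in> null_sets (image_law N V)" by (simp add: AE_iff_null_sets)
  qed
  with V_N VU show ?thesis by blast
qed

lemma invertible_iff_log_L: "as_invertible \<nu> U \<longleftrightarrow> (AE w in N. log_L w = neg_log_rho w)"
proof
  assume ae: "AE w in N. log_L w = neg_log_rho w"
  from inverse_exists[OF F1_subset_G1[OF log_L_imp_rho_G1[OF ae]]]
  show "as_invertible \<nu> U" unfolding as_invertible_def using U_path ac_theta by blast
qed (rule invertible_imp_log_L)

end

theorem theorem2:
  fixes \<nu> :: "(real \<Rightarrow> real ^ 'n::finite) measure"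
    and \<beta> :: "(real \<Rightarrow> real ^ 'n) \<Rightarrow> (real \<Rightarrow> real ^ 'n)"
    and W :: "((real \<Rightarrow> real ^ 'n) \<Rightarrow> (real \<Rightarrow> real ^ 'n)) \<Rightarrow> (real \<Rightarrow> real ^ 'n) \<Rightarrow> (real \<Rightarrow> real ^ 'n)"
    and u :: "(real \<Rightarrow> real ^ 'n) \<Rightarrow> (real \<Rightarrow> real ^ 'n)"
  assumes prob: "prob_space \<nu>" and sets_nu: "sets \<nu> = sets path_space"
    and bm: "brownian_motion \<nu> \<beta>"
    and W_meas: "\<And>v. v \<in> bounded_drifts \<nu> \<Longrightarrow> W v \<in> measurable (completion \<nu>) path_space"
    and filtration_eq: "\<And>t. t \<in> {0..1} \<Longrightarrow>
          sets (completed_filtration \<nu> \<beta> t) = sets (canonical_filtration \<nu> t)"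
    and W_zero: "\<And>w. w \<in> space \<nu> \<Longrightarrow> W (\<lambda>_. zero_path) w = w"
    and W_law: "\<And>v. v \<in> bounded_drifts \<nu> \<Longrightarrow>
          image_law (density (completion \<nu>) (\<lambda>w. ennreal (girsanov_density \<nu> \<beta> v w))) (W v) =
          image_law (completion \<nu>) (\<lambda>w. w)"
    and beta_W: "\<And>v. v \<in> bounded_drifts \<nu> \<Longrightarrow>
          (AE w in \<nu>. \<beta> (W v w) = path_add (\<beta> w) (v w))"
    and W_comp: "\<And>v v'. v \<in> bounded_drifts \<nu> \<Longrightarrow> v' \<in> bounded_drifts \<nu> \<Longrightarrow>
          (AE w in \<nu>. W v (W v' w) = W (\<lambda>w. path_add (v' w) (v (W v' w))) w)"
    and u: "u \<in> bounded_drifts \<nu>"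
  shows "as_invertible \<nu> (W u) \<longleftrightarrow>
         rel_entropy (image_law (completion \<nu>) (W u)) \<nu> =
           ereal (1 / 2 * (\<integral>w. cm_norm_sq (u w) \<partial>completion \<nu>))"
proof -
  interpret prob_space \<nu> by (rule prob)
  interpret drift_space \<nu> \<beta> W u
    by unfold_locales (rule sets_nu bm filtration_eq W_meas W_law beta_W u; assumption?)+
  show ?thesis unfolding invertible_iff_log_L entropy_iff ..
qed

end
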